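(* Let $Y$ be a second countable Hilbert manifold and $G$ a finite dimensional Lie group acting on $Y$ by an action of class $C^1$ such that $\dim D_y$ does not depend on $y\in Y$. Let $(S_n)_{n\ge1}$ be a countable family of submanifolds of $Y$ that are transverse to $D$ and such that every orbit of $G$ intersects some $S_n$. Let $f:Y\to\mathbb R$ be a smooth $G$-invariant function. Then $f$ is $G$-Morse if and only if $f|_{S_n}$ is a Morse function for all $n$.
   Context: For $y\in Y$, let $\beta_y:G\to Y$, $\beta_y(g)=g\cdot y$; $D_y\subset T_yY$ is the image of $\mathrm d\beta_y(1):\mathfrak g\to T_yY$, where $\mathfrak g$ is the Lie algebra of $G$. A submanifold $S\subset Y$ is transverse to $D$ if for every $y\in S$, $T_yY$ is the direct sum $T_yS\oplus D_y$. A $G$-invariant function $f$ is $G$-nondegenerate at a critical point $y$ if the Hessian $\mathrm H^f(y)$ is strongly nondegenerate (i.e., represented by an isomorphism) when restricted to some closed complement of $D_y$ in $T_yY$; $f$ is $G$-Morse if it is $G$-nondegenerate at every critical point. A function on a Hilbert manifold is Morse if its Hessian is strongly nondegenerate at each critical point. *)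

theory Defs
  imports "HOL-Analysis.Analysis" "HOL-Algebra.Group_Action"
begin

section \<open>Differential calculus on open subsets of closed subspaces\<close>

text \<open>
  Charts take values in closed subspaces of a Hilbert space (rather than in the whole
  space), so that a manifold and its submanifolds are modelled on the same type.
  Multilinear maps of \<open>j\<close> arguments are represented as functions on lists of length \<open>j\<close>.
\<close>

definition bounded_multilinear_on ::
  "nat \<Rightarrow> 'a::real_normed_vector set \<Rightarrow> ('a list \<Rightarrow> 'b::real_normed_vector) \<Rightarrow> bool" where
  "bounded_multilinear_on j E T \<longleftrightarrow>
    (\<forall>us\<in>lists E. \<forall>ws\<in>lists E. \<forall>u\<in>E. \<forall>v\<in>E. \<forall>a b. length us + 1 + length ws = j \<longrightarrow>
       T (us @ [a *\<^sub>R u + b *\<^sub>R v] @ ws) = a *\<^sub>R T (us @ [u] @ ws) + b *\<^sub>R T (us @ [v] @ ws)) \<and>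
    (\<exists>C. \<forall>vs\<in>lists E. length vs = j \<longrightarrow> norm (T vs) \<le> C * (\<Prod>v\<leftarrow>vs. norm v))"

text \<open>
  \<open>has_derivs k E V g D\<close>: on \<open>V\<close>, a relatively open subset of the subspace \<open>E\<close>,
  the map \<open>g\<close> is \<open>k\<close> times continuously Frechet differentiable (all
  limits being taken in the operator norm of multilinear maps on \<open>E\<close>), and
  \<open>D x [v\<^sub>1, \<dots>, v\<^sub>j]\<close> is its \<open>j\<close>-th derivative at \<open>x\<close> applied to \<open>v\<^sub>1, \<dots>, v\<^sub>j \<in> E\<close>, for
  \<open>j \<le> k\<close>. The direction of the last differentiation is the head of the list.
\<close>

definition has_derivs ::
  "nat \<Rightarrow> 'a::real_normed_vector set \<Rightarrow> 'a set \<Rightarrow> ('a \<Rightarrow> 'b::real_normed_vector)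
    \<Rightarrow> ('a \<Rightarrow> 'a list \<Rightarrow> 'b) \<Rightarrow> bool" where
  "has_derivs k E V g D \<longleftrightarrow>
    (\<forall>x\<in>V. D x [] = g x) \<and>
    (\<forall>j\<le>k. \<forall>x\<in>V. bounded_multilinear_on j E (D x)) \<and>
    (\<forall>j<k. \<forall>x\<in>V. \<forall>e>0. \<exists>d>0. \<forall>z\<in>V. dist z x < d \<longrightarrow>
       (\<forall>vs\<in>lists E. length vs = j \<longrightarrow>
          norm (D z vs - D x vs - D x ((z - x) # vs)) \<le> e * norm (z - x) * (\<Prod>v\<leftarrow>vs. norm v))) \<and>
    (\<forall>x\<in>V. \<forall>e>0. \<exists>d>0. \<forall>z\<in>V. dist z x < d \<longrightarrow>
       (\<forall>vs\<in>lists E. length vs = k \<longrightarrow> norm (D z vs - D x vs) \<le> e * (\<Prod>v\<leftarrow>vs. norm v)))"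

definition Ck_on ::
  "nat \<Rightarrow> 'a::real_normed_vector set \<Rightarrow> 'a set \<Rightarrow> ('a \<Rightarrow> 'b::real_normed_vector) \<Rightarrow> bool" where
  "Ck_on k E V g \<longleftrightarrow> (\<exists>D. has_derivs k E V g D)"

definition smooth_on ::
  "'a::real_normed_vector set \<Rightarrow> 'a set \<Rightarrow> ('a \<Rightarrow> 'b::real_normed_vector) \<Rightarrow> bool" where
  "smooth_on E V g \<longleftrightarrow> (\<forall>k. Ck_on k E V g)"

text \<open>
  The derivative of order \<open>length vs\<close> at \<open>x\<close>, applied to \<open>vs\<close>. Since \<open>V\<close> is open in \<open>E\<close>, the
  value does not depend on the choice of \<open>D\<close> as long as \<open>x \<in> V\<close> and \<open>vs\<close> lies in \<open>E\<close>.
\<close>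

definition deriv_at ::
  "'a::real_normed_vector set \<Rightarrow> 'a set \<Rightarrow> ('a \<Rightarrow> 'b::real_normed_vector) \<Rightarrow> 'a \<Rightarrow> 'a list \<Rightarrow> 'b" where
  "deriv_at E V g x vs = (SOME D. has_derivs (length vs) E V g D) x vs"

text \<open>On open subsets of the whole space this is the library's Frechet derivative.\<close>

lemma has_derivs_1_UNIV_has_derivative:
  fixes g :: "'a::real_normed_vector \<Rightarrow> 'b::real_normed_vector"
  assumes D: "has_derivs 1 UNIV V g D" and V: "open V" and x: "x \<in> V"
  shows "(g has_derivative (\<lambda>v. D x [v])) (at x)"
proof -
  have ml: "bounded_multilinear_on 1 UNIV (D x)" and g0: "\<And>z. z \<in> V \<Longrightarrow> D z [] = g z"
    using D x unfolding has_derivs_def by auto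
  have lin: "D x [a *\<^sub>R u + b *\<^sub>R v] = a *\<^sub>R D x [u] + b *\<^sub>R D x [v]" for a b u v
  proof -
    have "\<forall>us\<in>lists UNIV. \<forall>ws\<in>lists UNIV. \<forall>u\<in>UNIV. \<forall>v\<in>UNIV. \<forall>a b. length us + 1 + length ws = 1 \<longrightarrow>
       D x (us @ [a *\<^sub>R u + b *\<^sub>R v] @ ws) = a *\<^sub>R D x (us @ [u] @ ws) + b *\<^sub>R D x (us @ [v] @ ws)"
      using ml unfolding bounded_multilinear_on_def by blast
    from this[rule_format, of "[]" "[]" u v a b] show ?thesis by simp
  qed
  obtain C where C: "\<forall>vs\<in>lists UNIV. length vs = 1 \<longrightarrow> norm (D x vs) \<le> C * (\<Prod>v\<leftarrow>vs. norm v)"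
    using ml unfolding bounded_multilinear_on_def by blast
  have bl: "bounded_linear (\<lambda>v. D x [v])"
  proof (rule bounded_linear_intro[where K = C])
    show "D x [u + v] = D x [u] + D x [v]" for u v using lin[of 1 u 1 v] by simp
    show "D x [r *\<^sub>R v] = r *\<^sub>R D x [v]" for r v using lin[of r v 0 v] by simp
    show "norm (D x [v]) \<le> norm v * C" for v using C[rule_format, of "[v]"] by (simp add: mult.commute)
  qed
  have "\<exists>d>0. \<forall>z. norm (z - x) < d \<longrightarrow> norm (g z - g x - D x [z - x]) \<le> e * norm (z - x)"
    if "e > 0" for e
  proof -
    have "\<forall>j<1. \<forall>x\<in>V. \<forall>e>0. \<exists>d>0. \<forall>z\<in>V. dist z x < d \<longrightarrow>
       (\<forall>vs\<in>lists UNIV. length vs = j \<longrightarrow>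
          norm (D z vs - D x vs - D x ((z - x) # vs)) \<le> e * norm (z - x) * (\<Prod>v\<leftarrow>vs. norm v))"
      using D unfolding has_derivs_def by blast
    from this[rule_format, of 0 x e] obtain d where "d > 0"
      and d: "\<And>z. z \<in> V \<Longrightarrow> dist z x < d \<Longrightarrow>
        norm (D z [] - D x [] - D x [z - x]) \<le> e * norm (z - x)"
      using x \<open>e > 0\<close> by force
    obtain r where "r > 0" "ball x r \<subseteq> V" using V x openE by blast
    show ?thesis
      using \<open>d > 0\<close> \<open>r > 0\<close> \<open>ball x r \<subseteq> V\<close> d g0 x
      by (intro exI[of _ "min d r"]) (auto simp: subset_iff dist_norm norm_minus_commute)
  qed
  then show ?thesis using bl unfolding has_derivative_at_alt by blast
qed


section \<open>Hilbert manifolds\<close>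

record ('p, 'h) chart =
  cdom :: "'p set"
  cmodel :: "'h set"
  cmap :: "'p \<Rightarrow> 'h"

record ('p, 'h) mfd =
  mtop :: "'p topology"
  atlas :: "('p, 'h) chart set"

abbreviation points :: "('p, 'h) mfd \<Rightarrow> 'p set" where
  "points M \<equiv> topspace (mtop M)"

abbreviation cinv :: "('p, 'h) chart \<Rightarrow> 'h \<Rightarrow> 'p" where
  "cinv c \<equiv> inv_into (cdom c) (cmap c)"

definition is_chart ::
  "'p topology \<Rightarrow> ('p, 'h::{real_inner, complete_space}) chart \<Rightarrow> bool" where
  "is_chart T c \<longleftrightarrow>
    openin T (cdom c) \<and> subspace (cmodel c) \<and> closed (cmodel c) \<and>
    openin (top_of_set (cmodel c)) (cmap c ` cdom c) \<and>
    homeomorphic_map (subtopology T (cdom c)) (top_of_set (cmap c ` cdom c)) (cmap c)"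

definition compatible ::
  "('p, 'h::{real_inner, complete_space}) chart \<Rightarrow> ('p, 'h) chart \<Rightarrow> bool" where
  "compatible c c' \<longleftrightarrow>
    smooth_on (cmodel c) (cmap c ` (cdom c \<inter> cdom c')) (cmap c' \<circ> cinv c) \<and>
    smooth_on (cmodel c') (cmap c' ` (cdom c \<inter> cdom c')) (cmap c \<circ> cinv c')"

definition hilbert_manifold :: "('p, 'h::{real_inner, complete_space}) mfd \<Rightarrow> bool" where
  "hilbert_manifold M \<longleftrightarrow>
    Hausdorff_space (mtop M) \<and>
    (\<forall>c\<in>atlas M. is_chart (mtop M) c) \<and>
    points M = (\<Union>c\<in>atlas M. cdom c) \<and>
    (\<forall>c\<in>atlas M. \<forall>c'\<in>atlas M. compatible c c')"

definition max_atlas ::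
  "('p, 'h::{real_inner, complete_space}) mfd \<Rightarrow> ('p, 'h) chart set" where
  "max_atlas M = {c. is_chart (mtop M) c \<and> (\<forall>c'\<in>atlas M. compatible c c')}"

definition prod_mfd ::
  "('p, 'h) mfd \<Rightarrow> ('q, 'k) mfd \<Rightarrow> ('p \<times> 'q, 'h \<times> 'k) mfd" where
  "prod_mfd M N =
    \<lparr>mtop = prod_topology (mtop M) (mtop N),
     atlas = {\<lparr>cdom = cdom c \<times> cdom c', cmodel = cmodel c \<times> cmodel c',
               cmap = map_prod (cmap c) (cmap c')\<rparr> | c c'. c \<in> atlas M \<and> c' \<in> atlas N}\<rparr>"

definition Ck_map ::
  "nat \<Rightarrow> ('p, 'h::{real_inner, complete_space}) mfd \<Rightarrow> ('q, 'k::{real_inner, complete_space}) mfd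
    \<Rightarrow> ('p \<Rightarrow> 'q) \<Rightarrow> bool" where
  "Ck_map k M N F \<longleftrightarrow>
    continuous_map (mtop M) (mtop N) F \<and>
    (\<forall>c\<in>atlas M. \<forall>c'\<in>atlas N.
       Ck_on k (cmodel c) (cmap c ` (cdom c \<inter> F -` cdom c')) (cmap c' \<circ> F \<circ> cinv c))"

definition smooth_map ::
  "('p, 'h::{real_inner, complete_space}) mfd \<Rightarrow> ('q, 'k::{real_inner, complete_space}) mfd
    \<Rightarrow> ('p \<Rightarrow> 'q) \<Rightarrow> bool" where
  "smooth_map M N F \<longleftrightarrow> (\<forall>k. Ck_map k M N F)"

definition smooth_fun ::
  "('p, 'h::{real_inner, complete_space}) mfd \<Rightarrow> ('p \<Rightarrow> real) \<Rightarrow> bool" where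
  "smooth_fun M f \<longleftrightarrow> (\<forall>c\<in>atlas M. smooth_on (cmodel c) (cmap c ` cdom c) (f \<circ> cinv c))"


section \<open>Tangent spaces and differentials\<close>

text \<open>
  A chart \<open>c\<close> at \<open>y\<close> identifies the tangent space at \<open>y\<close>, as a topological vector space, with
  \<open>cmodel c\<close>. We realise the tangent space at each point through one chosen chart at that point;
  another choice changes it by the toplinear isomorphism given by the derivative of the
  transition map, under which all notions below are invariant.
\<close>

definition chart_at :: "('p, 'h) mfd \<Rightarrow> 'p \<Rightarrow> ('p, 'h) chart" where
  "chart_at M y = (SOME c. c \<in> atlas M \<and> y \<in> cdom c)"

definition tangent_space :: "('p, 'h) mfd \<Rightarrow> 'p \<Rightarrow> 'h set" where
  "tangent_space M y = cmodel (chart_at M y)"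

definition differential ::
  "('p, 'h::{real_inner, complete_space}) mfd \<Rightarrow> ('q, 'k::{real_inner, complete_space}) mfd
    \<Rightarrow> ('p \<Rightarrow> 'q) \<Rightarrow> 'p \<Rightarrow> 'h \<Rightarrow> 'k" where
  "differential M N F y v =
    (let c = chart_at M y; c' = chart_at N (F y)
     in deriv_at (cmodel c) (cmap c ` (cdom c \<inter> F -` cdom c')) (cmap c' \<circ> F \<circ> cinv c) (cmap c y) [v])"

definition fun_differential ::
  "('p, 'h::{real_inner, complete_space}) mfd \<Rightarrow> ('p \<Rightarrow> real) \<Rightarrow> 'p \<Rightarrow> 'h \<Rightarrow> real" where
  "fun_differential M f y v =
    (let c = chart_at M y
     in deriv_at (cmodel c) (cmap c ` cdom c) (f \<circ> cinv c) (cmap c y) [v])"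

definition critical_point ::
  "('p, 'h::{real_inner, complete_space}) mfd \<Rightarrow> ('p \<Rightarrow> real) \<Rightarrow> 'p \<Rightarrow> bool" where
  "critical_point M f y \<longleftrightarrow>
    y \<in> points M \<and> (\<forall>v\<in>tangent_space M y. fun_differential M f y v = 0)"

text \<open>At a critical point the second derivative in a chart is the Hessian, a bilinear form on the
  tangent space that does not depend on the chart.\<close>

definition hessian ::
  "('p, 'h::{real_inner, complete_space}) mfd \<Rightarrow> ('p \<Rightarrow> real) \<Rightarrow> 'p \<Rightarrow> 'h \<Rightarrow> 'h \<Rightarrow> real" where
  "hessian M f y u v =
    (let c = chart_at M y
     in deriv_at (cmodel c) (cmap c ` cdom c) (f \<circ> cinv c) (cmap c y) [u, v])"

text \<open>For a closed subspace \<open>W\<close>: the form \<open>B\<close> is represented, with respect to the Hilbert space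
  inner product, by a toplinear isomorphism \<open>A\<close> of \<open>W\<close>.\<close>

definition strongly_nondegenerate_on ::
  "'h::{real_inner, complete_space} set \<Rightarrow> ('h \<Rightarrow> 'h \<Rightarrow> real) \<Rightarrow> bool" where
  "strongly_nondegenerate_on W B \<longleftrightarrow>
    (\<exists>A A'. homeomorphism W W A A' \<and>
       (\<forall>u\<in>W. \<forall>v\<in>W. \<forall>a b. A (a *\<^sub>R u + b *\<^sub>R v) = a *\<^sub>R A u + b *\<^sub>R A v) \<and>
       (\<forall>u\<in>W. \<forall>v\<in>W. B u v = inner (A u) v))"

definition Morse :: "('p, 'h::{real_inner, complete_space}) mfd \<Rightarrow> ('p \<Rightarrow> real) \<Rightarrow> bool" where
  "Morse M f \<longleftrightarrow>
    (\<forall>y. critical_point M f y \<longrightarrow> strongly_nondegenerate_on (tangent_space M y) (hessian M f y))"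


section \<open>Submanifolds\<close>

text \<open>Embedded submanifolds: around each of its points, \<open>S\<close> is flattened onto a closed linear
  subspace \<open>F\<close> of the model space by some chart of the maximal atlas. The restrictions of
  such charts form an atlas for \<open>S\<close> with its subspace topology.\<close>

definition sub_mfd :: "('p, 'h::{real_inner, complete_space}) mfd \<Rightarrow> 'p set \<Rightarrow> ('p, 'h) mfd" where
  "sub_mfd M S =
    \<lparr>mtop = subtopology (mtop M) S,
     atlas = {\<lparr>cdom = cdom c \<inter> S, cmodel = F, cmap = cmap c\<rparr> | c F.
       c \<in> max_atlas M \<and> subspace F \<and> closed F \<and> F \<subseteq> cmodel c \<and>
       cmap c ` (cdom c \<inter> S) = cmap c ` cdom c \<inter> F}\<rparr>"

definition submanifold :: "('p, 'h::{real_inner, complete_space}) mfd \<Rightarrow> 'p set \<Rightarrow> bool" where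
  "submanifold M S \<longleftrightarrow> S \<subseteq> points M \<and> S \<subseteq> (\<Union>c\<in>atlas (sub_mfd M S). cdom c)"

definition sub_tangent_space ::
  "('p, 'h::{real_inner, complete_space}) mfd \<Rightarrow> 'p set \<Rightarrow> 'p \<Rightarrow> 'h set" where
  "sub_tangent_space M S y =
    differential (sub_mfd M S) M (\<lambda>x. x) y ` tangent_space (sub_mfd M S) y"


section \<open>Actions of Lie groups\<close>

definition lie_group ::
  "('g, 'b) monoid_scheme \<Rightarrow> ('g, 'e::{real_inner, complete_space}) mfd \<Rightarrow> bool" where
  "lie_group G MG \<longleftrightarrow>
    group G \<and> hilbert_manifold MG \<and> points MG = carrier G \<and>
    smooth_map (prod_mfd MG MG) MG (\<lambda>(a, b). a \<otimes>\<^bsub>G\<^esub> b) \<and>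
    smooth_map MG MG (\<lambda>a. inv\<^bsub>G\<^esub> a)"

definition C1_action ::
  "('g, 'b) monoid_scheme \<Rightarrow> ('g, 'e::{real_inner, complete_space}) mfd
    \<Rightarrow> ('y, 'h::{real_inner, complete_space}) mfd \<Rightarrow> ('g \<Rightarrow> 'y \<Rightarrow> 'y) \<Rightarrow> bool" where
  "C1_action G MG Y act \<longleftrightarrow>
    group_action G (points Y) act \<and> Ck_map 1 (prod_mfd MG Y) Y (\<lambda>(g, y). act g y)"

definition orbit_tangent ::
  "('g, 'b) monoid_scheme \<Rightarrow> ('g, 'e::{real_inner, complete_space}) mfd
    \<Rightarrow> ('y, 'h::{real_inner, complete_space}) mfd \<Rightarrow> ('g \<Rightarrow> 'y \<Rightarrow> 'y) \<Rightarrow> 'y \<Rightarrow> 'h set" where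
  "orbit_tangent G MG Y act y =
    differential MG Y (\<lambda>g. act g y) \<one>\<^bsub>G\<^esub> ` tangent_space MG \<one>\<^bsub>G\<^esub>"

definition is_direct_sum :: "'h::real_vector set \<Rightarrow> 'h set \<Rightarrow> 'h set \<Rightarrow> bool" where
  "is_direct_sum E W D \<longleftrightarrow>
    subspace W \<and> subspace D \<and> W \<inter> D = {0} \<and> E = {w + d | w d. w \<in> W \<and> d \<in> D}"

definition transverse_to_orbits ::
  "('g, 'b) monoid_scheme \<Rightarrow> ('g, 'e::{real_inner, complete_space}) mfd
    \<Rightarrow> ('y, 'h::{real_inner, complete_space}) mfd \<Rightarrow> ('g \<Rightarrow> 'y \<Rightarrow> 'y) \<Rightarrow> 'y set \<Rightarrow> bool" where
  "transverse_to_orbits G MG Y act S \<longleftrightarrow>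
    (\<forall>y\<in>S. is_direct_sum (tangent_space Y y) (sub_tangent_space Y S y) (orbit_tangent G MG Y act y))"

definition G_invariant ::
  "('g, 'b) monoid_scheme \<Rightarrow> ('y, 'h) mfd \<Rightarrow> ('g \<Rightarrow> 'y \<Rightarrow> 'y) \<Rightarrow> ('y \<Rightarrow> real) \<Rightarrow> bool" where
  "G_invariant G Y act f \<longleftrightarrow> (\<forall>g\<in>carrier G. \<forall>y\<in>points Y. f (act g y) = f y)"

definition G_nondegenerate ::
  "('g, 'b) monoid_scheme \<Rightarrow> ('g, 'e::{real_inner, complete_space}) mfd
    \<Rightarrow> ('y, 'h::{real_inner, complete_space}) mfd \<Rightarrow> ('g \<Rightarrow> 'y \<Rightarrow> 'y) \<Rightarrow> ('y \<Rightarrow> real) \<Rightarrow> 'y \<Rightarrow> bool" where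
  "G_nondegenerate G MG Y act f y \<longleftrightarrow>
    (\<exists>W. closed W \<and> is_direct_sum (tangent_space Y y) W (orbit_tangent G MG Y act y) \<and>
       strongly_nondegenerate_on W (hessian Y f y))"

definition G_Morse ::
  "('g, 'b) monoid_scheme \<Rightarrow> ('g, 'e::{real_inner, complete_space}) mfd
    \<Rightarrow> ('y, 'h::{real_inner, complete_space}) mfd \<Rightarrow> ('g \<Rightarrow> 'y \<Rightarrow> 'y) \<Rightarrow> ('y \<Rightarrow> real) \<Rightarrow> bool" where
  "G_Morse G MG Y act f \<longleftrightarrow>
    (\<forall>y. critical_point Y f y \<longrightarrow> G_nondegenerate G MG Y act f y)"

end

theory Submission
  imports Defs
begin

text \<open>
  A critical orbit stays critical, and differentiating \<open>f (g y) = f y\<close> twice at a critical point \<open>y\<close>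
  expresses the Hessian at \<open>g y\<close> on the image of the differential of the action by the Hessian at
  \<open>y\<close>. Only one derivative of the action enters, because the terms with its second derivative are
  multiplied by \<open>df = 0\<close>; so a \<open>C\<^sup>1\<close> action suffices. For \<open>g = 1\<close> this puts \<open>D\<^sub>y\<close> into the radical of
  the Hessian, so strong nondegeneracy does not depend on the closed complement of \<open>D\<^sub>y\<close>; on a
  submanifold transverse to \<open>D\<close> one such complement is the tangent space, and a critical point of
  the restriction is critical for \<open>f\<close>.

  Conversely, move a critical point \<open>y\<close> along its orbit to \<open>z = g y\<close> in some \<open>S\<^sub>n\<close>. Then \<open>D\<^sub>z\<close> is the
  whole radical of the Hessian at \<open>z\<close>, so the differential of \<open>g\<close> maps \<open>D\<^sub>y\<close> into \<open>D\<^sub>z\<close>, and onto it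
  since the dimensions agree; hence the tangent space of \<open>S\<^sub>n\<close> pulls back to a complement of \<open>D\<^sub>y\<close>.
\<close>


section \<open>Velocities of curves\<close>

text \<open>Chain rules are mostly run along curves: model spaces are closed subspaces of a type and
  derivatives enter through \<open>SOME\<close>, so a derivative is pinned down as the
  \<open>velocity\<close> of a curve, a limit of difference quotients at 0, and two derivatives
  agree because limits are unique. One identity \<open>f2 (\<Phi> x) = f1 (p x)\<close>,
  differentiated once and then again at a critical point, serves twice: for the action with
  \<open>p = snd\<close>, since \<open>f (a b) = f b\<close> has no \<open>a\<close> on the right,
  and for the inclusion of a submanifold with \<open>p\<close> the identity. A genuine second order
  chain rule is needed only because flattening charts come from the maximal atlas, whereas
  \<open>f\<close> is smooth in the charts of the given one.

  Closed complements of \<open>D_y\<close> are compared by projections along \<open>D_y\<close>.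
  Their continuity comes from the finite dimension of \<open>D_y\<close>, the image of the Lie
  algebra.

  In the converse direction the radical at \<open>z\<close> is known, because nondegeneracy on the
  tangent space of \<open>S_n\<close> is given there, but the radical at \<open>y\<close> is not.
  This is why the differential gives one inclusion only and a dimension count closes the
  gap.\<close>

definition velocity :: "(real \<Rightarrow> 'a::real_normed_vector) \<Rightarrow> 'a \<Rightarrow> bool" where
  "velocity c v \<longleftrightarrow> ((\<lambda>t. (c t - c 0) /\<^sub>R t) \<longlongrightarrow> v) (at 0)"

lemma velocity_line: "velocity (\<lambda>t. x + t *\<^sub>R v) v"
  unfolding velocity_def by (rule tendsto_eventually) (auto simp: eventually_at_filter)

lemma velocity_unique: "velocity c v \<Longrightarrow> velocity c w \<Longrightarrow> v = w"
  unfolding velocity_def by (rule tendsto_unique) auto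

text \<open>Agreement is required on \<open>nhds 0\<close>, which includes the point 0 itself,
  because \<open>c 0\<close> enters every difference quotient.\<close>

lemma velocity_cong:
  assumes "velocity c v" and "\<forall>\<^sub>F t in nhds 0. c t = c' t"
  shows "velocity c' v"
proof -
  have "c 0 = c' 0" using assms(2) by (rule eventually_nhds_x_imp_x)
  moreover have "\<forall>\<^sub>F t in at 0. c t = c' t"
    using assms(2) by (simp add: eventually_at_filter eventually_mono)
  ultimately have "\<forall>\<^sub>F t in at 0. (c t - c 0) /\<^sub>R t = (c' t - c' 0) /\<^sub>R t"
    by (auto elim: eventually_mono)
  then show ?thesis
    using assms(1) unfolding velocity_def by (rule Lim_transform_eventually[rotated])
qed

lemma velocity_tendsto:
  assumes "velocity c v"
  shows "(c \<longlongrightarrow> c 0) (at 0)"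
proof -
  have "((\<lambda>t. c 0 + t *\<^sub>R ((c t - c 0) /\<^sub>R t)) \<longlongrightarrow> c 0 + 0 *\<^sub>R v) (at 0)"
    using assms unfolding velocity_def by (intro tendsto_intros)
  moreover have "\<forall>\<^sub>F t in at 0. c 0 + t *\<^sub>R ((c t - c 0) /\<^sub>R t) = c t"
    by (auto simp: eventually_at_filter)
  ultimately show ?thesis by (simp add: tendsto_cong)
qed

lemma velocity_tendsto_nhds:
  assumes "velocity c v"
  shows "(c \<longlongrightarrow> c 0) (nhds 0)"
  using velocity_tendsto[OF assms] by (simp add: tendsto_at_iff_tendsto_nhds)

text \<open>Difference quotients stay in the subspace and closedness keeps the limit there. This is
  why derivatives of a chart expression land in the model space of the target.\<close>

lemma velocity_in_closed_subspace:
  assumes "velocity c v" and "\<forall>\<^sub>F t in nhds 0. c t \<in> E" and "subspace E" and "closed E"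
  shows "v \<in> E"
proof (rule Lim_in_closed_set[OF \<open>closed E\<close> _ _ assms(1)[unfolded velocity_def]])
  have "c 0 \<in> E" using assms(2) by (rule eventually_nhds_x_imp_x)
  moreover have "\<forall>\<^sub>F t in at 0. c t \<in> E"
    using assms(2) by (simp add: eventually_at_filter eventually_mono)
  ultimately show "\<forall>\<^sub>F t in at 0. (c t - c 0) /\<^sub>R t \<in> E"
    using \<open>subspace E\<close> by (auto elim!: eventually_mono intro: subspace_diff subspace_scale)
qed auto

lemma velocity_Pair:
  "velocity c v \<Longrightarrow> velocity c' v' \<Longrightarrow> velocity (\<lambda>t. (c t, c' t)) (v, v')"
  unfolding velocity_def by (drule (1) tendsto_Pair) simp

lemma velocity_const: "velocity (\<lambda>t. x) 0"
  unfolding velocity_def by simp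

lemma velocity_bounded_linear:
  assumes "bounded_linear p" "velocity c v"
  shows "velocity (\<lambda>t. p (c t)) (p v)"
proof -
  interpret bounded_linear p by fact
  have "((\<lambda>t. p ((c t - c 0) /\<^sub>R t)) \<longlongrightarrow> p v) (at 0)"
    using assms(2) unfolding velocity_def by (rule tendsto)
  then show ?thesis unfolding velocity_def by (simp add: scaleR diff)
qed

text \<open>Images of charts are open only relative to the model space \<open>E\<close>, so
  directions have to be taken in \<open>E\<close>.\<close>

lemma eventually_line_in_openin:
  fixes x v :: "'a::real_normed_vector"
  assumes "openin (top_of_set E) V" "subspace E" "x \<in> V" "v \<in> E"
  shows "\<forall>\<^sub>F t in nhds 0. x + t *\<^sub>R v \<in> V"
proof -
  obtain U where "open U" and V: "V = E \<inter> U" using assms(1) by (auto simp: openin_open)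
  have "((\<lambda>t. x + t *\<^sub>R v) \<longlongrightarrow> x + 0 *\<^sub>R v) (nhds 0)"
    by (intro tendsto_add tendsto_scaleR tendsto_const filterlim_ident)
  then have "\<forall>\<^sub>F t in nhds 0. x + t *\<^sub>R v \<in> U"
    using \<open>open U\<close> \<open>x \<in> V\<close> V by (intro topological_tendstoD) auto
  then show ?thesis
    using assms V by (auto elim!: eventually_mono intro: subspace_add subspace_scale)
qed

text \<open>The estimates of \<open>has_derivs\<close> bound a remainder by an arbitrary
  \<open>e\<close> times a quantity that stays bounded along the curve; this turns them into
  limits.\<close>

lemma tendsto_zero_if_le_multiple:
  fixes X :: "'a \<Rightarrow> 'b::real_normed_vector"
  assumes "\<And>e. e > 0 \<Longrightarrow> \<forall>\<^sub>F t in F. norm (X t) \<le> e * K" and "K \<ge> 0"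
  shows "(X \<longlongrightarrow> 0) F"
proof (rule tendstoI)
  fix e :: real assume "e > 0"
  \<comment> \<open>\<open>K\<close> may be 0, hence the denominator \<open>K + 1\<close>.\<close>
  then have "\<forall>\<^sub>F t in F. norm (X t) \<le> e / (K + 1) * K" using \<open>K \<ge> 0\<close> by (intro assms(1)) auto
  moreover have "e / (K + 1) * K < e" using \<open>e > 0\<close> \<open>K \<ge> 0\<close> by (simp add: field_simps)
  ultimately show "\<forall>\<^sub>F t in F. dist (X t) 0 < e" by (auto elim!: eventually_mono)
qed


section \<open>Calculus of \<open>has_derivs\<close>\<close>

text \<open>Filter form of the epsilon-delta clauses: estimates at a point can then be intersected,
  and pulled back along curves and maps by \<open>eventually_compose_filterlim\<close>.\<close>

lemma has_derivs_eventually: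
  "has_derivs k E V g D \<longleftrightarrow>
    (\<forall>x\<in>V. D x [] = g x) \<and>
    (\<forall>j\<le>k. \<forall>x\<in>V. bounded_multilinear_on j E (D x)) \<and>
    (\<forall>j<k. \<forall>x\<in>V. \<forall>e>0. \<forall>\<^sub>F z in nhds x. z \<in> V \<longrightarrow>
       (\<forall>vs\<in>lists E. length vs = j \<longrightarrow>
          norm (D z vs - D x vs - D x ((z - x) # vs)) \<le> e * norm (z - x) * (\<Prod>v\<leftarrow>vs. norm v))) \<and>
    (\<forall>x\<in>V. \<forall>e>0. \<forall>\<^sub>F z in nhds x. z \<in> V \<longrightarrow>
       (\<forall>vs\<in>lists E. length vs = k \<longrightarrow> norm (D z vs - D x vs) \<le> e * (\<Prod>v\<leftarrow>vs. norm v)))"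
  unfolding has_derivs_def eventually_nhds_metric by (simp add: imp_conjL Ball_def imp_conjR) meson

lemma has_derivs_Nil: "has_derivs k E V g D \<Longrightarrow> x \<in> V \<Longrightarrow> D x [] = g x"
  by (simp add: has_derivs_def)

lemma has_derivs_multilinear:
  "has_derivs k E V g D \<Longrightarrow> x \<in> V \<Longrightarrow> j \<le> k \<Longrightarrow> bounded_multilinear_on j E (D x)"
  by (simp add: has_derivs_def)

lemma has_derivs_step:
  "has_derivs k E V g D \<Longrightarrow> x \<in> V \<Longrightarrow> j < k \<Longrightarrow> e > 0 \<Longrightarrow>
    \<forall>\<^sub>F z in nhds x. z \<in> V \<longrightarrow> (\<forall>vs\<in>lists E. length vs = j \<longrightarrow>
      norm (D z vs - D x vs - D x ((z - x) # vs)) \<le> e * norm (z - x) * (\<Prod>v\<leftarrow>vs. norm v))"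
  by (simp add: has_derivs_eventually)

lemma has_derivs_top:
  "has_derivs k E V g D \<Longrightarrow> x \<in> V \<Longrightarrow> e > 0 \<Longrightarrow>
    \<forall>\<^sub>F z in nhds x. z \<in> V \<longrightarrow> (\<forall>vs\<in>lists E. length vs = k \<longrightarrow>
      norm (D z vs - D x vs) \<le> e * (\<Prod>v\<leftarrow>vs. norm v))"
  by (simp add: has_derivs_eventually)

section \<open>Bounded multilinear maps on lists\<close>

lemma prod_list_norm_nonneg: "0 \<le> (\<Prod>v\<leftarrow>vs. norm v)"
  by (induction vs) auto

text \<open>The constant in the definition may be negative, for instance when \<open>E\<close> is
  \<open>{0}\<close> and \<open>j\<close> is positive; \<open>max C 0\<close> repairs this.\<close>

lemma bounded_multilinear_on_bound:
  assumes "bounded_multilinear_on j E T"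
  obtains C where "C \<ge> 0"
    "\<And>vs. vs \<in> lists E \<Longrightarrow> length vs = j \<Longrightarrow> norm (T vs) \<le> C * (\<Prod>v\<leftarrow>vs. norm v)"
proof -
  obtain C where C: "\<forall>vs\<in>lists E. length vs = j \<longrightarrow> norm (T vs) \<le> C * (\<Prod>v\<leftarrow>vs. norm v)"
    using assms unfolding bounded_multilinear_on_def by blast
  show ?thesis
  proof (rule that[of "max C 0"])
    fix vs assume "vs \<in> lists E" "length vs = j"
    with C have "norm (T vs) \<le> C * (\<Prod>v\<leftarrow>vs. norm v)" by blast
    also have "\<dots> \<le> max C 0 * (\<Prod>v\<leftarrow>vs. norm v)"
      by (intro mult_right_mono prod_list_norm_nonneg) auto
    finally show "norm (T vs) \<le> max C 0 * (\<Prod>v\<leftarrow>vs. norm v)" .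
  qed auto
qed

lemma bounded_multilinear_on_append:
  assumes "bounded_multilinear_on j E T" "us \<in> lists E" "ws \<in> lists E" "u \<in> E" "v \<in> E"
    and "length us + 1 + length ws = j"
  shows "T (us @ [a *\<^sub>R u + b *\<^sub>R v] @ ws) = a *\<^sub>R T (us @ [u] @ ws) + b *\<^sub>R T (us @ [v] @ ws)"
  using assms unfolding bounded_multilinear_on_def by blast

lemma bounded_multilinear_on_Cons:
  assumes "bounded_multilinear_on j E T" "ws \<in> lists E" "u \<in> E" "v \<in> E" "Suc (length ws) = j"
  shows "T ((a *\<^sub>R u + b *\<^sub>R v) # ws) = a *\<^sub>R T (u # ws) + b *\<^sub>R T (v # ws)"
  using bounded_multilinear_on_append[OF assms(1) _ assms(2-4), of "[]"] assms(5) by simp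

lemma bounded_multilinear_on_Cons_scaleR:
  assumes "bounded_multilinear_on j E T" "ws \<in> lists E" "u \<in> E" "Suc (length ws) = j"
  shows "T ((a *\<^sub>R u) # ws) = a *\<^sub>R T (u # ws)"
  using bounded_multilinear_on_Cons[OF assms(1-3,3,4), of a 0] by simp

lemma bounded_multilinear_on_Cons_diff:
  assumes "bounded_multilinear_on j E T" "ws \<in> lists E" "u \<in> E" "v \<in> E" "Suc (length ws) = j"
  shows "T ((u - v) # ws) = T (u # ws) - T (v # ws)"
  using bounded_multilinear_on_Cons[OF assms, of 1 "-1"] by simp

lemma bounded_multilinear_on_second_diff:
  assumes "bounded_multilinear_on 2 E T" "w \<in> E" "u \<in> E" "v \<in> E"
  shows "T [w, u - v] = T [w, u] - T [w, v]"
  using bounded_multilinear_on_append[OF assms(1), of "[w]" "[]" u v 1 "-1"] assms by simp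

lemma bounded_multilinear_on_1_iff:
  "bounded_multilinear_on 1 E T \<longleftrightarrow>
    (\<forall>u\<in>E. \<forall>v\<in>E. \<forall>a b. T [a *\<^sub>R u + b *\<^sub>R v] = a *\<^sub>R T [u] + b *\<^sub>R T [v]) \<and>
    (\<exists>C. \<forall>v\<in>E. norm (T [v]) \<le> C * norm v)"
  unfolding bounded_multilinear_on_def by (simp add: length_Suc_conv Ball_def in_lists_conv_set) force

lemma bounded_multilinear_on_2_iff:
  "bounded_multilinear_on 2 E T \<longleftrightarrow>
    (\<forall>u\<in>E. \<forall>v\<in>E. \<forall>w\<in>E. \<forall>a b. T [a *\<^sub>R u + b *\<^sub>R v, w] = a *\<^sub>R T [u, w] + b *\<^sub>R T [v, w]) \<and>
    (\<forall>u\<in>E. \<forall>v\<in>E. \<forall>w\<in>E. \<forall>a b. T [w, a *\<^sub>R u + b *\<^sub>R v] = a *\<^sub>R T [w, u] + b *\<^sub>R T [w, v]) \<and>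
    (\<exists>C. \<forall>u\<in>E. \<forall>v\<in>E. norm (T [u, v]) \<le> C * norm u * norm v)" (is "?L \<longleftrightarrow> ?R")
proof
  assume L: ?L
  obtain C where "\<And>vs. vs \<in> lists E \<Longrightarrow> length vs = 2 \<Longrightarrow> norm (T vs) \<le> C * (\<Prod>v\<leftarrow>vs. norm v)"
    using bounded_multilinear_on_bound[OF L] by blast
  from this[of "[u, v]" for u v] have "\<forall>u\<in>E. \<forall>v\<in>E. norm (T [u, v]) \<le> C * norm u * norm v"
    by (auto simp: mult.assoc)
  then show ?R
    using bounded_multilinear_on_append[OF L, of "[]" "[w]" for w]
      bounded_multilinear_on_append[OF L, of "[w]" "[]" for w] by auto
next
  assume R: ?R
  have "T (us @ [a *\<^sub>R u + b *\<^sub>R v] @ ws) = a *\<^sub>R T (us @ [u] @ ws) + b *\<^sub>R T (us @ [v] @ ws)"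
    if "us \<in> lists E" "ws \<in> lists E" "u \<in> E" "v \<in> E" "length us + 1 + length ws = 2" for us ws u v a b
  proof -
    from that(5) consider "length us = 0" "length ws = 1" | "length us = 1" "length ws = 0" by linarith
    then show ?thesis
      by cases (use that R in \<open>auto simp: length_Suc_conv\<close>)
  qed
  moreover obtain C where C: "\<forall>u\<in>E. \<forall>v\<in>E. norm (T [u, v]) \<le> C * norm u * norm v" using R by blast
  have "\<forall>vs\<in>lists E. length vs = 2 \<longrightarrow> norm (T vs) \<le> C * (\<Prod>v\<leftarrow>vs. norm v)"
    using C by (auto simp: numeral_2_eq_2 length_Suc_conv mult.assoc)
  ultimately show ?L unfolding bounded_multilinear_on_def by blast
qed

lemma bounded_multilinear_on_cong:
  assumes "bounded_multilinear_on j E T" "subspace E"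
    and "\<And>vs. vs \<in> lists E \<Longrightarrow> length vs = j \<Longrightarrow> T vs = T' vs"
  shows "bounded_multilinear_on j E T'"
proof -
  have "T' (us @ [a *\<^sub>R u + b *\<^sub>R v] @ ws) = a *\<^sub>R T' (us @ [u] @ ws) + b *\<^sub>R T' (us @ [v] @ ws)"
    if "us \<in> lists E" "ws \<in> lists E" "u \<in> E" "v \<in> E" "length us + 1 + length ws = j" for us ws u v a b
    using bounded_multilinear_on_append[OF assms(1) that, of a b] that \<open>subspace E\<close>
    by (simp add: assms(3)[symmetric] subspace_add subspace_scale)
  then show ?thesis
    using assms(1,3) unfolding bounded_multilinear_on_def by auto
qed

section \<open>Change of domain, function and order\<close>

lemma has_derivs_subset: "has_derivs k E V g D \<Longrightarrow> V' \<subseteq> V \<Longrightarrow> has_derivs k E V' g D"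
  unfolding has_derivs_def by (meson subset_iff)

lemma has_derivs_subspace:
  assumes "has_derivs k E V g D" "F \<subseteq> E"
  shows "has_derivs k F V g D"
proof -
  have "lists F \<subseteq> lists E" using assms(2) by (rule lists_mono)
  moreover have "bounded_multilinear_on j F (D x)" if "bounded_multilinear_on j E (D x)" for j x
    using that assms(2) \<open>lists F \<subseteq> lists E\<close> unfolding bounded_multilinear_on_def by (meson subset_iff)
  ultimately show ?thesis
    using assms(1) unfolding has_derivs_def by (meson subset_iff)
qed

lemma has_derivs_cong_fun:
  assumes "has_derivs k E V g D" "\<And>x. x \<in> V \<Longrightarrow> g x = g' x"
  shows "has_derivs k E V g' D"
  using assms unfolding has_derivs_def by simp

text \<open>Values of \<open>D\<close> off \<open>V\<close> or on lists outside \<open>E\<close> are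
  never read by \<open>has_derivs\<close>, so a family may be replaced by one that agrees where it
  counts.\<close>

lemma has_derivs_cong:
  assumes D: "has_derivs k E V g D" and E: "subspace E" "V \<subseteq> E"
    and eq: "\<And>x vs. x \<in> V \<Longrightarrow> vs \<in> lists E \<Longrightarrow> length vs \<le> k \<Longrightarrow> D x vs = D' x vs"
  shows "has_derivs k E V g D'"
  unfolding has_derivs_eventually
proof (intro conjI allI impI ballI)
  show "D' x [] = g x" if "x \<in> V" for x
    using D that eq[OF that, of "[]"] by (simp add: has_derivs_Nil)
  show "bounded_multilinear_on j E (D' x)" if "j \<le> k" "x \<in> V" for j x
    by (rule bounded_multilinear_on_cong[OF has_derivs_multilinear[OF D that(2,1)] E(1)])
      (use eq that in auto)
  show "\<forall>\<^sub>F z in nhds x. z \<in> V \<longrightarrow> (\<forall>vs\<in>lists E. length vs = j \<longrightarrow>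
      norm (D' z vs - D' x vs - D' x ((z - x) # vs)) \<le> e * norm (z - x) * (\<Prod>v\<leftarrow>vs. norm v))"
    if "j < k" "x \<in> V" "e > 0" for j x e
    using has_derivs_step[OF D that(2,1,3)]
  proof eventually_elim
    case (elim z)
    \<comment> \<open>\<open>D x\<close> is also read at the list headed by \<open>z - x\<close>,
      which therefore has to lie in \<open>E\<close>.\<close>
    have "z - x \<in> E" if "z \<in> V" using that \<open>x \<in> V\<close> E by (blast intro: subspace_diff)
    with elim show ?case using that by (auto simp: eq[symmetric])
  qed
  show "\<forall>\<^sub>F z in nhds x. z \<in> V \<longrightarrow> (\<forall>vs\<in>lists E. length vs = k \<longrightarrow>
      norm (D' z vs - D' x vs) \<le> e * (\<Prod>v\<leftarrow>vs. norm v))"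
    if "x \<in> V" "e > 0" for x e
    using has_derivs_top[OF D that] by eventually_elim (use that in \<open>auto simp: eq[symmetric]\<close>)
qed

text \<open>Lowering the order turns a differentiability clause into the continuity clause of the
  new top order: the \<open>k\<close>-th derivative satisfies a Lipschitz estimate at
  \<open>x\<close> in operator norm.\<close>

lemma has_derivs_Suc_imp:
  assumes D: "has_derivs (Suc k) E V g D" and E: "subspace E" "V \<subseteq> E"
  shows "has_derivs k E V g D"
  unfolding has_derivs_eventually
proof (intro conjI allI impI ballI)
  show "\<forall>\<^sub>F z in nhds x. z \<in> V \<longrightarrow> (\<forall>vs\<in>lists E. length vs = k \<longrightarrow>
      norm (D z vs - D x vs) \<le> e * (\<Prod>v\<leftarrow>vs. norm v))"
    if x: "x \<in> V" "e > 0" for x e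
  proof -
    obtain C where C: "C \<ge> 0" "\<And>vs. vs \<in> lists E \<Longrightarrow> length vs = Suc k \<Longrightarrow>
        norm (D x vs) \<le> C * (\<Prod>v\<leftarrow>vs. norm v)"
      using bounded_multilinear_on_bound[OF has_derivs_multilinear[OF D x(1) le_refl]] by blast
    \<comment> \<open>In \<open>C + 1\<close> the \<open>C\<close> bounds the derivative of order
      \<open>k + 1\<close>, and the 1 is the remainder, estimated with tolerance 1.\<close>
    have "\<forall>\<^sub>F z in nhds x. dist z x < e / (C + 1)"
      using C \<open>e > 0\<close> by (intro eventually_nhds_metric[THEN iffD2] exI[of _ "e / (C + 1)"]) auto
    with has_derivs_step[OF D x(1) lessI zero_less_one] show ?thesis
    proof eventually_elim
      case (elim z)
      show ?case
      proof (intro impI ballI)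
        fix vs assume vs: "z \<in> V" "vs \<in> lists E" "length vs = k"
        let ?p = "\<Prod>v\<leftarrow>vs. norm v"
        have zx: "z - x \<in> E" using vs x E by (blast intro: subspace_diff)
        have "norm (D z vs - D x vs) \<le>
            norm (D z vs - D x vs - D x ((z - x) # vs)) + norm (D x ((z - x) # vs))"
          by (metis diff_add_cancel norm_triangle_ineq)
        also have "\<dots> \<le> 1 * norm (z - x) * ?p + C * (norm (z - x) * ?p)"
          using elim(1) C(2)[of "(z - x) # vs"] vs zx by (intro add_mono) auto
        also have "\<dots> = (C + 1) * norm (z - x) * ?p" by (simp add: algebra_simps)
        also have "\<dots> \<le> e * ?p"
          using elim(2) C(1) by (intro mult_right_mono prod_list_norm_nonneg) (simp add: dist_norm field_simps)
        finally show "norm (D z vs - D x vs) \<le> e * ?p" .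
      qed
    qed
  qed
qed (use D in \<open>auto intro: has_derivs_Nil has_derivs_multilinear has_derivs_step\<close>)

lemma has_derivs_mono:
  assumes "has_derivs k E V g D" "j \<le> k" "subspace E" "V \<subseteq> E"
  shows "has_derivs j E V g D"
  using \<open>j \<le> k\<close> assms(1)
  by (induction rule: inc_induct) (use has_derivs_Suc_imp assms(3,4) in blast)+

text \<open>Chain rule along a curve, at any order below \<open>k\<close>: with \<open>vs\<close>
  fixed, the quotient of \<open>D (c t) vs\<close> splits into the remainder of the
  differentiability clause and a linear term in the quotient of \<open>c\<close>.\<close>

lemma has_derivs_velocity:
  assumes D: "has_derivs k E V g D" and vs: "vs \<in> lists E" "length vs < k"
    and c: "velocity c v" "\<forall>\<^sub>F t in nhds 0. c t \<in> V" and E: "v \<in> E" "subspace E" "V \<subseteq> E"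
  shows "velocity (\<lambda>t. D (c t) vs) (D (c 0) (v # vs))"
proof -
  define q where "q = (\<lambda>t. (c t - c 0) /\<^sub>R t)"
  let ?p = "\<Prod>v\<leftarrow>vs. norm v"
  have q: "(q \<longlongrightarrow> v) (at 0)" using c(1) unfolding velocity_def q_def .
  have c0: "c 0 \<in> V" using c(2) by (rule eventually_nhds_x_imp_x)
  have cV: "\<forall>\<^sub>F t in at 0. t \<noteq> 0 \<and> c t \<in> V \<and> q t \<in> E \<and> c t - c 0 \<in> E"
    unfolding eventually_at_filter using c(2)
  proof eventually_elim
    case (elim t)
    have "c t - c 0 \<in> E" using elim c0 E by (blast intro: subspace_diff)
    with elim E show ?case by (auto simp: q_def subspace_scale)
  qed
  have ml: "bounded_multilinear_on (Suc (length vs)) E (D (c 0))"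
    using has_derivs_multilinear[OF D c0] vs by simp
  obtain C where C: "C \<ge> 0" "\<And>us. us \<in> lists E \<Longrightarrow> length us = Suc (length vs) \<Longrightarrow>
      norm (D (c 0) us) \<le> C * (\<Prod>v\<leftarrow>us. norm v)"
    using bounded_multilinear_on_bound[OF ml] by blast
  \<comment> \<open>In the remainder divided by \<open>t\<close>, the factor
    \<open>norm (c t - c 0) / \<bar>t\<bar>\<close> is the norm of \<open>q t\<close>, which stays
    below \<open>norm v + 1\<close>.\<close>
  have 1: "((\<lambda>t. (D (c t) vs - D (c 0) vs) /\<^sub>R t - D (c 0) (q t # vs)) \<longlongrightarrow> 0) (at 0)"
  proof (rule tendsto_zero_if_le_multiple)
    fix e :: real assume "e > 0"
    have "filterlim c (nhds (c 0)) (at 0)" using velocity_tendsto[OF c(1)] .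
    then have "\<forall>\<^sub>F t in at 0. c t \<in> V \<longrightarrow> (\<forall>vs'\<in>lists E. length vs' = length vs \<longrightarrow>
        norm (D (c t) vs' - D (c 0) vs' - D (c 0) ((c t - c 0) # vs')) \<le>
          e * norm (c t - c 0) * (\<Prod>v\<leftarrow>vs'. norm v))"
      by (rule eventually_compose_filterlim[OF has_derivs_step[OF D c0 vs(2) \<open>e > 0\<close>]])
    moreover have "\<forall>\<^sub>F t in at 0. norm (q t) < norm v + 1"
      using tendsto_norm[OF q] by (rule order_tendstoD) simp
    ultimately show "\<forall>\<^sub>F t in at 0. norm ((D (c t) vs - D (c 0) vs) /\<^sub>R t - D (c 0) (q t # vs)) \<le>
        e * ((norm v + 1) * ?p)"
      using cV
    proof eventually_elim
      case (elim t)
      have eq: "D (c 0) (q t # vs) = D (c 0) ((c t - c 0) # vs) /\<^sub>R t"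
        unfolding q_def using bounded_multilinear_on_Cons_scaleR[OF ml] vs elim by blast
      have "norm ((D (c t) vs - D (c 0) vs) /\<^sub>R t - D (c 0) (q t # vs)) =
          norm (D (c t) vs - D (c 0) vs - D (c 0) ((c t - c 0) # vs)) / \<bar>t\<bar>"
        unfolding eq scaleR_diff_right[symmetric] norm_scaleR
        by (simp only: abs_inverse divide_inverse mult.commute)
      also have "\<dots> \<le> e * norm (c t - c 0) * ?p / \<bar>t\<bar>"
        using elim vs by (intro divide_right_mono) auto
      also have "\<dots> = e * (norm (q t) * ?p)" by (simp add: q_def divide_inverse mult.commute mult.left_commute)
      also have "\<dots> \<le> e * ((norm v + 1) * ?p)"
        using elim \<open>e > 0\<close> by (intro mult_left_mono mult_right_mono prod_list_norm_nonneg) auto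
      finally show ?case .
    qed
  qed (simp add: prod_list_norm_nonneg)
  \<comment> \<open>\<open>D (c 0)\<close> is linear and bounded on \<open>E\<close> only, so the
    passage from \<open>q t\<close> to \<open>v\<close> is estimated through \<open>q t - v\<close>,
    which lies in \<open>E\<close>.\<close>
  have 2: "((\<lambda>t. D (c 0) (q t # vs)) \<longlongrightarrow> D (c 0) (v # vs)) (at 0)"
  proof (rule Lim_transform_eventually[OF _ eventually_mono])
    have "((\<lambda>t. D (c 0) ((q t - v) # vs)) \<longlongrightarrow> 0) (at 0)"
    proof (rule Lim_null_comparison)
      show "\<forall>\<^sub>F t in at 0. norm (D (c 0) ((q t - v) # vs)) \<le> C * (norm (q t - v) * ?p)"
        using cV
      proof eventually_elim
        case (elim t)
        have "q t - v \<in> E" using elim E by (blast intro: subspace_diff)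
        then show ?case using C(2)[of "(q t - v) # vs"] vs by simp
      qed
      have "((\<lambda>t. C * (norm (q t - v) * ?p)) \<longlongrightarrow> C * (norm (v - v) * ?p)) (at 0)"
        by (intro tendsto_intros q)
      then show "((\<lambda>t. C * (norm (q t - v) * ?p)) \<longlongrightarrow> 0) (at 0)" by simp
    qed
    then show "((\<lambda>t. D (c 0) (v # vs) + D (c 0) ((q t - v) # vs)) \<longlongrightarrow> D (c 0) (v # vs)) (at 0)"
      by (auto intro: tendsto_eq_intros)
    show "\<forall>\<^sub>F t in at 0. q t \<in> E" using cV by (auto elim: eventually_mono)
    show "D (c 0) (v # vs) + D (c 0) ((q t - v) # vs) = D (c 0) (q t # vs)" if "q t \<in> E" for t
      using bounded_multilinear_on_Cons_diff[OF ml vs(1) that E(1)] by simp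
  qed
  show ?thesis unfolding velocity_def using tendsto_add[OF 1 2] by simp
qed

lemma has_derivs_velocity_fun:
  assumes D: "has_derivs k E V g D" and "0 < k"
    and c: "velocity c v" "\<forall>\<^sub>F t in nhds 0. c t \<in> V" and E: "v \<in> E" "subspace E" "V \<subseteq> E"
  shows "velocity (\<lambda>t. g (c t)) (D (c 0) [v])"
proof (rule velocity_cong)
  show "velocity (\<lambda>t. D (c t) []) (D (c 0) [v])"
    using assms by (intro has_derivs_velocity) auto
  show "\<forall>\<^sub>F t in nhds 0. D (c t) [] = g (c t)"
    using c(2) by eventually_elim (rule has_derivs_Nil[OF D])
qed

text \<open>With \<open>k = 1\<close> it makes the first derivative of a \<open>C^1\<close> map
  continuous along a curve, which is what the moving argument \<open>w\<close> in
  \<open>has_derivs_second_at_critical\<close> has to satisfy.\<close>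

lemma has_derivs_top_tendsto:
  assumes D: "has_derivs k E V g D" and vs: "vs \<in> lists E" "length vs = k" and x: "x \<in> V"
    and c: "(c \<longlongrightarrow> x) F" "\<forall>\<^sub>F t in F. c t \<in> V"
  shows "((\<lambda>t. D (c t) vs) \<longlongrightarrow> D x vs) F"
proof -
  have "((\<lambda>t. D (c t) vs - D x vs) \<longlongrightarrow> 0) F"
  proof (rule tendsto_zero_if_le_multiple)
    fix e :: real assume "e > 0"
    have "\<forall>\<^sub>F t in F. c t \<in> V \<longrightarrow> (\<forall>vs'\<in>lists E. length vs' = k \<longrightarrow>
        norm (D (c t) vs' - D x vs') \<le> e * (\<Prod>v\<leftarrow>vs'. norm v))"
      by (rule eventually_compose_filterlim[OF has_derivs_top[OF D x \<open>e > 0\<close>] c(1)])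
    with c(2) show "\<forall>\<^sub>F t in F. norm (D (c t) vs - D x vs) \<le> e * (\<Prod>v\<leftarrow>vs. norm v)"
      by eventually_elim (use vs in auto)
  qed (rule prod_list_norm_nonneg)
  then show ?thesis by (simp add: Lim_null[symmetric])
qed

text \<open>To first order along \<open>c\<close>, \<open>D (c t)\<close> is its second derivative applied to \<open>c t - c 0\<close>, since
  the first derivative vanishes at \<open>c 0\<close>; hence mere continuity of \<open>w\<close> suffices.\<close>

lemma has_derivs_second_at_critical:
  assumes D: "has_derivs k E V g D" and k: "2 \<le> k"
    and c: "velocity c v" "\<forall>\<^sub>F t in nhds 0. c t \<in> V" and E: "v \<in> E" "subspace E" "V \<subseteq> E"
    and w: "(w \<longlongrightarrow> w0) (at 0)" "\<forall>\<^sub>F t in at 0. w t \<in> E" "w0 \<in> E"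
    and crit: "\<And>u. u \<in> E \<Longrightarrow> D (c 0) [u] = 0"
  shows "((\<lambda>t. D (c t) [w t] /\<^sub>R t) \<longlongrightarrow> D (c 0) [v, w0]) (at 0)"
proof -
  define q where "q = (\<lambda>t. (c t - c 0) /\<^sub>R t)"
  have q: "(q \<longlongrightarrow> v) (at 0)" using c(1) unfolding velocity_def q_def .
  have c0: "c 0 \<in> V" using c(2) by (rule eventually_nhds_x_imp_x)
  have "\<forall>\<^sub>F t in at 0. t \<noteq> 0 \<and> c t \<in> V \<and> q t \<in> E \<and> c t - c 0 \<in> E"
    unfolding eventually_at_filter using c(2)
  proof eventually_elim
    case (elim t)
    have "c t - c 0 \<in> E" using elim c0 E by (blast intro: subspace_diff)
    with elim E show ?case by (auto simp: q_def subspace_scale)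
  qed
  then have cV: "\<forall>\<^sub>F t in at 0. t \<noteq> 0 \<and> c t \<in> V \<and> q t \<in> E \<and> c t - c 0 \<in> E \<and> w t \<in> E"
    using w(2) by eventually_elim auto
  have ml: "bounded_multilinear_on 2 E (D (c 0))" using has_derivs_multilinear[OF D c0 k] .
  then obtain C where C: "\<And>u v. u \<in> E \<Longrightarrow> v \<in> E \<Longrightarrow> norm (D (c 0) [u, v]) \<le> C * norm u * norm v"
    unfolding bounded_multilinear_on_2_iff by blast
  have 1: "((\<lambda>t. D (c t) [w t] /\<^sub>R t - D (c 0) [q t, w t]) \<longlongrightarrow> 0) (at 0)"
  proof (rule tendsto_zero_if_le_multiple)
    fix e :: real assume "e > 0"
    have "filterlim c (nhds (c 0)) (at 0)" using velocity_tendsto[OF c(1)] .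
    then have "\<forall>\<^sub>F t in at 0. c t \<in> V \<longrightarrow> (\<forall>vs'\<in>lists E. length vs' = 1 \<longrightarrow>
        norm (D (c t) vs' - D (c 0) vs' - D (c 0) ((c t - c 0) # vs')) \<le>
          e * norm (c t - c 0) * (\<Prod>v\<leftarrow>vs'. norm v))"
      using k by (intro eventually_compose_filterlim[OF has_derivs_step[OF D c0 _ \<open>e > 0\<close>]]) auto
    moreover have "\<forall>\<^sub>F t in at 0. norm (q t) < norm v + 1"
      using tendsto_norm[OF q] by (rule order_tendstoD) simp
    moreover have "\<forall>\<^sub>F t in at 0. norm (w t) < norm w0 + 1"
      using tendsto_norm[OF w(1)] by (rule order_tendstoD) simp
    ultimately show "\<forall>\<^sub>F t in at 0. norm (D (c t) [w t] /\<^sub>R t - D (c 0) [q t, w t]) \<le>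
        e * ((norm v + 1) * (norm w0 + 1))"
      using cV
    proof eventually_elim
      case (elim t)
      have eq: "D (c 0) [q t, w t] = D (c 0) [c t - c 0, w t] /\<^sub>R t"
        unfolding q_def using bounded_multilinear_on_Cons_scaleR[OF ml, of "[w t]"] elim by simp
      \<comment> \<open>The vanishing term \<open>D (c 0) [w t]\<close> is inserted here; it turns
        the numerator into the remainder of the first derivative.\<close>
      have "norm (D (c t) [w t] /\<^sub>R t - D (c 0) [q t, w t]) =
          norm (D (c t) [w t] - D (c 0) [w t] - D (c 0) [c t - c 0, w t]) / \<bar>t\<bar>"
        unfolding eq scaleR_diff_right[symmetric] norm_scaleR
        using elim crit by (simp add: divide_inverse mult.commute)
      also have "\<dots> \<le> e * norm (c t - c 0) * norm (w t) / \<bar>t\<bar>"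
        using elim(1)[rule_format, of "[w t]"] elim by (intro divide_right_mono) auto
      also have "\<dots> = e * (norm (q t) * norm (w t))" by (simp add: q_def divide_inverse mult.commute mult.left_commute)
      also have "\<dots> \<le> e * ((norm v + 1) * (norm w0 + 1))"
        using elim \<open>e > 0\<close> by (intro mult_left_mono mult_mono) auto
      finally show ?case .
    qed
  qed auto
  \<comment> \<open>Both arguments move; bilinearity changes them one at a time.\<close>
  have 2: "((\<lambda>t. D (c 0) [q t, w t] - D (c 0) [v, w0]) \<longlongrightarrow> 0) (at 0)"
  proof (rule Lim_null_comparison)
    show "\<forall>\<^sub>F t in at 0. norm (D (c 0) [q t, w t] - D (c 0) [v, w0]) \<le>
        C * norm (q t - v) * norm (w t) + C * norm v * norm (w t - w0)"
      using cV
    proof eventually_elim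
      case (elim t)
      have qv: "q t - v \<in> E" "w t - w0 \<in> E" using elim E w(3) by (auto intro: subspace_diff)
      have "D (c 0) [q t, w t] - D (c 0) [v, w0] = D (c 0) [q t - v, w t] + D (c 0) [v, w t - w0]"
        using bounded_multilinear_on_Cons_diff[OF ml, of "[w t]" "q t" v]
          bounded_multilinear_on_second_diff[OF ml, of v "w t" w0] elim E w(3) by simp
      then show ?case
        using C[OF qv(1), of "w t"] C[OF E(1) qv(2)] elim
        by (metis add_mono norm_triangle_le)
    qed
    have "((\<lambda>t. C * norm (q t - v) * norm (w t) + C * norm v * norm (w t - w0)) \<longlongrightarrow>
        C * norm (v - v) * norm w0 + C * norm v * norm (w0 - w0)) (at 0)"
      by (intro tendsto_intros q w)
    then show "((\<lambda>t. C * norm (q t - v) * norm (w t) + C * norm v * norm (w t - w0)) \<longlongrightarrow> 0) (at 0)"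
      by simp
  qed
  show ?thesis using tendsto_add[OF 1 2] by (simp add: Lim_null[symmetric])
qed

text \<open>Induction over the list: the value at \<open>v # vs\<close> is the velocity of the value
  at \<open>vs\<close> along the line in direction \<open>v\<close>, and that line stays in
  \<open>V\<close> for small times because \<open>V\<close> is open in \<open>E\<close>.\<close>

lemma has_derivs_unique:
  assumes "has_derivs k E V g D" "has_derivs k E V g D'" and E: "openin (top_of_set E) V" "subspace E"
    and "x \<in> V" "vs \<in> lists E" "length vs \<le> k"
  shows "D x vs = D' x vs"
  using assms(5-7)
proof (induction vs arbitrary: x)
  case Nil
  then show ?case using assms(1,2) by (simp add: has_derivs_Nil)
next
  case (Cons v vs)
  have VE: "V \<subseteq> E" using E(1) openin_imp_subset by blast
  have ev: "\<forall>\<^sub>F t in nhds 0. x + t *\<^sub>R v \<in> V"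
    using Cons E by (intro eventually_line_in_openin) auto
  have "velocity (\<lambda>t. B (x + t *\<^sub>R v) vs) (B x (v # vs))" if "has_derivs k E V g B" for B
    using has_derivs_velocity[OF that _ _ velocity_line ev] Cons.prems E VE by simp
  note v = this[OF assms(1)] this[OF assms(2)]
  have "\<forall>\<^sub>F t in nhds 0. D (x + t *\<^sub>R v) vs = D' (x + t *\<^sub>R v) vs"
    using ev by eventually_elim (use Cons in auto)
  then show ?case by (rule velocity_unique[OF velocity_cong[OF v(1)] v(2)])
qed

text \<open>The same induction along lines, with limits of elements of \<open>F\<close> staying in
  \<open>F\<close>. For \<open>F\<close> the model space of the target chart it shows that
  derivatives of chart expressions are tangent vectors of the target.\<close>

lemma has_derivs_in_closed_subspace:
  assumes D: "has_derivs k E V g D" and E: "openin (top_of_set E) V" "subspace E"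
    and F: "subspace F" "closed F" "g ` V \<subseteq> F"
    and "x \<in> V" "vs \<in> lists E" "length vs \<le> k"
  shows "D x vs \<in> F"
  using assms(7-)
proof (induction vs arbitrary: x)
  case Nil
  then show ?case using D F by (auto simp: has_derivs_Nil)
next
  case (Cons v vs)
  have VE: "V \<subseteq> E" using E(1) openin_imp_subset by blast
  have ev: "\<forall>\<^sub>F t in nhds 0. x + t *\<^sub>R v \<in> V"
    using Cons E by (intro eventually_line_in_openin) auto
  have "velocity (\<lambda>t. D (x + t *\<^sub>R v) vs) (D x (v # vs))"
    using has_derivs_velocity[OF D _ _ velocity_line ev] Cons.prems E VE by simp
  then show ?case
  proof (rule velocity_in_closed_subspace[OF _ _ F(1,2)])
    show "\<forall>\<^sub>F t in nhds 0. D (x + t *\<^sub>R v) vs \<in> F"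
      using ev by eventually_elim (use Cons in auto)
  qed
qed

text \<open>Replaces the \<open>SOME\<close> in \<open>deriv_at\<close> by any available family. The
  chosen family has order \<open>length vs\<close>, which may be smaller than \<open>k\<close>;
  \<open>has_derivs_mono\<close> brings both to the same order before uniqueness applies.\<close>

lemma deriv_at_eq:
  assumes "has_derivs k E V g D" "openin (top_of_set E) V" "subspace E"
    and "x \<in> V" "vs \<in> lists E" "length vs \<le> k"
  shows "deriv_at E V g x vs = D x vs"
proof -
  have D: "has_derivs (length vs) E V g D"
    using assms(2,3) openin_imp_subset by (intro has_derivs_mono[OF assms(1,6)]) blast+
  show ?thesis
    unfolding deriv_at_def
    by (rule has_derivs_unique[OF someI[where P = "has_derivs (length vs) E V g", OF D] D assms(2-5) order_refl])
qed

text \<open>At each point the family of that point's own neighbourhood is used,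
  \<open>D x = B x x\<close>. On overlaps two families agree by uniqueness, so \<open>D\<close>
  coincides with the single family \<open>B x\<close> on all of \<open>U x\<close>, and every clause
  is local.\<close>

lemma Ck_on_local:
  assumes loc: "\<And>x. x \<in> V \<Longrightarrow> \<exists>U. x \<in> U \<and> U \<subseteq> V \<and> openin (top_of_set E) U \<and> Ck_on k E U g"
    and E: "subspace E"
  shows "Ck_on k E V g"
proof -
  from loc obtain U where U: "\<And>x. x \<in> V \<Longrightarrow>
      x \<in> U x \<and> U x \<subseteq> V \<and> openin (top_of_set E) (U x) \<and> Ck_on k E (U x) g" by metis
  then obtain B where B: "\<And>x. x \<in> V \<Longrightarrow> has_derivs k E (U x) g (B x)" unfolding Ck_on_def by metis
  define D where "D x = B x x" for x
  have D: "has_derivs k E (U x) g D" if x: "x \<in> V" for x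
  proof (rule has_derivs_cong[OF B[OF x] E])
    show "U x \<subseteq> E" using U[OF x] openin_imp_subset by blast
    fix z vs assume z: "z \<in> U x" and vs: "vs \<in> lists E" "length vs \<le> k"
    then have zV: "z \<in> V" using U[OF x] by blast
    have "has_derivs k E (U x \<inter> U z) g (B x)" "has_derivs k E (U x \<inter> U z) g (B z)"
      using B[OF x] B[OF zV] by (auto elim: has_derivs_subset)
    then show "B x z vs = D z vs" unfolding D_def
      by (rule has_derivs_unique[OF _ _ _ E _ vs]) (use z zV x U in auto)
  qed
  \<comment> \<open>The clauses quantify over \<open>z \<in> V\<close>; relative openness of
    \<open>U x\<close> puts all such \<open>z\<close> near \<open>x\<close> into
    \<open>U x\<close>.\<close>
  have near: "\<forall>\<^sub>F z in nhds x. z \<in> V \<longrightarrow> z \<in> U x" if x: "x \<in> V" for x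
  proof -
    obtain T where "open T" "U x = E \<inter> T" using U[OF x] by (auto simp: openin_open)
    moreover have "V \<subseteq> E"
    proof
      fix z assume "z \<in> V"
      from U[OF this] show "z \<in> E" using openin_imp_subset by blast
    qed
    ultimately show ?thesis using U[OF that] by (auto simp: eventually_nhds intro!: exI[of _ T])
  qed
  have "has_derivs k E V g D"
    unfolding has_derivs_eventually
  proof (intro conjI allI impI ballI)
    show "D x [] = g x" if "x \<in> V" for x using has_derivs_Nil[OF D[OF that]] U[OF that] by blast
    show "bounded_multilinear_on j E (D x)" if "j \<le> k" "x \<in> V" for j x
      using has_derivs_multilinear[OF D[OF that(2)]] U that by blast
    show "\<forall>\<^sub>F z in nhds x. z \<in> V \<longrightarrow> (\<forall>vs\<in>lists E. length vs = j \<longrightarrow>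
        norm (D z vs - D x vs - D x ((z - x) # vs)) \<le> e * norm (z - x) * (\<Prod>v\<leftarrow>vs. norm v))"
      if "j < k" "x \<in> V" "e > 0" for j x e
      using near[OF that(2)] has_derivs_step[OF D[OF that(2)] _ that(1,3), of x] U[OF that(2)]
      by (auto elim: eventually_elim2)
    show "\<forall>\<^sub>F z in nhds x. z \<in> V \<longrightarrow> (\<forall>vs\<in>lists E. length vs = k \<longrightarrow>
        norm (D z vs - D x vs) \<le> e * (\<Prod>v\<leftarrow>vs. norm v))"
      if "x \<in> V" "e > 0" for x e
      using near[OF that(1)] has_derivs_top[OF D[OF that(1)] _ that(2), of x] U[OF that(1)]
      by (auto elim: eventually_elim2)
  qed
  then show ?thesis unfolding Ck_on_def by blast
qed

text \<open>Both sides of \<open>eq\<close> are differentiated along the line from \<open>x\<close>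
  in direction \<open>v\<close>. For the action, \<open>\<Phi>\<close> is its chart expression and
  \<open>p\<close> forgets the group coordinate; for a submanifold, \<open>\<Phi>\<close> is a
  transition map and \<open>p\<close> the identity.\<close>

lemma has_derivs_first_order_identity:
  assumes f2: "has_derivs k E2 V2 f2 D2" and f1: "has_derivs k E1 V1 f1 D1" and k: "0 < k"
    and \<Phi>: "has_derivs 1 E V \<Phi> P" and E: "openin (top_of_set E) V" "subspace E"
    and E2: "subspace E2" "closed E2" "V2 \<subseteq> E2" and E1: "subspace E1" "V1 \<subseteq> E1"
    and p: "bounded_linear p" "p ` E \<subseteq> E1" "p ` V \<subseteq> V1"
    and maps: "\<Phi> ` V \<subseteq> V2" and eq: "\<And>x. x \<in> V \<Longrightarrow> f2 (\<Phi> x) = f1 (p x)"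
    and x: "x \<in> V" "v \<in> E"
  shows "D2 (\<Phi> x) [P x [v]] = D1 (p x) [p v]"
proof -
  have VE: "V \<subseteq> E" using E(1) openin_imp_subset by blast
  let ?c = "\<lambda>t. x + t *\<^sub>R v"
  have ev: "\<forall>\<^sub>F t in nhds 0. ?c t \<in> V"
    using x E by (intro eventually_line_in_openin) auto
  have ev\<Phi>: "\<forall>\<^sub>F t in nhds 0. \<Phi> (?c t) \<in> V2" and evp: "\<forall>\<^sub>F t in nhds 0. p (?c t) \<in> V1"
    using ev by (eventually_elim, use maps p in blast)+
  have \<Phi>c: "velocity (\<lambda>t. \<Phi> (?c t)) (P x [v])"
    using has_derivs_velocity_fun[OF \<Phi> _ velocity_line ev] x E VE by simp
  have P: "P x [v] \<in> E2"
    using has_derivs_in_closed_subspace[OF \<Phi> E E2(1,2)] maps E2(3) x by auto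
  have 1: "velocity (\<lambda>t. f2 (\<Phi> (?c t))) (D2 (\<Phi> x) [P x [v]])"
    using has_derivs_velocity_fun[OF f2 k \<Phi>c ev\<Phi> P E2(1,3)] by simp
  have 2: "velocity (\<lambda>t. f1 (p (?c t))) (D1 (p x) [p v])"
    using has_derivs_velocity_fun[OF f1 k velocity_bounded_linear[OF p(1) velocity_line] evp _ E1]
      p x by auto
  have "\<forall>\<^sub>F t in nhds 0. f2 (\<Phi> (?c t)) = f1 (p (?c t))"
    using ev by eventually_elim (rule eq)
  then show ?thesis by (rule velocity_unique[OF velocity_cong[OF 1] 2])
qed

text \<open>At critical points the Hessian pulls back under maps that are only once differentiable: both
  sides are the derivative along \<open>x + t h\<close> of the two sides of the first order identity.\<close>

lemma has_derivs_second_order_identity: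
  assumes f2: "has_derivs k E2 V2 f2 D2" and f1: "has_derivs k E1 V1 f1 D1" and k: "2 \<le> k"
    and \<Phi>: "has_derivs 1 E V \<Phi> P" and E: "openin (top_of_set E) V" "subspace E"
    and E2: "subspace E2" "closed E2" "V2 \<subseteq> E2" and E1: "subspace E1" "V1 \<subseteq> E1"
    and p: "bounded_linear p" "p ` E \<subseteq> E1" "p ` V \<subseteq> V1"
    and maps: "\<Phi> ` V \<subseteq> V2" and eq: "\<And>x. x \<in> V \<Longrightarrow> f2 (\<Phi> x) = f1 (p x)"
    and x: "x \<in> V" and uv: "u \<in> E" "v \<in> E"
    and crit2: "\<And>w. w \<in> E2 \<Longrightarrow> D2 (\<Phi> x) [w] = 0" and crit1: "\<And>w. w \<in> E1 \<Longrightarrow> D1 (p x) [w] = 0"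
  shows "D2 (\<Phi> x) [P x [u], P x [v]] = D1 (p x) [p u, p v]"
proof -
  have VE: "V \<subseteq> E" using E(1) openin_imp_subset by blast
  let ?c = "\<lambda>t. x + t *\<^sub>R u"
  have ev: "\<forall>\<^sub>F t in nhds 0. ?c t \<in> V"
    using x uv E by (intro eventually_line_in_openin) auto
  then have ev0: "\<forall>\<^sub>F t in at 0. ?c t \<in> V" by (simp add: eventually_at_filter eventually_mono)
  have ev\<Phi>: "\<forall>\<^sub>F t in nhds 0. \<Phi> (?c t) \<in> V2" and evp: "\<forall>\<^sub>F t in nhds 0. p (?c t) \<in> V1"
    using ev by (eventually_elim, use maps p in blast)+
  have \<Phi>c: "velocity (\<lambda>t. \<Phi> (?c t)) (P x [u])"
    using has_derivs_velocity_fun[OF \<Phi> _ velocity_line ev] uv E VE by simp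
  have P: "P z [w] \<in> E2" if "z \<in> V" "w \<in> E" for z w
    using has_derivs_in_closed_subspace[OF \<Phi> E E2(1,2), of z "[w]"] maps E2(3) that by auto
  \<comment> \<open>The moving argument is the image of \<open>v\<close> under the derivative of
    \<open>\<Phi>\<close> at the moving point; for a \<open>C^1\<close> map it is continuous in
    \<open>t\<close> and no more is at hand.\<close>
  have "((\<lambda>t. P (?c t) [v]) \<longlongrightarrow> P x [v]) (at 0)"
  proof (rule has_derivs_top_tendsto[OF \<Phi> _ _ x _ ev0])
    show "(?c \<longlongrightarrow> x) (at 0)" using velocity_tendsto[OF velocity_line, of x u] by simp
  qed (use uv in auto)
  moreover have "\<forall>\<^sub>F t in at 0. P (?c t) [v] \<in> E2" using ev0 by eventually_elim (use P uv in auto)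
  ultimately have 1: "((\<lambda>t. D2 (\<Phi> (?c t)) [P (?c t) [v]] /\<^sub>R t) \<longlongrightarrow> D2 (\<Phi> x) [P x [u], P x [v]]) (at 0)"
    using has_derivs_second_at_critical[OF f2 k \<Phi>c ev\<Phi> P[OF x uv(1)] E2(1,3)] P[OF x uv(2)] crit2
    by simp
  have 2: "((\<lambda>t. D1 (p (?c t)) [p v] /\<^sub>R t) \<longlongrightarrow> D1 (p x) [p u, p v]) (at 0)"
    using has_derivs_second_at_critical[OF f1 k velocity_bounded_linear[OF p(1) velocity_line] evp _ E1,
        of "\<lambda>t. p v" "p v"] p uv crit1 by auto
  have "\<forall>\<^sub>F t in at 0. D2 (\<Phi> (?c t)) [P (?c t) [v]] /\<^sub>R t = D1 (p (?c t)) [p v] /\<^sub>R t"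
    using ev0
  proof eventually_elim
    case (elim t)
    show ?case
      using has_derivs_first_order_identity[OF f2 f1 _ \<Phi> E E2 E1 p maps eq elim uv(2)] k by simp
  qed
  then show ?thesis by (rule tendsto_unique[OF at_neq_bot Lim_transform_eventually[OF 1] 2])
qed


section \<open>Composition of twice differentiable maps\<close>

lemma has_derivs_2_iff:
  "has_derivs 2 E V g D \<longleftrightarrow>
    (\<forall>x\<in>V. D x [] = g x \<and> bounded_multilinear_on 1 E (D x) \<and> bounded_multilinear_on 2 E (D x)) \<and>
    (\<forall>x\<in>V. \<forall>e>0. \<forall>\<^sub>F z in nhds x. z \<in> V \<longrightarrow> norm (D z [] - D x [] - D x [z - x]) \<le> e * norm (z - x)) \<and>
    (\<forall>x\<in>V. \<forall>e>0. \<forall>\<^sub>F z in nhds x. z \<in> V \<longrightarrow>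
      (\<forall>v\<in>E. norm (D z [v] - D x [v] - D x [z - x, v]) \<le> e * norm (z - x) * norm v)) \<and>
    (\<forall>x\<in>V. \<forall>e>0. \<forall>\<^sub>F z in nhds x. z \<in> V \<longrightarrow>
      (\<forall>u\<in>E. \<forall>v\<in>E. norm (D z [u, v] - D x [u, v]) \<le> e * (norm u * norm v)))"
proof -
  have "bounded_multilinear_on 0 E T" for T :: "'a list \<Rightarrow> 'b"
    unfolding bounded_multilinear_on_def by auto
  then have ml: "(\<forall>j\<le>2. \<forall>x\<in>V. bounded_multilinear_on j E (D x)) \<longleftrightarrow>
      (\<forall>x\<in>V. bounded_multilinear_on 1 E (D x) \<and> bounded_multilinear_on 2 E (D x))"
    by (auto simp: numeral_2_eq_2 le_Suc_eq)
  have less2: "(\<forall>j<2. R j) \<longleftrightarrow> R 0 \<and> R (Suc 0)" for R :: "nat \<Rightarrow> bool"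
    by (auto simp: numeral_2_eq_2 less_Suc_eq)
  have 1: "(\<forall>vs\<in>lists E. length vs = Suc 0 \<longrightarrow> R vs) \<longleftrightarrow> (\<forall>v\<in>E. R [v])" for R
    by (auto simp: length_Suc_conv)
  have 2: "(\<forall>vs\<in>lists E. length vs = 2 \<longrightarrow> R vs) \<longleftrightarrow> (\<forall>u\<in>E. \<forall>v\<in>E. R [u, v])" for R
    by (auto simp: length_Suc_conv numeral_2_eq_2)
  have 0: "(\<forall>vs\<in>lists E. vs = [] \<longrightarrow> R vs) \<longleftrightarrow> R []" for R :: "'a list \<Rightarrow> bool"
    by auto
  show ?thesis unfolding has_derivs_eventually ml less2 1 2 length_0_conv 0 by auto
qed

text \<open>The clauses of \<open>has_derivs\<close> taken with tolerance 1 give boundedness and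
  Lipschitz estimates at \<open>x\<close>. One constant, at least 1, serves for all of them, so that
  the composition below has to track a single constant per map.\<close>

lemma has_derivs_2_linear_estimates:
  assumes D: "has_derivs 2 E V g D" and E: "openin (top_of_set E) V" "subspace E" and x: "x \<in> V"
  obtains C where "C \<ge> 1"
    "\<forall>v\<in>E. norm (D x [v]) \<le> C * norm v"
    "\<forall>u\<in>E. \<forall>v\<in>E. norm (D x [u, v]) \<le> C * norm u * norm v"
    "\<forall>\<^sub>F z in nhds x. z \<in> V \<longrightarrow> norm (g z - g x) \<le> C * norm (z - x)"
    "\<forall>\<^sub>F z in nhds x. z \<in> V \<longrightarrow> (\<forall>v\<in>E. norm (D z [v] - D x [v]) \<le> C * norm (z - x) * norm v)"
    "\<forall>\<^sub>F z in nhds x. z \<in> V \<longrightarrow> (\<forall>v\<in>E. norm (D z [v]) \<le> C * norm v)"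
    "\<forall>\<^sub>F z in nhds x. z \<in> V \<longrightarrow> (\<forall>u\<in>E. \<forall>v\<in>E. norm (D z [u, v]) \<le> C * norm u * norm v)"
proof -
  note D' = D[unfolded has_derivs_2_iff]
  have VE: "V \<subseteq> E" using E(1) openin_imp_subset by blast
  obtain A where A: "\<And>v. v \<in> E \<Longrightarrow> norm (D x [v]) \<le> A * norm v"
    using has_derivs_multilinear[OF D x one_le_numeral] unfolding bounded_multilinear_on_1_iff by blast
  obtain B where B: "\<And>u v. u \<in> E \<Longrightarrow> v \<in> E \<Longrightarrow> norm (D x [u, v]) \<le> B * norm u * norm v"
    using has_derivs_multilinear[OF D x order_refl] unfolding bounded_multilinear_on_2_iff by blast
  define M where "M = max 0 (max A B)"
  have M0: "M \<ge> 0" unfolding M_def by simp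
  have M1: "norm (D x [v]) \<le> M * norm v" if "v \<in> E" for v
    using A[OF that] by (rule order_trans) (auto simp: M_def intro!: mult_right_mono)
  have M2: "norm (D x [u, v]) \<le> M * norm u * norm v" if "u \<in> E" "v \<in> E" for u v
    using B[OF that] by (rule order_trans) (auto simp: M_def intro!: mult_right_mono)
  have ev0: "\<forall>\<^sub>F z in nhds x. z \<in> V \<longrightarrow> norm (g z - g x) \<le> (M + 1) * norm (z - x)"
  proof -
    have "\<forall>\<^sub>F z in nhds x. z \<in> V \<longrightarrow> norm (D z [] - D x [] - D x [z - x]) \<le> 1 * norm (z - x)"
      using D' x zero_less_one by blast
    then show ?thesis
    proof (eventually_elim, safe)
      fix z assume z: "z \<in> V" and *: "norm (D z [] - D x [] - D x [z - x]) \<le> 1 * norm (z - x)"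
      have "z - x \<in> E" using z x VE E(2) by (blast intro: subspace_diff)
      then have "norm (D x [z - x]) \<le> M * norm (z - x)" by (rule M1)
      with * have "norm (D z [] - D x []) \<le> 1 * norm (z - x) + M * norm (z - x)"
        by (metis (no_types) add_mono diff_add_cancel norm_triangle_le)
      then show "norm (g z - g x) \<le> (M + 1) * norm (z - x)"
        using D' x z by (simp add: algebra_simps)
    qed
  qed
  have ev1: "\<forall>\<^sub>F z in nhds x. z \<in> V \<longrightarrow>
      (\<forall>v\<in>E. norm (D z [v] - D x [v]) \<le> (M + 1) * norm (z - x) * norm v)"
  proof -
    have "\<forall>\<^sub>F z in nhds x. z \<in> V \<longrightarrow> (\<forall>v\<in>E. norm (D z [v] - D x [v] - D x [z - x, v]) \<le>
        1 * norm (z - x) * norm v)"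
      using D' x zero_less_one by blast
    then show ?thesis
    proof (eventually_elim, safe)
      fix z v assume z: "z \<in> V" and v: "v \<in> E"
        and "\<forall>v\<in>E. norm (D z [v] - D x [v] - D x [z - x, v]) \<le> 1 * norm (z - x) * norm v"
      then have *: "norm (D z [v] - D x [v] - D x [z - x, v]) \<le> 1 * norm (z - x) * norm v" by blast
      have "z - x \<in> E" using z x VE E(2) by (blast intro: subspace_diff)
      then have "norm (D x [z - x, v]) \<le> M * norm (z - x) * norm v" using v by (rule M2)
      with * have "norm (D z [v] - D x [v]) \<le> 1 * norm (z - x) * norm v + M * norm (z - x) * norm v"
        by (metis (no_types) add_mono diff_add_cancel norm_triangle_le)
      then show "norm (D z [v] - D x [v]) \<le> (M + 1) * norm (z - x) * norm v"
        by (simp add: algebra_simps)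
    qed
  qed
  have near: "\<forall>\<^sub>F z in nhds x. norm (z - x) < 1"
    unfolding eventually_nhds_metric by (auto simp: dist_norm intro!: exI[of _ 1])
  \<comment> \<open>The worst case is the bound on \<open>D z [v]\<close>: \<open>M\<close> for
    \<open>D x [v]\<close> plus \<open>M + 1\<close> for the difference within distance 1.\<close>
  let ?C = "2 * M + 1"
  show ?thesis
  proof
    show "?C \<ge> 1" using M0 by simp
    have "norm (D x [v]) \<le> ?C * norm v" if "v \<in> E" for v
      using M1[OF that] by (rule order_trans) (use M0 in \<open>auto intro!: mult_right_mono\<close>)
    then show "\<forall>v\<in>E. norm (D x [v]) \<le> ?C * norm v" by blast
    have "norm (D x [u, v]) \<le> ?C * norm u * norm v" if "u \<in> E" "v \<in> E" for u v
      using M2[OF that] by (rule order_trans) (use M0 in \<open>auto intro!: mult_right_mono\<close>)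
    then show "\<forall>u\<in>E. \<forall>v\<in>E. norm (D x [u, v]) \<le> ?C * norm u * norm v" by blast
    have C: "(M + 1) * a \<le> ?C * a" if "a \<ge> 0" for a
      using that M0 by (intro mult_right_mono) auto
    show "\<forall>\<^sub>F z in nhds x. z \<in> V \<longrightarrow> norm (g z - g x) \<le> ?C * norm (z - x)"
      using ev0 by eventually_elim (use C[OF norm_ge_zero] order_trans in blast)
    show "\<forall>\<^sub>F z in nhds x. z \<in> V \<longrightarrow> (\<forall>v\<in>E. norm (D z [v] - D x [v]) \<le> ?C * norm (z - x) * norm v)"
      using ev1
    proof (eventually_elim, safe)
      fix z v assume "\<forall>v\<in>E. norm (D z [v] - D x [v]) \<le> (M + 1) * norm (z - x) * norm v" "v \<in> E"
      then have "norm (D z [v] - D x [v]) \<le> (M + 1) * norm (z - x) * norm v" by blast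
      also have "\<dots> \<le> ?C * norm (z - x) * norm v" by (intro mult_right_mono C) auto
      finally show "norm (D z [v] - D x [v]) \<le> ?C * norm (z - x) * norm v" .
    qed
    show "\<forall>\<^sub>F z in nhds x. z \<in> V \<longrightarrow> (\<forall>v\<in>E. norm (D z [v]) \<le> ?C * norm v)"
      using ev1 near
    proof (eventually_elim, safe)
      fix z v assume "\<forall>v\<in>E. norm (D z [v] - D x [v]) \<le> (M + 1) * norm (z - x) * norm v"
        and v: "v \<in> E" and z: "norm (z - x) < 1"
      then have "norm (D z [v] - D x [v]) \<le> (M + 1) * norm (z - x) * norm v" by blast
      also have "\<dots> \<le> (M + 1) * 1 * norm v"
        using z M0 by (intro mult_right_mono mult_left_mono) auto
      finally have "norm (D z [v]) \<le> (M + 1) * norm v + M * norm v"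
        using M1[OF v] norm_triangle_sub[of "D z [v]" "D x [v]"] by simp
      then show "norm (D z [v]) \<le> ?C * norm v" by (simp add: algebra_simps)
    qed
    have "\<forall>\<^sub>F z in nhds x. z \<in> V \<longrightarrow> (\<forall>u\<in>E. \<forall>v\<in>E. norm (D z [u, v] - D x [u, v]) \<le> 1 * (norm u * norm v))"
      using D' x zero_less_one by blast
    then show "\<forall>\<^sub>F z in nhds x. z \<in> V \<longrightarrow> (\<forall>u\<in>E. \<forall>v\<in>E. norm (D z [u, v]) \<le> ?C * norm u * norm v)"
    proof (eventually_elim, safe)
      fix z u v assume "\<forall>u\<in>E. \<forall>v\<in>E. norm (D z [u, v] - D x [u, v]) \<le> 1 * (norm u * norm v)"
        and uv: "u \<in> E" "v \<in> E"
      then have "norm (D z [u, v] - D x [u, v]) \<le> norm u * norm v" by auto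
      then have "norm (D z [u, v]) \<le> M * norm u * norm v + norm u * norm v"
        using M2[OF uv] norm_triangle_sub[of "D z [u, v]" "D x [u, v]"] by simp
      also have "\<dots> = (M + 1) * (norm u * norm v)" by (simp add: algebra_simps)
      also have "\<dots> \<le> ?C * (norm u * norm v)" by (rule C) simp
      finally show "norm (D z [u, v]) \<le> ?C * norm u * norm v" by (simp add: mult.assoc)
    qed
  qed
qed

text \<open>The chain rule up to second order. The last branch drops further entries of the list;
  only lists of length at most 2 are ever read.\<close>

definition compose_derivs ::
  "('b \<Rightarrow> 'b list \<Rightarrow> 'c::real_vector) \<Rightarrow> ('a \<Rightarrow> 'b) \<Rightarrow> ('a \<Rightarrow> 'a list \<Rightarrow> 'b) \<Rightarrow> 'a \<Rightarrow> 'a list \<Rightarrow> 'c" where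
  "compose_derivs D \<phi> P x vs = (case vs of [] \<Rightarrow> D (\<phi> x) [] | [v] \<Rightarrow> D (\<phi> x) [P x [v]]
    | u # v # _ \<Rightarrow> D (\<phi> x) [P x [u], P x [v]] + D (\<phi> x) [P x [u, v]])"

lemma compose_derivs_simps [simp]:
  "compose_derivs D \<phi> P x [] = D (\<phi> x) []"
  "compose_derivs D \<phi> P x [v] = D (\<phi> x) [P x [v]]"
  "compose_derivs D \<phi> P x [u, v] = D (\<phi> x) [P x [u], P x [v]] + D (\<phi> x) [P x [u, v]]"
  by (simp_all add: compose_derivs_def)

text \<open>Each clause follows by telescoping: inner and outer increments are replaced one at a
  time, so that every summand carries one small factor. \<open>A\<close> bounds the inner map and
  its derivatives, \<open>B\<close> the outer one.\<close>

lemma has_derivs_2_compose: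
  assumes f: "has_derivs 2 E2 V2 f D" and \<phi>: "has_derivs 2 E V \<phi> P"
    and E: "openin (top_of_set E) V" "subspace E"
    and E2: "openin (top_of_set E2) V2" "subspace E2" "closed E2" and maps: "\<phi> ` V \<subseteq> V2"
  shows "has_derivs 2 E V (f \<circ> \<phi>) (compose_derivs D \<phi> P)"
proof -
  note f' = f[unfolded has_derivs_2_iff] and \<phi>' = \<phi>[unfolded has_derivs_2_iff]
  have VE: "V \<subseteq> E" "V2 \<subseteq> E2" using E(1) E2(1) openin_imp_subset by blast+
  have P: "P x vs \<in> E2" if "x \<in> V" "vs \<in> lists E" "length vs \<le> 2" for x vs
    by (rule has_derivs_in_closed_subspace[OF \<phi> E E2(2,3) _ that]) (use maps VE in auto)
  have P1: "P x [v] \<in> E2" if "x \<in> V" "v \<in> E" for x v using P[OF that(1), of "[v]"] that by simp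
  have P2: "P x [u, v] \<in> E2" if "x \<in> V" "u \<in> E" "v \<in> E" for x u v
    using P[OF that(1), of "[u, v]"] that by simp
  have lin: "P x [a *\<^sub>R u + b *\<^sub>R v] = a *\<^sub>R P x [u] + b *\<^sub>R P x [v]"
    "P x [a *\<^sub>R u + b *\<^sub>R v, w] = a *\<^sub>R P x [u, w] + b *\<^sub>R P x [v, w]"
    "P x [w, a *\<^sub>R u + b *\<^sub>R v] = a *\<^sub>R P x [w, u] + b *\<^sub>R P x [w, v]"
    if "x \<in> V" "u \<in> E" "v \<in> E" "w \<in> E" for x u v w a b
    using has_derivs_multilinear[OF \<phi> that(1), of 1] has_derivs_multilinear[OF \<phi> that(1), of 2] that
    unfolding bounded_multilinear_on_1_iff bounded_multilinear_on_2_iff by auto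
  have lin2: "D y [a *\<^sub>R u + b *\<^sub>R v] = a *\<^sub>R D y [u] + b *\<^sub>R D y [v]"
    "D y [a *\<^sub>R u + b *\<^sub>R v, w] = a *\<^sub>R D y [u, w] + b *\<^sub>R D y [v, w]"
    "D y [w, a *\<^sub>R u + b *\<^sub>R v] = a *\<^sub>R D y [w, u] + b *\<^sub>R D y [w, v]"
    if "y \<in> V2" "u \<in> E2" "v \<in> E2" "w \<in> E2" for y u v w a b
    using has_derivs_multilinear[OF f that(1), of 1] has_derivs_multilinear[OF f that(1), of 2] that
    unfolding bounded_multilinear_on_1_iff bounded_multilinear_on_2_iff by auto
  note lin = lin(1)[OF _ _ _ subspace_0[OF E(2)]] lin(2,3)
  have diff2: "D y [u - v] = D y [u] - D y [v]"
    "D y [u - v, w] = D y [u, w] - D y [v, w]" "D y [w, u - v] = D y [w, u] - D y [w, v]"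
    if "y \<in> V2" "u \<in> E2" "v \<in> E2" "w \<in> E2" for y u v w
    using lin2[OF that, of 1 "-1"] by simp_all
  note lin2 = lin2(1)[OF _ _ _ subspace_0[OF E2(2)]] lin2(2,3)
  {
    fix x assume x: "x \<in> V"
    define y where "y = \<phi> x"
    have y: "y \<in> V2" using maps x y_def by blast
    obtain A where A: "A \<ge> 1"
      "\<forall>v\<in>E. norm (P x [v]) \<le> A * norm v"
      "\<forall>u\<in>E. \<forall>v\<in>E. norm (P x [u, v]) \<le> A * norm u * norm v"
      "\<forall>\<^sub>F z in nhds x. z \<in> V \<longrightarrow> norm (\<phi> z - \<phi> x) \<le> A * norm (z - x)"
      "\<forall>\<^sub>F z in nhds x. z \<in> V \<longrightarrow> (\<forall>v\<in>E. norm (P z [v] - P x [v]) \<le> A * norm (z - x) * norm v)"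
      "\<forall>\<^sub>F z in nhds x. z \<in> V \<longrightarrow> (\<forall>v\<in>E. norm (P z [v]) \<le> A * norm v)"
      "\<forall>\<^sub>F z in nhds x. z \<in> V \<longrightarrow> (\<forall>u\<in>E. \<forall>v\<in>E. norm (P z [u, v]) \<le> A * norm u * norm v)"
      by (rule has_derivs_2_linear_estimates[OF \<phi> E x]) (rule that, assumption+)
    obtain B where B: "B \<ge> 1"
      "\<forall>v\<in>E2. norm (D y [v]) \<le> B * norm v"
      "\<forall>u\<in>E2. \<forall>v\<in>E2. norm (D y [u, v]) \<le> B * norm u * norm v"
      "\<forall>\<^sub>F z in nhds y. z \<in> V2 \<longrightarrow> norm (f z - f y) \<le> B * norm (z - y)"
      "\<forall>\<^sub>F z in nhds y. z \<in> V2 \<longrightarrow> (\<forall>v\<in>E2. norm (D z [v] - D y [v]) \<le> B * norm (z - y) * norm v)"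
      "\<forall>\<^sub>F z in nhds y. z \<in> V2 \<longrightarrow> (\<forall>v\<in>E2. norm (D z [v]) \<le> B * norm v)"
      "\<forall>\<^sub>F z in nhds y. z \<in> V2 \<longrightarrow> (\<forall>u\<in>E2. \<forall>v\<in>E2. norm (D z [u, v]) \<le> B * norm u * norm v)"
      by (rule has_derivs_2_linear_estimates[OF f E2(1,2) y]) (rule that, assumption+)
    note A2 = A(2)[rule_format] and A3 = A(3)[rule_format] and B2 = B(2)[rule_format] and B3 = B(3)[rule_format]
    have D1: "norm (D y [a]) \<le> B * r" if "a \<in> E2" "norm a \<le> r" for a r
      using B2[OF that(1)] by (rule order_trans) (use that(2) B(1) in \<open>auto intro: mult_left_mono\<close>)
    have D2: "norm (D y [a, b]) \<le> B * r * s" if "a \<in> E2" "b \<in> E2" "norm a \<le> r" "norm b \<le> s" for a b r s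
    proof -
      have "norm (D y [a, b]) \<le> B * norm a * norm b" using B3 that by blast
      also have "\<dots> \<le> B * r * s"
        using that B(1) order_trans[OF norm_ge_zero that(3)] by (intro mult_mono) auto
      finally show ?thesis .
    qed
    \<comment> \<open>Convergence is taken relative to \<open>V\<close>, since nothing is known
      about \<phi> elsewhere; \<open>pull\<close> then moves estimates near \<open>y\<close> back to
      \<open>x\<close>.\<close>
    have lim: "filterlim \<phi> (nhds y) (inf (nhds x) (principal V))"
    proof -
      have "((\<lambda>z. \<phi> z - y) \<longlongrightarrow> 0) (inf (nhds x) (principal V))"
      proof (rule Lim_null_comparison)
        show "\<forall>\<^sub>F z in inf (nhds x) (principal V). norm (\<phi> z - y) \<le> A * norm (z - x)"
          using A(4) unfolding eventually_inf_principal y_def .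
        have "((\<lambda>z. A * norm (z - x)) \<longlongrightarrow> A * norm (x - x)) (inf (nhds x) (principal V))"
          by (intro tendsto_mult tendsto_const tendsto_norm tendsto_diff
              filterlim_ident[THEN filterlim_mono[OF _ order_refl inf_le1]])
        then show "((\<lambda>z. A * norm (z - x)) \<longlongrightarrow> 0) (inf (nhds x) (principal V))" by simp
      qed
      then show ?thesis by (simp add: Lim_null[symmetric])
    qed
    have pull: "\<forall>\<^sub>F z in nhds x. z \<in> V \<longrightarrow> R (\<phi> z)" if "\<forall>\<^sub>F w in nhds y. w \<in> V2 \<longrightarrow> R w" for R
    proof -
      have "\<forall>\<^sub>F z in inf (nhds x) (principal V). \<phi> z \<in> V2 \<longrightarrow> R (\<phi> z)"
        using that lim by (rule eventually_compose_filterlim)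
      then show ?thesis unfolding eventually_inf_principal by eventually_elim (use maps in auto)
    qed
    have near: "\<forall>\<^sub>F z in nhds x. norm (z - x) < d" if "d > 0" for d
      unfolding eventually_nhds_metric using that by (auto simp: dist_norm)
    have zE: "z - x \<in> E" "\<phi> z - y \<in> E2" if "z \<in> V" for z
      using that x y maps VE E(2) E2(2) by (auto intro!: subspace_diff)
    have j0: "\<forall>\<^sub>F z in nhds x. z \<in> V \<longrightarrow>
        norm (f (\<phi> z) - f y - D y [P x [z - x]]) \<le> e * norm (z - x)" if e: "e > 0" for e
    proof -
      \<comment> \<open>The outer remainder contributes \<open>A * d\<close>, the inner one pushed
        through \<open>D y\<close> contributes \<open>B * d\<close>.\<close>
      define d where "d = e / (A + B)"
      have d: "d > 0" "(A + B) * d = e" using e A(1) B(1) by (auto simp: d_def)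
      have a: "\<forall>\<^sub>F z in nhds x. z \<in> V \<longrightarrow> norm (\<phi> z - y - P x [z - x]) \<le> d * norm (z - x)"
        using \<phi>' x d(1) unfolding y_def by (auto elim!: eventually_mono)
      have b: "\<forall>\<^sub>F w in nhds y. w \<in> V2 \<longrightarrow> norm (f w - f y - D y [w - y]) \<le> d * norm (w - y)"
        using f' y d(1) by (auto elim!: eventually_mono)
      from a A(4) pull[OF b] show ?thesis
      proof eventually_elim
        case (elim z)
        show ?case
        proof
          assume z: "z \<in> V"
          have "f (\<phi> z) - f y - D y [P x [z - x]] =
              (f (\<phi> z) - f y - D y [\<phi> z - y]) + D y [\<phi> z - y - P x [z - x]]"
            using diff2(1)[OF y, of "\<phi> z - y" "P x [z - x]"] zE[OF z] P1[OF x] by simp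
          also have "norm \<dots> \<le> d * norm (\<phi> z - y) + B * (d * norm (z - x))"
            using elim z zE[OF z] P1[OF x] E2(2)
            by (intro norm_triangle_mono D1) (auto intro: subspace_diff)
          also have "\<dots> \<le> d * (A * norm (z - x)) + B * (d * norm (z - x))"
            using elim z d(1) by (intro add_right_mono mult_left_mono) (auto simp: y_def)
          also have "\<dots> = e * norm (z - x)" unfolding d(2)[symmetric] by (simp add: algebra_simps)
          finally show "norm (f (\<phi> z) - f y - D y [P x [z - x]]) \<le> e * norm (z - x)" .
        qed
      qed
    qed
    have j1: "\<forall>\<^sub>F z in nhds x. z \<in> V \<longrightarrow> (\<forall>v\<in>E.
        norm (D (\<phi> z) [P z [v]] - D y [P x [v]] - (D y [P x [z - x], P x [v]] + D y [P x [z - x, v]]))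
          \<le> e * norm (z - x) * norm v)" if e: "e > 0" for e
    proof -
      \<comment> \<open>\<open>M\<close> collects the coefficients of \<open>d\<close> from the four
        summands of the telescoped difference below.\<close>
      define M where "M = A * A + B * A + B * A * A + B"
      have M: "M > 0" using A(1) B(1) by (auto simp: M_def intro!: add_nonneg_pos)
      define d where "d = e / M"
      have d: "d > 0" "M * d = e" using e M by (auto simp: d_def)
      have a: "\<forall>\<^sub>F z in nhds x. z \<in> V \<longrightarrow> norm (\<phi> z - y - P x [z - x]) \<le> d * norm (z - x)"
        using \<phi>' x d(1) unfolding y_def by (auto elim!: eventually_mono)
      have a1: "\<forall>\<^sub>F z in nhds x. z \<in> V \<longrightarrow>
          (\<forall>v\<in>E. norm (P z [v] - P x [v] - P x [z - x, v]) \<le> d * norm (z - x) * norm v)"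
        using \<phi>' x d(1) by blast
      have b: "\<forall>\<^sub>F w in nhds y. w \<in> V2 \<longrightarrow>
          (\<forall>v\<in>E2. norm (D w [v] - D y [v] - D y [w - y, v]) \<le> d * norm (w - y) * norm v)"
        using f' y d(1) by blast
      from a a1 A(4,5,6) near[OF d(1)] pull[OF b] show ?thesis
      proof eventually_elim
        case (elim z)
        show ?case
        proof (intro impI ballI)
          fix v assume z: "z \<in> V" and v: "v \<in> E"
          let ?n = "norm (z - x)"
          note mem = zE[OF z] P1[OF x v] P1[OF z v] P1[OF x zE(1)[OF z]] P2[OF x zE(1)[OF z] v]
          have diffs: "\<phi> z - y - P x [z - x] \<in> E2" "P z [v] - P x [v] \<in> E2"
            "P z [v] - P x [v] - P x [z - x, v] \<in> E2"
            using mem E2(2) by (auto intro!: subspace_diff)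
          note e = diff2(2)[OF y mem(2) mem(5) mem(4)]
            diff2(3)[OF y mem(4) mem(3) mem(5)] diff2(1)[OF y diffs(2) mem(6) mem(6)]
            diff2(1)[OF y mem(4) mem(3) mem(3)]
          have "D (\<phi> z) [P z [v]] - D y [P x [v]] - (D y [P x [z - x], P x [v]] + D y [P x [z - x, v]]) =
              (D (\<phi> z) [P z [v]] - D y [P z [v]] - D y [\<phi> z - y, P z [v]])
              + D y [\<phi> z - y - P x [z - x], P z [v]]
              + D y [P x [z - x], P z [v] - P x [v]]
              + D y [P z [v] - P x [v] - P x [z - x, v]]"
            unfolding e by simp
          also have "norm \<dots> \<le> d * (A * ?n) * (A * norm v) + B * (d * ?n) * (A * norm v)
              + B * (A * ?n) * (A * d * norm v) + B * (d * ?n * norm v)"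
          proof (intro norm_triangle_mono D1 D2 mem diffs)
            have "norm (D (\<phi> z) [P z [v]] - D y [P z [v]] - D y [\<phi> z - y, P z [v]]) \<le>
                d * norm (\<phi> z - y) * norm (P z [v])" using elim z mem by blast
            also have "\<dots> \<le> d * (A * ?n) * (A * norm v)"
              using elim z v d(1) A(1) by (intro mult_mono) (auto simp: y_def)
            finally show "norm (D (\<phi> z) [P z [v]] - D y [P z [v]] - D y [\<phi> z - y, P z [v]]) \<le>
                d * (A * ?n) * (A * norm v)" .
            \<comment> \<open>This summand is quadratic in \<open>z - x\<close>; one of the two
              factors is traded for \<open>d\<close>, because \<open>z\<close> is within
              \<open>d\<close> of \<open>x\<close>.\<close>
            have "norm (P z [v] - P x [v]) \<le> A * ?n * norm v" using elim z v by blast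
            also have "\<dots> \<le> A * d * norm v"
              using elim A(1) by (intro mult_right_mono mult_left_mono) auto
            finally show "norm (P z [v] - P x [v]) \<le> A * d * norm v" .
          qed (use elim z v A2[OF mem(1)] in auto)
          also have "\<dots> = e * ?n * norm v" unfolding d(2)[symmetric] M_def by (simp add: algebra_simps)
          finally show "norm (D (\<phi> z) [P z [v]] - D y [P x [v]] -
              (D y [P x [z - x], P x [v]] + D y [P x [z - x, v]])) \<le> e * ?n * norm v" .
        qed
      qed
    qed
    have j2: "\<forall>\<^sub>F z in nhds x. z \<in> V \<longrightarrow> (\<forall>u\<in>E. \<forall>v\<in>E.
        norm ((D (\<phi> z) [P z [u], P z [v]] + D (\<phi> z) [P z [u, v]]) -
          (D y [P x [u], P x [v]] + D y [P x [u, v]])) \<le> e * (norm u * norm v))" if e: "e > 0" for e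
    proof -
      \<comment> \<open>Three of the five summands contribute \<open>B * A * A\<close> each: two
        from moving the first derivatives of \<phi>, one from moving the base point of the outer
        first derivative.\<close>
      define M where "M = A * A + 2 * (B * A * A) + B * A * A + B"
      have M: "M > 0" using A(1) B(1) by (auto simp: M_def intro!: add_nonneg_pos)
      define d where "d = e / M"
      have d: "d > 0" "M * d = e" using e M by (auto simp: d_def)
      have a2: "\<forall>\<^sub>F z in nhds x. z \<in> V \<longrightarrow>
          (\<forall>u\<in>E. \<forall>v\<in>E. norm (P z [u, v] - P x [u, v]) \<le> d * (norm u * norm v))"
        using \<phi>' x d(1) by blast
      have b: "\<forall>\<^sub>F w in nhds y. w \<in> V2 \<longrightarrow>
          (\<forall>u\<in>E2. \<forall>v\<in>E2. norm (D w [u, v] - D y [u, v]) \<le> d * (norm u * norm v))"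
        using f' y d(1) by blast
      from a2 A(4,5,6,7) near[OF d(1)] pull[OF b] pull[OF B(5)] show ?thesis
      proof eventually_elim
        case (elim z)
        show ?case
        proof (intro impI ballI)
          fix u v assume z: "z \<in> V" and u: "u \<in> E" and v: "v \<in> E"
          let ?n = "norm (z - x)"
          note mem = P1[OF x u] P1[OF z u] P1[OF x v] P1[OF z v] P2[OF x u v] P2[OF z u v]
          have diffs: "P z [u] - P x [u] \<in> E2" "P z [v] - P x [v] \<in> E2" "P z [u, v] - P x [u, v] \<in> E2"
            using mem E2(2) by (auto intro!: subspace_diff)
          have small: "norm (P z [w] - P x [w]) \<le> A * d * norm w" if w: "w \<in> E" for w
          proof -
            have "norm (P z [w] - P x [w]) \<le> A * ?n * norm w" using elim z w by blast
            also have "\<dots> \<le> A * d * norm w"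
              using elim A(1) by (intro mult_right_mono mult_left_mono) auto
            finally show ?thesis .
          qed
          note e = diff2(2)[OF y mem(2) mem(1) mem(4)] diff2(3)[OF y mem(4) mem(3) mem(1)]
            diff2(1)[OF y mem(6) mem(5) mem(5)]
          have "(D (\<phi> z) [P z [u], P z [v]] + D (\<phi> z) [P z [u, v]]) -
              (D y [P x [u], P x [v]] + D y [P x [u, v]]) =
              (D (\<phi> z) [P z [u], P z [v]] - D y [P z [u], P z [v]])
              + D y [P z [u] - P x [u], P z [v]] + D y [P x [u], P z [v] - P x [v]]
              + (D (\<phi> z) [P z [u, v]] - D y [P z [u, v]]) + D y [P z [u, v] - P x [u, v]]"
            unfolding e by simp
          also have "norm \<dots> \<le> d * (A * norm u * (A * norm v)) + B * (A * d * norm u) * (A * norm v)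
              + B * (A * norm u) * (A * d * norm v)
              + B * (A * d) * (A * norm u * norm v) + B * (d * (norm u * norm v))"
          proof (intro norm_triangle_mono D1 D2 mem diffs small u v)
            have "norm (D (\<phi> z) [P z [u], P z [v]] - D y [P z [u], P z [v]]) \<le>
                d * (norm (P z [u]) * norm (P z [v]))" using elim z mem by blast
            also have "\<dots> \<le> d * (A * norm u * (A * norm v))"
              using elim z u v d(1) A(1) by (intro mult_left_mono mult_mono) auto
            finally show "norm (D (\<phi> z) [P z [u], P z [v]] - D y [P z [u], P z [v]]) \<le>
                d * (A * norm u * (A * norm v))" .
            have "norm (D (\<phi> z) [P z [u, v]] - D y [P z [u, v]]) \<le>
                B * norm (\<phi> z - y) * norm (P z [u, v])" using elim z mem by blast
            also have "\<dots> \<le> B * (A * d) * (A * norm u * norm v)"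
            proof (intro mult_mono mult_left_mono)
              have "norm (\<phi> z - y) \<le> A * ?n" using elim z unfolding y_def by blast
              also have "\<dots> \<le> A * d" using elim A(1) by (intro mult_left_mono) auto
              finally show "norm (\<phi> z - y) \<le> A * d" .
            qed (use elim z u v A(1) B(1) d(1) in auto)
            finally show "norm (D (\<phi> z) [P z [u, v]] - D y [P z [u, v]]) \<le>
                B * (A * d) * (A * norm u * norm v)" .
          qed (use elim z u v A2 in auto)
          also have "\<dots> = e * (norm u * norm v)" unfolding d(2)[symmetric] M_def by (simp add: algebra_simps)
          finally show "norm ((D (\<phi> z) [P z [u], P z [v]] + D (\<phi> z) [P z [u, v]]) -
              (D y [P x [u], P x [v]] + D y [P x [u, v]])) \<le> e * (norm u * norm v)" .
        qed
      qed
    qed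
    have m1: "bounded_multilinear_on 1 E (compose_derivs D \<phi> P x)"
      unfolding bounded_multilinear_on_1_iff compose_derivs_simps y_def[symmetric]
    proof (intro conjI ballI allI exI[of _ "B * A"])
      show "D y [P x [a *\<^sub>R u + b *\<^sub>R v]] = a *\<^sub>R D y [P x [u]] + b *\<^sub>R D y [P x [v]]"
        if "u \<in> E" "v \<in> E" for u v a b
        using that x y by (simp add: lin(1) lin2(1) P1)
      show "norm (D y [P x [v]]) \<le> B * A * norm v" if "v \<in> E" for v
        using D1[OF P1[OF x that] A2[OF that]] by (simp add: mult.assoc)
    qed
    have m2: "bounded_multilinear_on 2 E (compose_derivs D \<phi> P x)"
      unfolding bounded_multilinear_on_2_iff compose_derivs_simps y_def[symmetric]
    proof (intro conjI ballI allI exI[of _ "B * A * A + B * A"])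
      fix u v w a b assume uvw: "u \<in> E" "v \<in> E" "w \<in> E"
      show "D y [P x [a *\<^sub>R u + b *\<^sub>R v], P x [w]] + D y [P x [a *\<^sub>R u + b *\<^sub>R v, w]] =
          a *\<^sub>R (D y [P x [u], P x [w]] + D y [P x [u, w]]) +
          b *\<^sub>R (D y [P x [v], P x [w]] + D y [P x [v, w]])"
        using uvw x y by (simp add: lin lin2 P1 P2 scaleR_add_right)
      show "D y [P x [w], P x [a *\<^sub>R u + b *\<^sub>R v]] + D y [P x [w, a *\<^sub>R u + b *\<^sub>R v]] =
          a *\<^sub>R (D y [P x [w], P x [u]] + D y [P x [w, u]]) +
          b *\<^sub>R (D y [P x [w], P x [v]] + D y [P x [w, v]])"
        using uvw x y by (simp add: lin lin2 P1 P2 scaleR_add_right)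
    next
      fix u v assume uv: "u \<in> E" "v \<in> E"
      have "norm (D y [P x [u], P x [v]] + D y [P x [u, v]]) \<le>
          B * (A * norm u) * (A * norm v) + B * (A * norm u * norm v)"
        by (intro norm_triangle_mono D1 D2 P1 P2 A2 A3 x uv)
      then show "norm (D y [P x [u], P x [v]] + D y [P x [u, v]]) \<le> (B * A * A + B * A) * norm u * norm v"
        by (simp add: algebra_simps)
    qed
    note j0[unfolded y_def] j1[unfolded y_def] j2[unfolded y_def] m1 m2
  }
  note * = this
  show ?thesis
    unfolding has_derivs_2_iff
  proof (intro conjI ballI allI impI)
    fix x assume x: "x \<in> V"
    show "compose_derivs D \<phi> P x [] = (f \<circ> \<phi>) x" using f' maps x by auto
    show "bounded_multilinear_on 1 E (compose_derivs D \<phi> P x)"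
      "bounded_multilinear_on 2 E (compose_derivs D \<phi> P x)" using *(4,5)[OF x] .
    fix e :: real assume e: "e > 0"
    have "D (\<phi> z) [] = f (\<phi> z)" if "z \<in> V" for z using f' maps that by blast
    then show "\<forall>\<^sub>F z in nhds x. z \<in> V \<longrightarrow> norm (compose_derivs D \<phi> P z [] - compose_derivs D \<phi> P x []
        - compose_derivs D \<phi> P x [z - x]) \<le> e * norm (z - x)"
      using *(1)[OF x e] x by (auto elim: eventually_mono)
  qed (use *(2,3) in simp_all)
qed


section \<open>Riesz representation and adjoints on closed subspaces\<close>

text \<open>Tangent spaces are subspaces of a type and maps between them mean nothing outside, so
  linearity and the bound are relative to \<open>W\<close>.\<close>

definition bounded_linear_on :: "'a::real_normed_vector set \<Rightarrow> ('a \<Rightarrow> 'b::real_normed_vector) \<Rightarrow> bool" where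
  "bounded_linear_on W T \<longleftrightarrow>
    (\<forall>u\<in>W. \<forall>v\<in>W. \<forall>a b. T (a *\<^sub>R u + b *\<^sub>R v) = a *\<^sub>R T u + b *\<^sub>R T v) \<and>
    (\<exists>C. \<forall>v\<in>W. norm (T v) \<le> C * norm v)"

lemma bounded_linear_onD:
  assumes "bounded_linear_on W T" "subspace W" "u \<in> W" "v \<in> W"
  shows "T (a *\<^sub>R u + b *\<^sub>R v) = a *\<^sub>R T u + b *\<^sub>R T v" "T (u + v) = T u + T v" "T (u - v) = T u - T v"
    "T (a *\<^sub>R u) = a *\<^sub>R T u" "T 0 = 0"
proof -
  have lin: "T (a *\<^sub>R u + b *\<^sub>R v) = a *\<^sub>R T u + b *\<^sub>R T v" for a b
    using assms unfolding bounded_linear_on_def by blast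
  show "T (a *\<^sub>R u + b *\<^sub>R v) = a *\<^sub>R T u + b *\<^sub>R T v" using lin .
  show "T (u + v) = T u + T v" "T (u - v) = T u - T v" "T (a *\<^sub>R u) = a *\<^sub>R T u" "T 0 = 0"
    using lin[of 1 1] lin[of 1 "-1"] lin[of a 0] lin[of 0 0] by simp_all
qed

lemma bounded_linear_on_bound:
  assumes "bounded_linear_on W T"
  obtains C where "C > 0" "\<And>v. v \<in> W \<Longrightarrow> norm (T v) \<le> C * norm v"
proof -
  obtain C where C: "\<forall>v\<in>W. norm (T v) \<le> C * norm v" using assms unfolding bounded_linear_on_def by blast
  have "norm (T v) \<le> max 1 C * norm v" if "v \<in> W" for v
  proof -
    have "norm (T v) \<le> C * norm v" using C that by blast
    also have "\<dots> \<le> max 1 C * norm v" by (intro mult_right_mono) auto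
    finally show ?thesis .
  qed
  then show ?thesis using that[of "max 1 C"] by simp
qed

lemma bounded_linear_on_continuous:
  assumes "bounded_linear_on W T" "subspace W"
  shows "continuous_on W T"
proof -
  obtain C where C: "C > 0" "\<And>v. v \<in> W \<Longrightarrow> norm (T v) \<le> C * norm v"
    using bounded_linear_on_bound[OF assms(1)] by metis
  show ?thesis
  proof (rule continuous_onI)
    fix x and e :: real assume x: "x \<in> W" and e: "e > 0"
    show "\<exists>d>0. \<forall>z\<in>W. dist z x < d \<longrightarrow> dist (T z) (T x) \<le> e"
    proof (intro exI[of _ "e / C"] conjI ballI impI)
      fix z assume z: "z \<in> W" "dist z x < e / C"
      have "dist (T z) (T x) = norm (T (z - x))"
        using bounded_linear_onD(3)[OF assms z(1) x] by (simp add: dist_norm)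
      also have "\<dots> \<le> C * norm (z - x)" using C z(1) x assms(2) by (blast intro: subspace_diff)
      also have "\<dots> \<le> e" using z(2) C(1) by (simp add: dist_norm field_simps)
      finally show "dist (T z) (T x) \<le> e" .
    qed (use e C in auto)
  qed
qed

lemma bounded_linear_on_subset: "bounded_linear_on W T \<Longrightarrow> W' \<subseteq> W \<Longrightarrow> bounded_linear_on W' T"
  unfolding bounded_linear_on_def by (meson subset_iff)

lemma bounded_linear_on_compose:
  assumes T: "bounded_linear_on W T" and R: "bounded_linear_on W' R" and TW: "T ` W \<subseteq> W'"
  shows "bounded_linear_on W (R \<circ> T)"
proof -
  obtain C where C: "C > 0" "\<And>v. v \<in> W' \<Longrightarrow> norm (R v) \<le> C * norm v"
    using bounded_linear_on_bound[OF R] by metis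
  obtain C' where C': "C' > 0" "\<And>v. v \<in> W \<Longrightarrow> norm (T v) \<le> C' * norm v"
    using bounded_linear_on_bound[OF T] by metis
  have "norm (R (T v)) \<le> (C * C') * norm v" if "v \<in> W" for v
  proof -
    have "norm (R (T v)) \<le> C * norm (T v)" using C TW that by blast
    also have "\<dots> \<le> C * (C' * norm v)" using C C' that by (intro mult_left_mono) auto
    finally show ?thesis by simp
  qed
  then show ?thesis
    using T R TW unfolding bounded_linear_on_def by (auto simp: image_subset_iff)
qed

lemma subspace_image_linear_on:
  assumes "bounded_linear_on W T" "subspace W"
  shows "subspace (T ` W)"
proof (rule subspaceI)
  show "0 \<in> T ` W"
    using bounded_linear_onD(5)[OF assms subspace_0 subspace_0, OF assms(2,2)] subspace_0[OF assms(2)] by force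
  show "x + y \<in> T ` W" if "x \<in> T ` W" "y \<in> T ` W" for x y
    using that bounded_linear_onD(2)[OF assms] subspace_add[OF assms(2)] by (auto simp: image_iff) metis
  show "c *\<^sub>R x \<in> T ` W" if "x \<in> T ` W" for c x
    using that bounded_linear_onD(4)[OF assms] subspace_scale[OF assms(2)] by (auto simp: image_iff) metis
qed

text \<open>The representing vector minimises \<open>norm v ^ 2 / 2 - l v\<close>; minimising sequences converge by the
  parallelogram identity.\<close>

lemma riesz_representation_on:
  fixes W :: "'a::{real_inner, complete_space} set" and l :: "'a \<Rightarrow> real"
  assumes W: "subspace W" "closed W" and l: "bounded_linear_on W l"
  obtains a where "a \<in> W" "\<And>v. v \<in> W \<Longrightarrow> l v = inner a v"
proof -
  obtain C where C: "C > 0" "\<And>v. v \<in> W \<Longrightarrow> norm (l v) \<le> C * norm v"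
    using bounded_linear_on_bound[OF l] by metis
  note lD = bounded_linear_onD[OF l W(1)]
  define q where "q v = inner v v / 2 - l v" for v
  have below: "- (C\<^sup>2 / 2) \<le> q v" if "v \<in> W" for v
  proof -
    have "0 \<le> (norm v - C)\<^sup>2" by simp
    then have "C * norm v \<le> (norm v)\<^sup>2 / 2 + C\<^sup>2 / 2" by (simp add: power2_diff field_simps)
    then show ?thesis using C(2)[OF that] unfolding q_def by (simp add: power2_norm_eq_inner abs_le_iff)
  qed
  have par: "inner (u - v) (u - v) / 8 = (q u + q v) / 2 - q ((1/2) *\<^sub>R u + (1/2) *\<^sub>R v)"
    if "u \<in> W" "v \<in> W" for u v
    using lD(1)[OF that, of "1/2" "1/2"] unfolding q_def
    by (simp add: inner_add_left inner_add_right inner_diff_left inner_diff_right inner_commute[of v u])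
      argo
  define m where "m = Inf (q ` W)"
  have bdd: "bdd_below (q ` W)" using below by (auto intro!: bdd_belowI)
  have ne: "q ` W \<noteq> {}" using subspace_0[OF W(1)] by blast
  have m: "m \<le> q v" if "v \<in> W" for v unfolding m_def using bdd that by (auto intro: cInf_lower)
  have "\<exists>v\<in>W. q v < m + 1 / real (Suc n)" for n
    using cInf_lessD[OF ne, of "m + 1 / real (Suc n)"] unfolding m_def by (auto simp del: of_nat_Suc)
  then obtain s where s: "\<And>n. s n \<in> W" "\<And>n. q (s n) < m + 1 / real (Suc n)" by metis
  have close: "(norm (s i - s j))\<^sup>2 \<le> 4 * (1 / real (Suc i) + 1 / real (Suc j))" for i j
  proof -
    have "(1/2) *\<^sub>R s i + (1/2) *\<^sub>R s j \<in> W" using s W by (intro subspace_add subspace_scale)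
    then have "inner (s i - s j) (s i - s j) / 8 \<le> (q (s i) + q (s j)) / 2 - m"
      using par[OF s(1) s(1), of i j] m by fastforce
    also have "\<dots> \<le> (1 / real (Suc i) + 1 / real (Suc j)) / 2" using s(2)[of i] s(2)[of j] by argo
    finally show ?thesis by (simp add: power2_norm_eq_inner)
  qed
  have "Cauchy s"
  proof (rule metric_CauchyI)
    fix e :: real assume e: "e > 0"
    obtain N where N: "inverse (real (Suc N)) < e\<^sup>2 / 8" using reals_Archimedean[of "e\<^sup>2 / 8"] e by auto
    have "dist (s i) (s j) < e" if "i \<ge> N" "j \<ge> N" for i j
    proof -
      have "1 / real (Suc i) \<le> 1 / real (Suc N)" "1 / real (Suc j) \<le> 1 / real (Suc N)"
        using that by (auto simp: field_simps)
      then have "(norm (s i - s j))\<^sup>2 < e\<^sup>2"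
        using close[of i j] N by (simp add: inverse_eq_divide del: of_nat_Suc)
      then show ?thesis using e by (simp add: dist_norm power2_less_imp_less)
    qed
    then show "\<exists>M. \<forall>i\<ge>M. \<forall>j\<ge>M. dist (s i) (s j) < e" by blast
  qed
  then obtain a where a: "s \<longlonglongrightarrow> a" using Cauchy_convergent convergent_def by blast
  have aW: "a \<in> W" using closed_sequentially[OF W(2)] s(1) a by blast
  have "continuous_on W q"
    unfolding q_def by (intro continuous_intros bounded_linear_on_continuous[OF l W(1)]) auto
  then have "(\<lambda>n. q (s n)) \<longlonglongrightarrow> q a"
    using a aW s(1) by (auto simp: continuous_on_sequentially comp_def)
  moreover have "(\<lambda>n. m + 1 / real (Suc n)) \<longlonglongrightarrow> m + 0"
    by (intro tendsto_add tendsto_const LIMSEQ_Suc lim_1_over_n)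
  ultimately have "q a \<le> m + 0" by (rule LIMSEQ_le) (use s(2) less_imp_le in blast)
  then have min: "q a \<le> q v" if "v \<in> W" for v using m[OF that] by simp
  have "l v = inner a v" if v: "v \<in> W" for v
  proof -
    define b where "b = inner a v - l v"
    have ineq: "0 \<le> t * b + t\<^sup>2 * (inner v v / 2)" for t
    proof -
      have "a + t *\<^sub>R v \<in> W" using aW v W by (intro subspace_add subspace_scale)
      then have "q a \<le> q (a + t *\<^sub>R v)" by (rule min)
      moreover have "l (a + t *\<^sub>R v) = l a + t * l v" using lD(1)[OF aW v, of 1 t] by simp
      ultimately show ?thesis unfolding q_def b_def
        by (simp add: inner_add_left inner_add_right inner_commute[of v a] power2_eq_square algebra_simps)
    qed
    \<comment> \<open>\<open>ineq\<close> is tested at \<open>t = - b / M\<close>. The added 1 keeps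
      \<open>M\<close> positive for \<open>v = 0\<close> and makes the right-hand side
      \<open>- (b / M)^2\<close>, which is negative unless \<open>b = 0\<close>.\<close>
    define M where "M = inner v v / 2 + 1"
    have M: "M > 0" unfolding M_def by (simp add: add_nonneg_pos)
    have "0 \<le> (- b / M) * b + (- b / M)\<^sup>2 * (M - 1)" using ineq[of "- b / M"] by (simp add: M_def)
    also have "\<dots> = - (b / M)\<^sup>2" using M by (simp add: field_simps power2_eq_square)
    finally have "b = 0" using M by simp
    then show ?thesis unfolding b_def by simp
  qed
  with aW show ?thesis using that by blast
qed

lemma inner_eq_on_subspace_imp_eq:
  fixes W :: "'a::real_inner set"
  assumes "subspace W" "u \<in> W" "v \<in> W" "\<And>w. w \<in> W \<Longrightarrow> inner u w = inner v w"
  shows "u = v"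
  using assms(4)[OF subspace_diff[OF assms(1-3)]]
  by (metis eq_iff_diff_eq_0 inner_diff_left inner_eq_zero_iff)

text \<open>Riesz representation of \<open>v \<mapsto> inner w (T v)\<close> for each
  \<open>w\<close>. The adjoint is taken on the whole target type, with values in \<open>W\<close>,
  so no range space of \<open>T\<close> has to be named; its bound comes from
  \<open>norm (T' w) ^ 2 = inner w (T (T' w))\<close>.\<close>

lemma adjoint_on_exists:
  fixes W :: "'a::{real_inner, complete_space} set" and T :: "'a \<Rightarrow> 'b::{real_inner, complete_space}"
  assumes W: "subspace W" "closed W" and T: "bounded_linear_on W T"
  obtains T' where "bounded_linear_on UNIV T'" "range T' \<subseteq> W"
    "\<And>w v. v \<in> W \<Longrightarrow> inner (T' w) v = inner w (T v)"
proof -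
  obtain C where C: "C > 0" "\<And>v. v \<in> W \<Longrightarrow> norm (T v) \<le> C * norm v"
    using bounded_linear_on_bound[OF T] by metis
  have "\<exists>a\<in>W. \<forall>v\<in>W. inner w (T v) = inner a v" for w
  proof -
    have "bounded_linear_on W (\<lambda>v. inner w (T v))"
      unfolding bounded_linear_on_def
    proof (intro conjI ballI allI exI[of _ "norm w * C"])
      show "norm (inner w (T v)) \<le> norm w * C * norm v" if "v \<in> W" for v
        using Cauchy_Schwarz_ineq2[of w "T v"] mult_left_mono[OF C(2)[OF that] norm_ge_zero[of w]]
        by (simp add: mult.assoc)
    qed (use bounded_linear_onD(1)[OF T W(1)] in \<open>simp add: inner_add_right\<close>)
    from riesz_representation_on[OF W this] show ?thesis by metis
  qed
  then obtain T' where T': "\<And>w. T' w \<in> W" "\<And>w v. v \<in> W \<Longrightarrow> inner w (T v) = inner (T' w) v" by metis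
  have "bounded_linear_on UNIV T'"
    unfolding bounded_linear_on_def
  proof (intro conjI ballI allI exI[of _ C])
    show "T' (a *\<^sub>R u + b *\<^sub>R v) = a *\<^sub>R T' u + b *\<^sub>R T' v" for u v a b
      by (rule inner_eq_on_subspace_imp_eq[OF W(1)])
        (auto simp: T'(1) subspace_add subspace_scale W inner_add_left simp flip: T'(2))
    fix w
    have "(norm (T' w))\<^sup>2 = inner w (T (T' w))" using T' by (simp add: power2_norm_eq_inner)
    also have "\<dots> \<le> norm w * norm (T (T' w))" by (rule norm_cauchy_schwarz)
    also have "\<dots> \<le> norm w * (C * norm (T' w))" using C T' by (intro mult_left_mono) auto
    finally have "norm (T' w) * norm (T' w) \<le> (C * norm w) * norm (T' w)"
      by (simp add: power2_eq_square algebra_simps)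
    then show "norm (T' w) \<le> C * norm w"
      using C(1) by (cases "norm (T' w) = 0") (auto simp: mult_le_cancel_right)
  qed
  then show ?thesis using that[of T'] T' by auto
qed

text \<open>A strongly nondegenerate form comes with a linear homeomorphism, that is, with
  continuity only; this recasts it as a \<open>bounded_linear_on\<close> map.\<close>

lemma continuous_linear_on_imp_bounded:
  assumes "continuous_on W A" "subspace W"
    and "\<forall>u\<in>W. \<forall>v\<in>W. \<forall>a b. A (a *\<^sub>R u + b *\<^sub>R v) = a *\<^sub>R A u + b *\<^sub>R A v"
  shows "bounded_linear_on W A"
proof -
  have A: "A (a *\<^sub>R u) = a *\<^sub>R A u" if "u \<in> W" for a u
    using assms(3)[rule_format, OF that that, of a 0] by simp
  have 0: "0 \<in> W" "A 0 = 0" using assms(2) subspace_0 A[of 0 0] by auto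
  have "\<forall>e>0. \<exists>d>0. \<forall>z\<in>W. dist z 0 < d \<longrightarrow> dist (A z) (A 0) < e"
    using assms(1) 0(1) unfolding continuous_on_iff by blast
  from this[rule_format, OF zero_less_one] obtain d where d: "d > 0"
    "\<And>z. z \<in> W \<Longrightarrow> norm z < d \<Longrightarrow> norm (A z) < 1" using 0 by (auto simp: dist_norm)
  have "norm (A v) \<le> (2 / d) * norm v" if v: "v \<in> W" for v
  proof (cases "v = 0")
    case False
    \<comment> \<open>Scales \<open>v\<close> to norm \<open>d / 2\<close>, strictly inside the ball
      where \<open>A\<close> stays below 1.\<close>
    define r where "r = d / (2 * norm v)"
    have r: "r > 0" using False d by (simp add: r_def)
    have "norm (A (r *\<^sub>R v)) < 1"
      using False d(1) v assms(2) by (intro d(2)) (auto simp: r_def subspace_scale)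
    then have "r * norm (A v) < 1" using A[OF v] r by simp
    then show ?thesis using False d(1) by (simp add: r_def field_simps)
  qed (use 0 in simp)
  then show ?thesis using assms(3) unfolding bounded_linear_on_def by blast
qed

text \<open>If \<open>A\<close> represents \<open>B\<close>, then \<open>Tt A T\<close> represents
  \<open>B'\<close>, where \<open>Tt\<close> is the adjoint of \<open>T\<close>, because
  \<open>B (T u) (T v) = inner (A (T u)) (T v)\<close>. Its inverse is \<open>R A' Rt\<close>, since
  the adjoint \<open>Rt\<close> of \<open>R\<close> inverts \<open>Tt\<close>.\<close>

lemma strongly_nondegenerate_on_pullback:
  fixes W :: "'a::{real_inner, complete_space} set" and W' :: "'b::{real_inner, complete_space} set"
  assumes W: "subspace W" "closed W" and W': "subspace W'" "closed W'"
    and T: "bounded_linear_on W' T" "T ` W' \<subseteq> W" and R: "bounded_linear_on W R" "R ` W \<subseteq> W'"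
    and RT: "\<And>u. u \<in> W' \<Longrightarrow> R (T u) = u" and TR: "\<And>w. w \<in> W \<Longrightarrow> T (R w) = w"
    and B: "\<And>u v. u \<in> W' \<Longrightarrow> v \<in> W' \<Longrightarrow> B' u v = B (T u) (T v)"
    and nd: "strongly_nondegenerate_on W B"
  shows "strongly_nondegenerate_on W' B'"
proof -
  obtain A A' where hom: "homeomorphism W W A A'"
    and linA: "\<forall>u\<in>W. \<forall>v\<in>W. \<forall>a b. A (a *\<^sub>R u + b *\<^sub>R v) = a *\<^sub>R A u + b *\<^sub>R A v"
    and BA: "\<forall>u\<in>W. \<forall>v\<in>W. B u v = inner (A u) v"
    using nd unfolding strongly_nondegenerate_on_def by blast
  note homD = homeomorphism_apply1[OF hom] homeomorphism_apply2[OF hom] homeomorphism_cont1[OF hom]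
    homeomorphism_cont2[OF hom] homeomorphism_image1[OF hom] homeomorphism_image2[OF hom]
  obtain Tt where Tt: "bounded_linear_on UNIV Tt" "range Tt \<subseteq> W'"
    "\<And>w v. v \<in> W' \<Longrightarrow> inner (Tt w) v = inner w (T v)"
    using adjoint_on_exists[OF W' T(1)] by metis
  obtain Rt where Rt: "bounded_linear_on UNIV Rt" "range Rt \<subseteq> W"
    "\<And>w v. v \<in> W \<Longrightarrow> inner (Rt w) v = inner w (R v)"
    using adjoint_on_exists[OF W R(1)] by metis
  \<comment> \<open>Adjoints reverse composition: \<open>Tt Rt\<close> is the adjoint of
    \<open>R T\<close>, the identity of \<open>W'\<close>, and is compared with it by testing
    against vectors of \<open>W'\<close>.\<close>
  have TtRt: "Tt (Rt u) = u" if "u \<in> W'" for u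
    using that Tt(2) T(2) Rt RT by (intro inner_eq_on_subspace_imp_eq[OF W'(1)]) (auto simp: Tt(3) image_subset_iff)
  have RtTt: "Rt (Tt w) = w" if "w \<in> W" for w
    using that Rt(2) R(2) Tt TR by (intro inner_eq_on_subspace_imp_eq[OF W(1)]) (auto simp: Rt(3) image_subset_iff)
  have A: "bounded_linear_on W A"
    using continuous_linear_on_imp_bounded[OF homD(3) W(1) linA] .
  have contTt: "continuous_on X Tt" "continuous_on X' Rt" for X X'
    using bounded_linear_on_continuous[OF Tt(1)] bounded_linear_on_continuous[OF Rt(1)]
    by (auto intro: continuous_on_subset)
  have mem: "A w \<in> W" "A' w \<in> W" "R w \<in> W'" if "w \<in> W" for w
    using that homD(5,6) R(2) by blast+
  have TW: "T u \<in> W" if "u \<in> W'" for u using that T(2) by blast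
  have "Tt w \<in> W'" "Rt w' \<in> W" for w w' using Tt(2) Rt(2) by blast+
  note mem' = TW this
  have "homeomorphism W' W' (\<lambda>u. Tt (A (T u))) (\<lambda>u. R (A' (Rt u)))"
    unfolding homeomorphism_def
  proof (intro conjI ballI)
    show 1: "R (A' (Rt (Tt (A (T u))))) = u" if "u \<in> W'" for u
      using that mem mem' by (simp add: RtTt homD(1) RT)
    show 2: "Tt (A (T (R (A' (Rt u))))) = u" if "u \<in> W'" for u
      using that mem mem' by (simp add: TR homD(2) TtRt)
    show "(\<lambda>u. Tt (A (T u))) ` W' = W'"
    proof safe
      fix u assume u: "u \<in> W'"
      then show "Tt (A (T u)) \<in> W'" using mem' by blast
      have "R (A' (Rt u)) \<in> W'" using u mem mem' by blast
      then show "u \<in> (\<lambda>u. Tt (A (T u))) ` W'" using 2[OF u, symmetric] by blast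
    qed
    show "(\<lambda>u. R (A' (Rt u))) ` W' = W'"
    proof safe
      fix u assume u: "u \<in> W'"
      then show "R (A' (Rt u)) \<in> W'" using mem mem' by blast
      have "Tt (A (T u)) \<in> W'" using u mem mem' by blast
      then show "u \<in> (\<lambda>u. R (A' (Rt u))) ` W'" using 1[OF u, symmetric] by blast
    qed
    have "continuous_on W' (A \<circ> T)"
      using bounded_linear_on_continuous[OF T(1) W'(1)] homD(3) T(2)
      by (intro continuous_on_compose) (auto intro: continuous_on_subset)
    from continuous_on_compose[OF this contTt(1)]
    show "continuous_on W' (\<lambda>u. Tt (A (T u)))" by (simp add: comp_def)
    have "continuous_on W' (A' \<circ> Rt)"
      by (intro continuous_on_compose contTt(2) continuous_on_subset[OF homD(4)]) (use Rt(2) in auto)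
    moreover have "continuous_on ((A' \<circ> Rt) ` W') R"
      by (rule continuous_on_subset[OF bounded_linear_on_continuous[OF R(1) W(1)]])
        (use Rt(2) homD(6) in auto)
    ultimately have "continuous_on W' (R \<circ> (A' \<circ> Rt))"
      by (rule continuous_on_compose)
    then show "continuous_on W' (\<lambda>u. R (A' (Rt u)))" by (simp add: comp_def)
  qed
  moreover have "Tt (A (T (a *\<^sub>R u + b *\<^sub>R v))) = a *\<^sub>R Tt (A (T u)) + b *\<^sub>R Tt (A (T v))"
    if uv: "u \<in> W'" "v \<in> W'" for u v a b
    unfolding bounded_linear_onD(1)[OF T(1) W'(1) uv] bounded_linear_onD(1)[OF A W(1) TW[OF uv(1)] TW[OF uv(2)]]
      bounded_linear_onD(1)[OF Tt(1) subspace_UNIV UNIV_I UNIV_I] ..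
  moreover have "B' u v = inner (Tt (A (T u))) v" if uv: "u \<in> W'" "v \<in> W'" for u v
    unfolding B[OF uv] Tt(3)[OF uv(2)] using BA TW uv by blast
  ultimately have "homeomorphism W' W' (\<lambda>u. Tt (A (T u))) (\<lambda>u. R (A' (Rt u))) \<and>
      (\<forall>u\<in>W'. \<forall>v\<in>W'. \<forall>a b. Tt (A (T (a *\<^sub>R u + b *\<^sub>R v))) = a *\<^sub>R Tt (A (T u)) + b *\<^sub>R Tt (A (T v))) \<and>
      (\<forall>u\<in>W'. \<forall>v\<in>W'. B' u v = inner (Tt (A (T u))) v)"
    by blast
  then show ?thesis unfolding strongly_nondegenerate_on_def by (intro exI) assumption
qed

lemma strongly_nondegenerate_on_imp_zero:
  assumes "strongly_nondegenerate_on W B" "subspace W" "u \<in> W" "\<And>v. v \<in> W \<Longrightarrow> B u v = 0"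
  shows "u = 0"
proof -
  obtain A A' where hom: "homeomorphism W W A A'"
    and lin: "\<forall>u\<in>W. \<forall>v\<in>W. \<forall>a b. A (a *\<^sub>R u + b *\<^sub>R v) = a *\<^sub>R A u + b *\<^sub>R A v"
    and B: "\<forall>u\<in>W. \<forall>v\<in>W. B u v = inner (A u) v"
    using assms(1) unfolding strongly_nondegenerate_on_def by blast
  have Au: "A u \<in> W" using homeomorphism_image1[OF hom] assms(3) by blast
  then have "inner (A u) (A u) = 0" using B assms(3,4) by metis
  then have "A u = 0" by simp
  moreover have "A 0 = 0"
    using lin[rule_format, OF subspace_0 subspace_0, OF assms(2,2), of 0 0] by simp
  ultimately show ?thesis
    using homeomorphism_apply1[OF hom] assms(3) subspace_0[OF assms(2)] by metis
qed

text \<open>If \<open>T u_n\<close> converges to \<open>y\<close>, then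
  \<open>u_n = R (T u_n)\<close> converges to \<open>R y\<close>, and continuity of \<open>T\<close>
  gives \<open>y = T (R y)\<close>. It is applied to differentials with a left inverse, whose images
  are to serve as closed complements.\<close>

lemma closed_image_left_inverse:
  fixes W :: "'a::metric_space set" and T :: "'a \<Rightarrow> 'b::metric_space"
  assumes W: "closed W" and E: "closed E" "T ` W \<subseteq> E"
    and R: "continuous_on E R" and T: "continuous_on W T" and RT: "\<And>u. u \<in> W \<Longrightarrow> R (T u) = u"
  shows "closed (T ` W)"
  unfolding closed_sequential_limits
proof (intro allI impI, elim conjE)
  fix s y assume s: "\<forall>n. s n \<in> T ` W" and y: "s \<longlonglongrightarrow> y"
  then have yE: "y \<in> E" using closed_sequentially[OF E(1)] E(2) by blast
  have "\<forall>n. \<exists>x. x \<in> W \<and> s n = T x" using s by blast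
  then obtain u where u: "\<And>n. u n \<in> W" "\<And>n. s n = T (u n)" by metis
  have "s n \<in> E" for n using s E(2) by blast
  then have "(\<lambda>n. R (s n)) \<longlonglongrightarrow> R y"
    using R yE y unfolding continuous_on_sequentially comp_def by blast
  then have "u \<longlonglongrightarrow> R y" by (simp add: u RT)
  moreover from this have Ry: "R y \<in> W" using closed_sequentially[OF W] u(1) by blast
  ultimately have "(\<lambda>n. T (u n)) \<longlonglongrightarrow> T (R y)"
    using T u(1) unfolding continuous_on_sequentially comp_def by blast
  then have "y = T (R y)" using y LIMSEQ_unique by (simp add: u(2)[symmetric])
  then show "y \<in> T ` W" using Ry by blast
qed


section \<open>Projections along finite dimensional subspaces\<close>

text \<open>\<open>b\<close> has positive distance from the closed set \<open>W\<close>; this bounds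
  the coefficient of \<open>b\<close>, and the bound makes coefficients of convergent sequences
  Cauchy, which gives closedness. Both outputs drive the induction that follows.\<close>

lemma closed_subspace_insert:
  fixes W :: "'a::real_normed_vector set"
  assumes W: "subspace W" "closed W" and b: "b \<notin> W"
  obtains K where "K > 0" "\<And>w t. w \<in> W \<Longrightarrow> \<bar>t\<bar> \<le> K * norm (w + t *\<^sub>R b)"
    "subspace {w + t *\<^sub>R b |w t. w \<in> W}" "closed {w + t *\<^sub>R b |w t. w \<in> W}"
proof -
  have "open (- W)" using W(2) by blast
  then obtain e where e: "e > 0" "ball b e \<subseteq> - W" using b openE by (metis ComplI)
  have K: "\<bar>t\<bar> \<le> (1 / e) * norm (w + t *\<^sub>R b)" if w: "w \<in> W" for w t
  proof (cases "t = 0")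
    case False
    \<comment> \<open>\<open>w + t b\<close> is \<open>t\<close> times the difference of
      \<open>b\<close> and the point \<open>(- 1 / t) w\<close> of \<open>W\<close>, and that point
      is at least \<open>e\<close> away from \<open>b\<close>.\<close>
    have "(- 1 / t) *\<^sub>R w \<in> W" using w W(1) by (rule subspace_scale[rotated])
    then have "\<not> dist b ((- 1 / t) *\<^sub>R w) < e" using e(2) by (auto simp: subset_iff)
    then have "e * \<bar>t\<bar> \<le> \<bar>t\<bar> * norm (b + (1 / t) *\<^sub>R w)" using mult_left_mono[of e "norm (b + (1 / t) *\<^sub>R w)" "\<bar>t\<bar>"] by (simp add: dist_norm mult.commute)
    also have "\<dots> = norm (t *\<^sub>R (b + (1 / t) *\<^sub>R w))" by simp
    also have "t *\<^sub>R (b + (1 / t) *\<^sub>R w) = w + t *\<^sub>R b"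
      using False by (simp add: scaleR_add_right add.commute)
    finally show ?thesis using e(1) by (simp add: field_simps)
  qed (use e(1) in simp)
  have "subspace {w + t *\<^sub>R b |w t. w \<in> W}"
  proof (rule subspaceI)
    show "0 \<in> {w + t *\<^sub>R b |w t. w \<in> W}" using subspace_0[OF W(1)] by force
    fix x y c assume "x \<in> {w + t *\<^sub>R b |w t. w \<in> W}"
    then obtain w t where x: "x = w + t *\<^sub>R b" "w \<in> W" by blast
    have "c *\<^sub>R x = c *\<^sub>R w + (c * t) *\<^sub>R b" by (simp add: x scaleR_add_right)
    then show "c *\<^sub>R x \<in> {w + t *\<^sub>R b |w t. w \<in> W}" using subspace_scale[OF W(1) x(2)] by blast
    assume "y \<in> {w + t *\<^sub>R b |w t. w \<in> W}"
    then obtain w' t' where y: "y = w' + t' *\<^sub>R b" "w' \<in> W" by blast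
    have "x + y = (w + w') + (t + t') *\<^sub>R b" by (simp add: x y scaleR_add_left)
    then show "x + y \<in> {w + t *\<^sub>R b |w t. w \<in> W}" using subspace_add[OF W(1) x(2) y(2)] by blast
  qed
  moreover have "closed {w + t *\<^sub>R b |w t. w \<in> W}"
    unfolding closed_sequential_limits
  proof (intro allI impI, elim conjE)
    fix s y assume s: "\<forall>n. s n \<in> {w + t *\<^sub>R b |w t. w \<in> W}" and y: "s \<longlonglongrightarrow> y"
    then have "\<forall>n. \<exists>w t. w \<in> W \<and> s n = w + t *\<^sub>R b" by blast
    then obtain w t where wt: "\<And>n. w n \<in> W" "\<And>n. s n = w n + t n *\<^sub>R b" by metis
    have "Cauchy t"
    proof (rule metric_CauchyI)
      fix r :: real assume r: "r > 0"
      obtain N where N: "\<And>i j. i \<ge> N \<Longrightarrow> j \<ge> N \<Longrightarrow> dist (s i) (s j) < r * e"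
        using metric_CauchyD[OF LIMSEQ_imp_Cauchy[OF y], of "r * e"] r e(1) by auto
      have "dist (t i) (t j) < r" if ij: "i \<ge> N" "j \<ge> N" for i j
      proof -
        have "w i - w j \<in> W" using wt(1) W(1) by (intro subspace_diff)
        from K[OF this, of "t i - t j"] have "\<bar>t i - t j\<bar> \<le> (1 / e) * norm (s i - s j)"
          by (simp add: wt(2) algebra_simps)
        also have "\<dots> < r" using N[OF ij] e(1) by (simp add: dist_norm field_simps)
        finally show ?thesis by (simp add: dist_real_def)
      qed
      then show "\<exists>M. \<forall>i\<ge>M. \<forall>j\<ge>M. dist (t i) (t j) < r" by blast
    qed
    then obtain t0 where t0: "t \<longlonglongrightarrow> t0" using Cauchy_convergent convergent_def by blast
    have "(\<lambda>n. s n - t n *\<^sub>R b) \<longlonglongrightarrow> y - t0 *\<^sub>R b" by (intro tendsto_intros y t0)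
    then have "w \<longlonglongrightarrow> y - t0 *\<^sub>R b" by (simp add: wt(2))
    then have "y - t0 *\<^sub>R b \<in> W" using closed_sequentially[OF W(2)] wt(1) by blast
    then show "y \<in> {w + t *\<^sub>R b |w t. w \<in> W}" by (auto intro!: exI[of _ "y - t0 *\<^sub>R b"])
  qed
  ultimately show ?thesis using that[of "1 / e"] e(1) K by auto
qed

text \<open>Induction on the basis with \<open>W\<close> generalised: the new basis vector is moved
  from the span into \<open>W\<close>, which stays a closed subspace by
  \<open>closed_subspace_insert\<close>. The bound expresses continuity of the projection to
  \<open>span B\<close> along \<open>W\<close>.\<close>

lemma finite_dim_complement_bound:
  fixes W :: "'a::real_normed_vector set"
  assumes "finite B" "independent B" "subspace W" "closed W" "W \<inter> span B = {0}"
  shows "\<exists>C>0. \<forall>w\<in>W. \<forall>d\<in>span B. norm d \<le> C * norm (w + d)"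
  using assms
proof (induction B arbitrary: W rule: finite_induct)
  case empty
  show ?case by (rule exI[of _ 1]) simp
next
  case (insert b B)
  let ?W' = "{w + t *\<^sub>R b |w t. w \<in> W}"
  have b: "b \<notin> span B" "independent B" using insert.prems(1) insert.hyps(2) by (auto simp: independent_insert)
  have "b \<noteq> 0" using b span_zero by metis
  then have bW: "b \<notin> W" using insert.prems(4) span_base[of b "insert b B"] by blast
  obtain K where K: "K > 0" "\<And>w t. w \<in> W \<Longrightarrow> \<bar>t\<bar> \<le> K * norm (w + t *\<^sub>R b)" "subspace ?W'" "closed ?W'"
    using closed_subspace_insert[OF insert.prems(2,3) bW] by metis
  have "?W' \<inter> span B \<subseteq> {0}"
  proof (intro subsetI, elim IntE)
    fix x assume "x \<in> ?W'" and x: "x \<in> span B"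
    then obtain w t where wt: "x = w + t *\<^sub>R b" "w \<in> W" by blast
    have "w = x - t *\<^sub>R b" using wt by simp
    also have "\<dots> \<in> span (insert b B)"
      using x by (meson insertI1 span_base span_diff span_mono span_scale subset_insertI subsetD)
    finally have w0: "w = 0" using insert.prems(4) wt(2) by blast
    have "t = 0"
    proof (rule ccontr)
      assume "t \<noteq> 0"
      then have "b = (1 / t) *\<^sub>R x" using wt w0 by simp
      then show False using b(1) x span_scale by metis
    qed
    then show "x \<in> {0}" using wt w0 by simp
  qed
  moreover have "0 \<in> ?W' \<inter> span B" using subspace_0[OF K(3)] span_zero by blast
  ultimately have "?W' \<inter> span B = {0}" by blast
  from insert.IH[OF b(2) K(3,4) this] obtain C where
    C: "C > 0" "\<And>w d. w \<in> ?W' \<Longrightarrow> d \<in> span B \<Longrightarrow> norm d \<le> C * norm (w + d)" by blast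
  \<comment> \<open>With \<open>d = t b + d'\<close> and all bounds in multiples of
    \<open>norm (w + d)\<close>: the induction hypothesis for the enlarged \<open>W\<close> bounds
    \<open>d'\<close> by \<open>C\<close>, hence \<open>w + t b\<close> by \<open>1 + C\<close>, and
    \<open>K\<close> turns the latter into a bound on \<open>t\<close>.\<close>
  show ?case
  proof (intro exI[of _ "K * norm b * (1 + C) + C"] conjI ballI)
    show "K * norm b * (1 + C) + C > 0" using K(1) C(1) by (simp add: add_nonneg_pos)
    fix w d assume w: "w \<in> W" and d: "d \<in> span (insert b B)"
    then obtain t where t: "d - t *\<^sub>R b \<in> span B" by (auto simp: span_insert)
    define d' where "d' = d - t *\<^sub>R b"
    let ?n = "norm (w + d)"
    have "w + t *\<^sub>R b \<in> ?W'" using w by blast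
    from C(2)[OF this t] have 1: "norm d' \<le> C * ?n" by (simp add: d'_def)
    have "norm (w + t *\<^sub>R b) \<le> ?n + norm d'"
      using norm_triangle_ineq4[of "w + d" d'] by (simp add: d'_def)
    with 1 have 2: "norm (w + t *\<^sub>R b) \<le> (1 + C) * ?n" by (simp add: algebra_simps)
    have "norm (t *\<^sub>R b) \<le> K * norm (w + t *\<^sub>R b) * norm b" using K(2)[OF w, of t] by (simp add: mult_right_mono)
    also have "\<dots> \<le> K * ((1 + C) * ?n) * norm b"
      using K(1) 2 by (intro mult_right_mono mult_left_mono) auto
    finally have "norm (t *\<^sub>R b) \<le> K * ((1 + C) * ?n) * norm b" .
    moreover have "norm d \<le> norm (t *\<^sub>R b) + norm d'"
      using norm_triangle_ineq[of "t *\<^sub>R b" d'] by (simp add: d'_def)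
    ultimately show "norm d \<le> (K * norm b * (1 + C) + C) * ?n" using 1 by (simp add: algebra_simps)
  qed
qed

lemma is_direct_sum_subset:
  assumes "is_direct_sum E W D"
  shows "W \<subseteq> E" "D \<subseteq> E"
proof -
  have 0: "0 \<in> W" "0 \<in> D" and E: "\<And>w d. w \<in> W \<Longrightarrow> d \<in> D \<Longrightarrow> w + d \<in> E"
    using assms by (auto simp: is_direct_sum_def subspace_0)
  show "W \<subseteq> E" "D \<subseteq> E" using E[OF _ 0(2)] E[OF 0(1)] by auto
qed

lemma is_direct_sumE:
  assumes "is_direct_sum E W D" "v \<in> E"
  obtains w d where "w \<in> W" "d \<in> D" "v = w + d"
  using assms unfolding is_direct_sum_def by auto

text \<open>The decomposition is unique, so \<open>p\<close> is well defined and linear. Closedness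
  of \<open>W\<close> and finite dimension of \<open>D\<close> give its continuity, through the
  bound on the \<open>D\<close> component.\<close>

lemma projection_along_exists:
  fixes W :: "'a::real_normed_vector set"
  assumes sum: "is_direct_sum E W D" and "closed W" and B: "finite B" "D = span B"
  obtains p where "bounded_linear_on E p" "p ` E \<subseteq> W" "\<And>u. u \<in> E \<Longrightarrow> u - p u \<in> D"
    "\<And>w d. w \<in> W \<Longrightarrow> d \<in> D \<Longrightarrow> p (w + d) = w"
proof -
  have W: "subspace W" "subspace D" "W \<inter> D = {0}" "E = {w + d |w d. w \<in> W \<and> d \<in> D}"
    using sum unfolding is_direct_sum_def by auto
  \<comment> \<open>\<open>B\<close> is only a spanning set, and the bound above wants a
    basis.\<close>
  obtain B' where B': "B' \<subseteq> D" "independent B'" "D = span B'"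
    using basis_exists[of D] W(2) by (metis span_subspace)
  then have "finite B'" using independent_span_bound[OF B(1)] B(2) by blast
  then obtain C where C: "C > 0" "\<And>w d. w \<in> W \<Longrightarrow> d \<in> D \<Longrightarrow> norm d \<le> C * norm (w + d)"
    using finite_dim_complement_bound[OF _ B'(2) W(1) \<open>closed W\<close>] W(3) B'(3) by metis
  have uniq: "w = w'" if "w \<in> W" "w' \<in> W" "d \<in> D" "d' \<in> D" "w + d = w' + d'" for w w' d d'
  proof -
    have "w - w' = d' - d" using that(5) by (simp add: algebra_simps)
    moreover have "w - w' \<in> W" "d' - d \<in> D" using that W(1,2) by (auto intro: subspace_diff)
    ultimately have "w - w' \<in> W \<inter> D" by simp
    then show ?thesis using W(3) by simp
  qed
  have "\<forall>u\<in>E. \<exists>w\<in>W. u - w \<in> D" unfolding W(4) by force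
  then obtain p where p: "\<And>u. u \<in> E \<Longrightarrow> p u \<in> W" "\<And>u. u \<in> E \<Longrightarrow> u - p u \<in> D" by metis
  have E: "w + d \<in> E" if "w \<in> W" "d \<in> D" for w d using that W(4) by blast
  have pe: "p (w + d) = w" if "w \<in> W" "d \<in> D" for w d
    using uniq[OF p(1)[OF E[OF that]] that(1) p(2)[OF E[OF that]] that(2)] by simp
  have "bounded_linear_on E p"
    unfolding bounded_linear_on_def
  proof (intro conjI ballI allI exI[of _ "1 + C"])
    fix u v a b assume uv: "u \<in> E" "v \<in> E"
    have "a *\<^sub>R u + b *\<^sub>R v = (a *\<^sub>R p u + b *\<^sub>R p v) + (a *\<^sub>R (u - p u) + b *\<^sub>R (v - p v))"
      by (simp add: algebra_simps)
    also have "p \<dots> = a *\<^sub>R p u + b *\<^sub>R p v"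
      using p uv W(1,2) by (intro pe subspace_add subspace_scale) auto
    finally show "p (a *\<^sub>R u + b *\<^sub>R v) = a *\<^sub>R p u + b *\<^sub>R p v" .
  next
    fix u assume u: "u \<in> E"
    have "norm (u - p u) \<le> C * norm u" using C(2)[OF p(1)[OF u] p(2)[OF u]] by simp
    then show "norm (p u) \<le> (1 + C) * norm u"
      using norm_triangle_sub[of "p u" u] by (simp add: norm_minus_commute algebra_simps)
  qed
  then show ?thesis using that p pe by blast
qed

text \<open>The projection to \<open>W\<close> along \<open>D\<close>, restricted to
  \<open>W'\<close>, is an isomorphism; its inverse is the projection to \<open>W'\<close> along
  \<open>D\<close>. It preserves \<open>H\<close> because it changes vectors only by elements of
  \<open>D\<close>, which lie in the radical. The radical condition is stated in both slots, as
  symmetry of \<open>H\<close> is not at hand.\<close>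

lemma strongly_nondegenerate_on_complement:
  fixes W W' :: "'a::{real_inner, complete_space} set"
  assumes sum: "is_direct_sum E W D" "is_direct_sum E W' D" and cl: "closed W" "closed W'"
    and B: "finite B" "D = span B" and E: "subspace E"
    and H: "\<And>u v w. u \<in> E \<Longrightarrow> v \<in> E \<Longrightarrow> w \<in> E \<Longrightarrow> H (u + v) w = H u w + H v w"
      "\<And>u v w. u \<in> E \<Longrightarrow> v \<in> E \<Longrightarrow> w \<in> E \<Longrightarrow> H w (u + v) = H w u + H w v"
    and rad: "\<And>u d. u \<in> E \<Longrightarrow> d \<in> D \<Longrightarrow> H u d = 0" "\<And>u d. u \<in> E \<Longrightarrow> d \<in> D \<Longrightarrow> H d u = 0"
    and nd: "strongly_nondegenerate_on W H"
  shows "strongly_nondegenerate_on W' H"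
proof -
  obtain p where p: "bounded_linear_on E p" "p ` E \<subseteq> W" "\<And>u. u \<in> E \<Longrightarrow> u - p u \<in> D"
    "\<And>w d. w \<in> W \<Longrightarrow> d \<in> D \<Longrightarrow> p (w + d) = w"
    using projection_along_exists[OF sum(1) cl(1) B] by metis
  obtain p' where p': "bounded_linear_on E p'" "p' ` E \<subseteq> W'" "\<And>u. u \<in> E \<Longrightarrow> u - p' u \<in> D"
    "\<And>w d. w \<in> W' \<Longrightarrow> d \<in> D \<Longrightarrow> p' (w + d) = w"
    using projection_along_exists[OF sum(2) cl(2) B] by metis
  have sub: "subspace W" "subspace W'" "subspace D" using sum unfolding is_direct_sum_def by auto
  have WE: "W \<subseteq> E" "W' \<subseteq> E" "D \<subseteq> E"
    using is_direct_sum_subset[OF sum(1)] is_direct_sum_subset[OF sum(2)] by auto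
  show ?thesis
  proof (rule strongly_nondegenerate_on_pullback[OF sub(1) cl(1) sub(2) cl(2)
        bounded_linear_on_subset[OF p(1) WE(2)] _ bounded_linear_on_subset[OF p'(1) WE(1)] _ _ _ _ nd])
    show "p ` W' \<subseteq> W" "p' ` W \<subseteq> W'" using p(2) p'(2) WE by blast+
    show "p' (p u) = u" if "u \<in> W'" for u
      using p'(4)[OF that, of "- (u - p u)"] p(3)[of u] that WE subspace_neg[OF sub(3)] by fastforce
    show "p (p' u) = u" if "u \<in> W" for u
      using p(4)[OF that, of "- (u - p' u)"] p'(3)[of u] that WE subspace_neg[OF sub(3)] by fastforce
    fix u v assume "u \<in> W'" "v \<in> W'"
    then have uv: "u \<in> E" "v \<in> E" using WE by auto
    then have mem: "p u \<in> E" "u - p u \<in> E" "p v \<in> E" "v - p v \<in> E" using p(2,3) WE by blast+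
    have "H u v = H (p u) v + H (u - p u) v" using H(1)[OF mem(1,2) uv(2)] by simp
    also have "H (u - p u) v = 0" using rad(2)[OF uv(2) p(3)[OF uv(1)]] .
    also have "H (p u) v = H (p u) (p v) + H (p u) (v - p v)" using H(2)[OF mem(3,4,1)] by simp
    also have "H (p u) (v - p v) = 0" using rad(1)[OF mem(1) p(3)[OF uv(2)]] .
    finally show "H u v = H (p u) (p v)" by simp
  qed
qed

lemma linear_on_span_image:
  assumes T: "bounded_linear_on E T" and E: "E = span B"
  shows "T ` E = span (T ` B)"
proof
  have sE: "subspace E" using E by simp
  show "span (T ` B) \<subseteq> T ` E"
    using subspace_image_linear_on[OF T sE] span_superset[of B] E by (intro span_minimal) auto
  have "x \<in> E \<and> T x \<in> span (T ` B)" if "x \<in> span B" for x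
    using that
  proof (induction rule: span_induct_alt)
    case base
    then show ?case
      using bounded_linear_onD(5)[OF T sE subspace_0 subspace_0, OF sE sE] sE by (simp add: span_zero subspace_0)
  next
    case (step c x y)
    then have x: "x \<in> E" "T x \<in> span (T ` B)" using E by (auto intro: span_base)
    with step show ?case
      using bounded_linear_onD(1)[OF T sE, of x y c 1] sE
      by (auto intro!: span_add span_scale subspace_add subspace_scale)
  qed
  then show "T ` E \<subseteq> span (T ` B)" using E by auto
qed

text \<open>\<open>T\<close> is linear only on \<open>E\<close>; a map \<open>g\<close> that is
  linear on the whole type and agrees with \<open>T\<close> on a basis of \<open>D\<close> carries
  independence over. An independent set of \<open>dim D'\<close> vectors in \<open>D'\<close> then
  spans \<open>D'\<close>.\<close>

lemma linear_on_image_eq_if_dim_eq: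
  fixes T :: "'a::real_normed_vector \<Rightarrow> 'b::real_normed_vector"
  assumes T: "bounded_linear_on E T" and sub: "D \<subseteq> E" "T ` D \<subseteq> D'" and inj: "inj_on T D"
    and B: "finite B" "D = span B" and B': "finite B'" "D' = span B'" and dim: "dim D = dim D'"
  shows "T ` D = D'"
proof -
  obtain b where b: "b \<subseteq> D" "independent b" "D \<subseteq> span b" "card b = dim D" using basis_exists by blast
  have Db: "D = span b" using b(1,3) B(2) by (metis span_minimal subset_antisym subspace_span)
  have finb: "finite b" using independent_span_bound[OF B(1) b(2)] b(1) B(2) by blast
  obtain g where g: "linear g" "\<And>x. x \<in> b \<Longrightarrow> g x = T x"
    using linear_independent_extend[OF b(2)] by metis
  note TD = bounded_linear_on_subset[OF T sub(1)]
  have sD: "subspace D" using B by simp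
  have gT': "x \<in> D \<and> g x = T x" if "x \<in> span b" for x
    using that
  proof (induction rule: span_induct_alt)
    case base
    then show ?case
      using bounded_linear_onD(5)[OF TD sD subspace_0 subspace_0, OF sD sD] linear_0[OF g(1)] sD
      by (simp add: subspace_0)
  next
    case (step c x y)
    then have "x \<in> D" "y \<in> D" using b(1) by auto
    with step show ?case
      using bounded_linear_onD(1)[OF TD sD, of x y c 1] g sD
      by (simp add: linear_add linear_scale subspace_add subspace_scale)
  qed
  then have gT: "g x = T x" if "x \<in> span b" for x using that by blast
  have "inj_on g (span b)" using inj gT Db inj_on_cong[of "span b" g T] by simp
  then have ind: "independent (g ` b)" using linear_independent_injective_image[OF g(1) b(2)] by blast
  have gb: "g ` b \<subseteq> D'" using sub(2) b(1) g(2) by auto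
  have card: "card (g ` b) = dim D'"
    using \<open>inj_on g (span b)\<close> dim b(4) card_image inj_on_subset span_superset by metis
  obtain c where c: "c \<subseteq> D'" "independent c" "D' \<subseteq> span c" "card c = dim D'" using basis_exists by blast
  have finc: "finite c" using independent_span_bound[OF B'(1) c(2)] c(1) B'(2) by blast
  have "D' \<subseteq> span (g ` b)"
  proof (rule ccontr)
    \<comment> \<open>A missed vector would give an independent set of more than
      \<open>card c\<close> vectors inside \<open>span c\<close>.\<close>
    assume "\<not> D' \<subseteq> span (g ` b)"
    then obtain x where x: "x \<in> D'" "x \<notin> span (g ` b)" by blast
    then have "x \<notin> g ` b" "independent (insert x (g ` b))"
      using ind span_base[of x "g ` b"] by (auto simp: independent_insert)
    moreover have "insert x (g ` b) \<subseteq> span c" using x gb c(3) by blast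
    ultimately have "Suc (card (g ` b)) \<le> card c"
      using independent_span_bound[OF finc] finb by fastforce
    then show False using card c(4) by simp
  qed
  also have "span (g ` b) = g ` span b" using linear_span_image[OF g(1)] .
  also have "\<dots> = T ` D" using gT Db by auto
  finally show ?thesis using sub(2) by blast
qed


section \<open>Charts\<close>

lemma bounded_linear_on_has_derivs:
  assumes "has_derivs k E V g D" "x \<in> V" "1 \<le> k"
  shows "bounded_linear_on E (\<lambda>v. D x [v])"
  using has_derivs_multilinear[OF assms(1,2,3)]
  unfolding bounded_multilinear_on_1_iff bounded_linear_on_def .

lemma is_chart_cdom:
  assumes "is_chart T c"
  shows "openin T (cdom c)" "subspace (cmodel c)" "closed (cmodel c)"
    "openin (top_of_set (cmodel c)) (cmap c ` cdom c)" "cdom c \<subseteq> topspace T" "cmap c ` cdom c \<subseteq> cmodel c"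
proof -
  show *: "openin T (cdom c)" "subspace (cmodel c)" "closed (cmodel c)"
    "openin (top_of_set (cmodel c)) (cmap c ` cdom c)"
    using assms unfolding is_chart_def by simp_all
  show "cdom c \<subseteq> topspace T" "cmap c ` cdom c \<subseteq> cmodel c"
    using openin_subset[OF *(1)] openin_imp_subset[OF *(4)] .
qed

lemma is_chart_inj:
  assumes "is_chart T c"
  shows "inj_on (cmap c) (cdom c)"
proof -
  have "topspace (subtopology T (cdom c)) = cdom c"
    using is_chart_cdom(5)[OF assms] by auto
  then show ?thesis
    using assms homeomorphic_imp_injective_map unfolding is_chart_def by metis
qed

lemma cinv_cmap [simp]: "is_chart T c \<Longrightarrow> p \<in> cdom c \<Longrightarrow> cinv c (cmap c p) = p"
  by (rule inv_into_f_f[OF is_chart_inj])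

lemma is_chart_open_image:
  assumes c: "is_chart T c" and U: "openin T U" "U \<subseteq> cdom c"
  shows "openin (top_of_set (cmodel c)) (cmap c ` U)"
proof -
  have "openin (subtopology T (cdom c)) U" using U by (simp add: openin_open_subtopology is_chart_cdom(1)[OF c])
  moreover have "open_map (subtopology T (cdom c)) (top_of_set (cmap c ` cdom c)) (cmap c)"
    using c homeomorphic_imp_open_map unfolding is_chart_def by blast
  ultimately have "openin (top_of_set (cmap c ` cdom c)) (cmap c ` U)"
    unfolding open_map_def by blast
  then show ?thesis using is_chart_cdom(4)[OF c] by (rule openin_trans)
qed

section \<open>Slices and products of charts\<close>

lemma openin_slice:
  assumes "openin (top_of_set (E1 \<times> E2)) V" "y \<in> E2"
  shows "openin (top_of_set E1) {x. (x, y) \<in> V}"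
proof -
  obtain U where U: "open U" "V = (E1 \<times> E2) \<inter> U" using assms(1) by (auto simp: openin_open)
  have "open ((\<lambda>x. (x, y)) -` U)" by (intro open_vimage U(1) continuous_intros)
  moreover have "{x. (x, y) \<in> V} = E1 \<inter> (\<lambda>x. (x, y)) -` U" using U(2) assms(2) by auto
  ultimately show ?thesis by (auto simp: openin_open)
qed

text \<open>Orbit maps \<open>a \<mapsto> act a y\<close> are differentiated in charts of the group
  alone, whereas \<open>C1_action\<close> speaks of the product. Fixing the second coordinate feeds
  the derivative with vectors \<open>(v, 0)\<close>, and \<open>0 \<in> E2\<close> keeps these in
  the product.\<close>

lemma has_derivs_slice:
  assumes D: "has_derivs k (E1 \<times> E2) V g D" and 0: "0 \<in> E2"
  shows "has_derivs k E1 {x. (x, y) \<in> V} (\<lambda>x. g (x, y)) (\<lambda>x vs. D (x, y) (map (\<lambda>v. (v, 0)) vs))"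
proof -
  let ?i = "\<lambda>v. (v, 0)"
  have lists: "map ?i vs \<in> lists (E1 \<times> E2)" if "vs \<in> lists E1" for vs using that 0 by auto
  have nrm: "(\<Prod>v\<leftarrow>map ?i vs. norm v) = (\<Prod>v\<leftarrow>vs. norm v)" for vs
    by (induction vs) (auto simp: norm_Pair)
  have lim: "filterlim (\<lambda>z. (z, y)) (nhds (x, y)) (nhds x)" for x
    by (intro tendsto_Pair tendsto_const filterlim_ident)
  show ?thesis
    unfolding has_derivs_eventually mem_Collect_eq
  proof (intro conjI allI impI ballI)
    show "D (x, y) (map ?i []) = g (x, y)" if "x \<in> {x. (x, y) \<in> V}" for x
      using has_derivs_Nil[OF D] that by simp
    show "bounded_multilinear_on j E1 (\<lambda>vs. D (x, y) (map ?i vs))" if "j \<le> k" "x \<in> {x. (x, y) \<in> V}" for j x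
    proof -
      have ml: "bounded_multilinear_on j (E1 \<times> E2) (D (x, y))" using has_derivs_multilinear[OF D] that by simp
      obtain C where C: "\<And>vs. vs \<in> lists (E1 \<times> E2) \<Longrightarrow> length vs = j \<Longrightarrow>
          norm (D (x, y) vs) \<le> C * (\<Prod>v\<leftarrow>vs. norm v)" using bounded_multilinear_on_bound[OF ml] by blast
      show ?thesis
        unfolding bounded_multilinear_on_def
      proof (intro conjI ballI allI impI exI[of _ C])
        fix us ws u v and a b :: real
        assume *: "us \<in> lists E1" "ws \<in> lists E1" "u \<in> E1" "v \<in> E1" "length us + 1 + length ws = j"
        have lin: "?i (a *\<^sub>R u + b *\<^sub>R v) = a *\<^sub>R ?i u + b *\<^sub>R ?i v" by simp
        show "D (x, y) (map ?i (us @ [a *\<^sub>R u + b *\<^sub>R v] @ ws)) =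
            a *\<^sub>R D (x, y) (map ?i (us @ [u] @ ws)) + b *\<^sub>R D (x, y) (map ?i (us @ [v] @ ws))"
          unfolding map_append list.map lin
          by (rule bounded_multilinear_on_append[OF ml lists[OF *(1)] lists[OF *(2)]]) (use * 0 in auto)
      next
        fix vs assume vs: "vs \<in> lists E1" "length vs = j"
        show "norm (D (x, y) (map ?i vs)) \<le> C * (\<Prod>v\<leftarrow>vs. norm v)"
          using C[OF lists[OF vs(1)], unfolded length_map nrm, OF vs(2)] .
      qed
    qed
    show "\<forall>\<^sub>F z in nhds x. (z, y) \<in> V \<longrightarrow> (\<forall>vs\<in>lists E1. length vs = j \<longrightarrow>
        norm (D (z, y) (map ?i vs) - D (x, y) (map ?i vs) - D (x, y) (map ?i ((z - x) # vs))) \<le>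
          e * norm (z - x) * (\<Prod>v\<leftarrow>vs. norm v))"
      if "j < k" "x \<in> {x. (x, y) \<in> V}" "e > 0" for j x e
    proof -
      have "\<forall>\<^sub>F z in nhds x. (z, y) \<in> V \<longrightarrow> (\<forall>vs\<in>lists (E1 \<times> E2). length vs = j \<longrightarrow>
          norm (D (z, y) vs - D (x, y) vs - D (x, y) (((z, y) - (x, y)) # vs)) \<le>
            e * norm ((z, y) - (x, y)) * (\<Prod>v\<leftarrow>vs. norm v))"
        by (rule eventually_compose_filterlim[OF has_derivs_step[OF D _ that(1,3), of "(x, y)"] lim[of x]]) (use that(2) in simp)
      then show ?thesis
      proof eventually_elim
        case (elim z)
        have zx: "(z, y) - (x, y) = ?i (z - x)" "norm (?i (z - x)) = norm (z - x)"
          by (simp_all add: norm_Pair)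
        note elim' = elim[unfolded zx]
        show ?case
        proof (intro impI ballI)
          fix vs assume z: "(z, y) \<in> V" and vs: "vs \<in> lists E1" "length vs = j"
          from elim'[rule_format, OF z lists[OF vs(1)], unfolded nrm length_map, OF vs(2)]
          show "norm (D (z, y) (map ?i vs) - D (x, y) (map ?i vs) - D (x, y) (map ?i ((z - x) # vs))) \<le>
              e * norm (z - x) * (\<Prod>v\<leftarrow>vs. norm v)" by (simp only: list.map)
        qed
      qed
    qed
    show "\<forall>\<^sub>F z in nhds x. (z, y) \<in> V \<longrightarrow> (\<forall>vs\<in>lists E1. length vs = k \<longrightarrow>
        norm (D (z, y) (map ?i vs) - D (x, y) (map ?i vs)) \<le> e * (\<Prod>v\<leftarrow>vs. norm v))"
      if "x \<in> {x. (x, y) \<in> V}" "e > 0" for x e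
    proof -
      have "\<forall>\<^sub>F z in nhds x. (z, y) \<in> V \<longrightarrow> (\<forall>vs\<in>lists (E1 \<times> E2). length vs = k \<longrightarrow>
          norm (D (z, y) vs - D (x, y) vs) \<le> e * (\<Prod>v\<leftarrow>vs. norm v))"
        by (rule eventually_compose_filterlim[OF has_derivs_top[OF D _ that(2), of "(x, y)"] lim[of x]]) (use that(1) in simp)
      then show ?thesis
      proof eventually_elim
        case (elim z)
        show ?case
        proof (intro impI ballI)
          fix vs assume z: "(z, y) \<in> V" and vs: "vs \<in> lists E1" "length vs = k"
          from elim[rule_format, OF z lists[OF vs(1)], unfolded nrm length_map, OF vs(2)]
          show "norm (D (z, y) (map ?i vs) - D (x, y) (map ?i vs)) \<le> e * (\<Prod>v\<leftarrow>vs. norm v)" .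
        qed
      qed
    qed
  qed
qed

text \<open>Around each of its points the open set contains a box, and boxes have images that are
  products of relatively open sets.\<close>

lemma prod_chart_open_image:
  assumes c: "is_chart T c" and c': "is_chart T' c'"
    and U: "openin (prod_topology T T') U" "U \<subseteq> cdom c \<times> cdom c'"
  shows "openin (top_of_set (cmodel c \<times> cmodel c')) (map_prod (cmap c) (cmap c') ` U)"
proof (subst openin_subopen, intro ballI)
  fix w assume "w \<in> map_prod (cmap c) (cmap c') ` U"
  then obtain a b where ab: "(a, b) \<in> U" "w = (cmap c a, cmap c' b)" by auto
  obtain A B where AB: "openin T A" "openin T' B" "a \<in> A" "b \<in> B" "A \<times> B \<subseteq> U"
    using openin_prod_topology_alt[THEN iffD1, OF U(1), rule_format, OF ab(1)] by metis
  have sub: "A \<subseteq> cdom c" "B \<subseteq> cdom c'" using AB U(2) by blast+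
  have "openin (top_of_set (cmodel c \<times> cmodel c')) (cmap c ` A \<times> cmap c' ` B)"
    by (intro openin_Times is_chart_open_image[OF c] is_chart_open_image[OF c'] AB sub)
  moreover have "w \<in> cmap c ` A \<times> cmap c' ` B" using ab AB by blast
  moreover have "cmap c ` A \<times> cmap c' ` B \<subseteq> map_prod (cmap c) (cmap c') ` U" using AB by force
  ultimately show "\<exists>T. openin (top_of_set (cmodel c \<times> cmodel c')) T \<and> w \<in> T \<and>
      T \<subseteq> map_prod (cmap c) (cmap c') ` U" by blast
qed

section \<open>Functions in the charts of a manifold\<close>

lemma chart_at_props:
  assumes M: "hilbert_manifold M" and y: "y \<in> points M"
  shows "chart_at M y \<in> atlas M" "y \<in> cdom (chart_at M y)" "is_chart (mtop M) (chart_at M y)"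
proof -
  have "\<exists>c. c \<in> atlas M \<and> y \<in> cdom c" using M y unfolding hilbert_manifold_def by blast
  then have "chart_at M y \<in> atlas M \<and> y \<in> cdom (chart_at M y)" unfolding chart_at_def by (rule someI_ex)
  then show "chart_at M y \<in> atlas M" "y \<in> cdom (chart_at M y)" "is_chart (mtop M) (chart_at M y)"
    using M unfolding hilbert_manifold_def by blast+
qed

lemma differential_and_hessian_eq:
  assumes "has_derivs 2 (cmodel c) (cmap c ` cdom c) (f \<circ> cinv c) D"
    and "openin (top_of_set (cmodel c)) (cmap c ` cdom c)" "subspace (cmodel c)"
    and "y \<in> cdom c" and "c = chart_at M y"
  shows "v \<in> cmodel c \<Longrightarrow> fun_differential M f y v = D (cmap c y) [v]"
    and "u \<in> cmodel c \<Longrightarrow> v \<in> cmodel c \<Longrightarrow> hessian M f y u v = D (cmap c y) [u, v]"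
  by (simp_all add: fun_differential_def hessian_def Let_def assms(5)[symmetric] assms(4)
      deriv_at_eq[OF assms(1-3)])

text \<open>Charts of a submanifold come from \<open>max_atlas\<close>, while
  \<open>smooth_fun\<close> looks only at \<open>atlas\<close>. Near each point \<open>f\<close> in
  the chart \<open>c\<close> is \<open>f\<close> in an atlas chart \<open>c'\<close> composed with
  the transition map, and the local results are glued. Order 2 is enough for a Hessian.\<close>

lemma smooth_fun_max_atlas:
  assumes M: "hilbert_manifold M" and f: "smooth_fun M f" and c: "c \<in> max_atlas M"
  shows "Ck_on 2 (cmodel c) (cmap c ` cdom c) (f \<circ> cinv c)"
proof (rule Ck_on_local)
  have ch: "is_chart (mtop M) c" using c by (simp add: max_atlas_def)
  show "subspace (cmodel c)" using is_chart_cdom[OF ch] by blast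
  fix x assume "x \<in> cmap c ` cdom c"
  then obtain p where p: "p \<in> cdom c" "x = cmap c p" by blast
  then have "p \<in> points M" using is_chart_cdom(5)[OF ch] by blast
  then obtain c' where c': "c' \<in> atlas M" "p \<in> cdom c'" "is_chart (mtop M) c'"
    using chart_at_props[OF M] by blast
  let ?U = "cmap c ` (cdom c \<inter> cdom c')"
  have U: "openin (top_of_set (cmodel c)) ?U"
    by (intro is_chart_open_image[OF ch] openin_Int is_chart_cdom(1) ch c'(3)) auto
  have "compatible c c'" using c c'(1) by (simp add: max_atlas_def)
  then obtain P where P: "has_derivs 2 (cmodel c) ?U (cmap c' \<circ> cinv c) P"
    unfolding compatible_def smooth_on_def Ck_on_def by blast
  obtain D where D: "has_derivs 2 (cmodel c') (cmap c' ` cdom c') (f \<circ> cinv c') D"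
    using f c'(1) unfolding smooth_fun_def smooth_on_def Ck_on_def by blast
  have "has_derivs 2 (cmodel c) ?U ((f \<circ> cinv c') \<circ> (cmap c' \<circ> cinv c)) (compose_derivs D (cmap c' \<circ> cinv c) P)"
    by (rule has_derivs_2_compose[OF D P U]) (use is_chart_cdom[OF ch] is_chart_cdom[OF c'(3)] ch in auto)
  then have "has_derivs 2 (cmodel c) ?U (f \<circ> cinv c) (compose_derivs D (cmap c' \<circ> cinv c) P)"
    by (rule has_derivs_cong_fun) (use ch c'(3) in auto)
  then have "Ck_on 2 (cmodel c) ?U (f \<circ> cinv c)" unfolding Ck_on_def by blast
  then show "\<exists>U. x \<in> U \<and> U \<subseteq> cmap c ` cdom c \<and> openin (top_of_set (cmodel c)) U \<and>
      Ck_on 2 (cmodel c) U (f \<circ> cinv c)"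
    using U p c'(2) by (intro exI[of _ ?U]) auto
qed


section \<open>Functions on submanifolds\<close>

lemma openin_Int_subspace:
  assumes "openin (top_of_set E) U" "F \<subseteq> E"
  shows "openin (top_of_set F) (U \<inter> F)"
  using assms by (auto simp: openin_open)

lemma submanifold_chart_at:
  assumes "submanifold M S" "z \<in> S"
  obtains c F where "chart_at (sub_mfd M S) z = \<lparr>cdom = cdom c \<inter> S, cmodel = F, cmap = cmap c\<rparr>"
    "c \<in> max_atlas M" "subspace F" "closed F" "F \<subseteq> cmodel c"
    "cmap c ` (cdom c \<inter> S) = cmap c ` cdom c \<inter> F" "z \<in> cdom c"
proof -
  have "\<exists>c. c \<in> atlas (sub_mfd M S) \<and> z \<in> cdom c" using assms unfolding submanifold_def by blast
  then have "chart_at (sub_mfd M S) z \<in> atlas (sub_mfd M S) \<and> z \<in> cdom (chart_at (sub_mfd M S) z)"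
    unfolding chart_at_def by (rule someI_ex)
  then show ?thesis using that unfolding sub_mfd_def by auto
qed

lemma submanifold_tangent_space:
  assumes "submanifold M S" "z \<in> S"
  shows "subspace (tangent_space (sub_mfd M S) z)" "closed (tangent_space (sub_mfd M S) z)"
  by (rule submanifold_chart_at[OF assms]; simp add: tangent_space_def)+

text \<open>The tangent space of \<open>S\<close> is read in a flattening chart, that of
  \<open>M\<close> in \<open>chart_at\<close>. \<open>L\<close> is the differential of the
  inclusion, computed as the derivative of the transition between the two charts, and
  \<open>L'\<close> is the derivative of the reverse transition. This left inverse makes
  \<open>L\<close> an isomorphism onto its image and the image closed.\<close>

lemma submanifold_differential:
  fixes M :: "('p, 'h::{real_inner, complete_space}) mfd"
  assumes M: "hilbert_manifold M" and f: "smooth_fun M f" and S: "submanifold M S" and z: "z \<in> S"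
  obtains L L' where
    "bounded_linear_on (tangent_space (sub_mfd M S) z) L" "bounded_linear_on (tangent_space M z) L'"
    "sub_tangent_space M S z = L ` tangent_space (sub_mfd M S) z"
    "L ` tangent_space (sub_mfd M S) z \<subseteq> tangent_space M z"
    "\<forall>v\<in>tangent_space (sub_mfd M S) z. L' (L v) = v"
    "\<forall>v\<in>tangent_space (sub_mfd M S) z. fun_differential (sub_mfd M S) f z v = fun_differential M f z (L v)"
    "critical_point M f z \<and> critical_point (sub_mfd M S) f z \<longrightarrow>
      (\<forall>u\<in>tangent_space (sub_mfd M S) z. \<forall>v\<in>tangent_space (sub_mfd M S) z.
        hessian (sub_mfd M S) f z u v = hessian M f z (L u) (L v))"
    "subspace (L ` tangent_space (sub_mfd M S) z)" "closed (L ` tangent_space (sub_mfd M S) z)"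
proof -
  let ?N = "sub_mfd M S"
  obtain c F where c: "chart_at ?N z = \<lparr>cdom = cdom c \<inter> S, cmodel = F, cmap = cmap c\<rparr>"
    "c \<in> max_atlas M" "subspace F" "closed F" "F \<subseteq> cmodel c"
    "cmap c ` (cdom c \<inter> S) = cmap c ` cdom c \<inter> F" "z \<in> cdom c"
    using submanifold_chart_at[OF S z] by metis
  have zM: "z \<in> points M" using S z unfolding submanifold_def by blast
  define c' where "c' = chart_at M z"
  have c': "c' \<in> atlas M" "z \<in> cdom c'" "is_chart (mtop M) c'"
    using chart_at_props[OF M zM] unfolding c'_def by auto
  have ch: "is_chart (mtop M) c" using c(2) by (simp add: max_atlas_def)
  have tan: "tangent_space ?N z = F" "tangent_space M z = cmodel c'"
    using c(1) by (auto simp: tangent_space_def c'_def)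
  \<comment> \<open>The inverse chart of the submanifold is an \<open>inv_into\<close> on the
    smaller domain, separate from \<open>cinv c\<close>; the two agree on chart values of points of
    \<open>S\<close>.\<close>
  define s where "s = inv_into (cdom c \<inter> S) (cmap c)"
  have s: "s (cmap c p) = p" if "p \<in> cdom c" "p \<in> S" for p
    unfolding s_def using that is_chart_inj[OF ch] by (intro inv_into_f_f) (auto elim: inj_on_subset)
  define x where "x = cmap c z"
  have cpt: "compatible c c'" using c(2) c'(1) by (simp add: max_atlas_def)
  let ?U = "cmap c ` (cdom c \<inter> cdom c')" and ?U' = "cmap c' ` (cdom c \<inter> cdom c')"
  have op: "openin (mtop M) (cdom c \<inter> cdom c')" by (intro openin_Int is_chart_cdom(1) ch c'(3))
  have U: "openin (top_of_set (cmodel c)) ?U" "openin (top_of_set (cmodel c')) ?U'"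
    by (rule is_chart_open_image[OF ch op] is_chart_open_image[OF c'(3) op], blast)+
  obtain P where P: "has_derivs 1 (cmodel c) ?U (cmap c' \<circ> cinv c) P"
    using cpt unfolding compatible_def smooth_on_def Ck_on_def by blast
  obtain P' where P': "has_derivs 1 (cmodel c') ?U' (cmap c \<circ> cinv c') P'"
    using cpt unfolding compatible_def smooth_on_def Ck_on_def by blast
  note sub = is_chart_cdom(2,3)[OF ch] is_chart_cdom(2,3)[OF c'(3)]
  have UE: "?U \<subseteq> cmodel c" "?U' \<subseteq> cmodel c'" using U openin_imp_subset by blast+
  have xU: "x \<in> ?U" "cmap c' z \<in> ?U'" using c(7) c'(2) x_def by auto
  define L where "L v = P x [v]" for v
  define L' where "L' v = P' (cmap c' z) [v]" for v
  have \<tau>x: "(cmap c' \<circ> cinv c) x = cmap c' z" using c(7) ch by (simp add: x_def)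
  have LE: "L v \<in> cmodel c'" if "v \<in> cmodel c" for v
    unfolding L_def
    by (rule has_derivs_in_closed_subspace[OF P U(1) sub(1,3,4) _ xU(1)])
      (use that ch is_chart_cdom(6)[OF c'(3)] in auto)
  \<comment> \<open>A line in the chart \<open>c\<close> is pushed to \<open>c'\<close> and back.
    Its velocity is unchanged, and two applications of the curve rule compute it as
    \<open>L' (L v)\<close>.\<close>
  have L'L: "L' (L v) = v" if v: "v \<in> cmodel c" for v
  proof -
    have ev: "\<forall>\<^sub>F t in nhds 0. x + t *\<^sub>R v \<in> ?U" by (rule eventually_line_in_openin[OF U(1) sub(1) xU(1) v])
    let ?g = "\<lambda>t. (cmap c' \<circ> cinv c) (x + t *\<^sub>R v)"
    have 1: "velocity ?g (L v)"
      using has_derivs_velocity_fun[OF P _ velocity_line ev v sub(1) UE(1)] by (simp add: L_def)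
    have "\<forall>\<^sub>F t in nhds 0. ?g t \<in> ?U'" using ev by eventually_elim (use ch in auto)
    from has_derivs_velocity_fun[OF P' _ 1 this LE[OF v] sub(3) UE(2)]
    have "velocity (\<lambda>t. (cmap c \<circ> cinv c') (?g t)) (L' (L v))" using \<tau>x by (simp add: L'_def)
    moreover have "\<forall>\<^sub>F t in nhds 0. (cmap c \<circ> cinv c') (?g t) = x + t *\<^sub>R v"
      using ev by eventually_elim (use ch c'(3) in auto)
    ultimately have "velocity (\<lambda>t. x + t *\<^sub>R v) (L' (L v))" by (rule velocity_cong)
    then show ?thesis using velocity_line by (rule velocity_unique)
  qed
  have PF: "has_derivs 1 F (?U \<inter> F) (cmap c' \<circ> cinv c) P"
    using has_derivs_subset[OF has_derivs_subspace[OF P c(5)]] by blast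
  have UF: "openin (top_of_set F) (?U \<inter> F)" using openin_Int_subspace[OF U(1) c(5)] .
  \<comment> \<open>A point of the chart with coordinates in \<open>F\<close> lies in
    \<open>S\<close>: by flatness some point of \<open>S\<close> has the same coordinates, and the
    chart is injective.\<close>
  have UF_eq: "cmap c ` (cdom c \<inter> S \<inter> cdom c') = ?U \<inter> F"
  proof
    show "cmap c ` (cdom c \<inter> S \<inter> cdom c') \<subseteq> ?U \<inter> F" using c(6) by blast
    show "?U \<inter> F \<subseteq> cmap c ` (cdom c \<inter> S \<inter> cdom c')"
    proof (clarify)
      fix p assume p: "p \<in> cdom c" "p \<in> cdom c'" "cmap c p \<in> F"
      then have "cmap c p \<in> cmap c ` (cdom c \<inter> S)" using c(6) by blast
      then obtain q where "q \<in> cdom c" "q \<in> S" "cmap c p = cmap c q" by blast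
      then have "p \<in> S" using is_chart_inj[OF ch] p(1) by (metis inj_onD)
      then show "cmap c p \<in> cmap c ` (cdom c \<inter> S \<inter> cdom c')" using p by blast
    qed
  qed
  have zF: "x \<in> ?U \<inter> F" unfolding UF_eq[symmetric] x_def using c(7) z c'(2) by blast
  have dif: "differential ?N M (\<lambda>x. x) z v = L v" if v: "v \<in> F" for v
  proof -
    have "has_derivs 1 F (?U \<inter> F) (cmap c' \<circ> (\<lambda>x. x) \<circ> s) P"
      by (rule has_derivs_cong_fun[OF PF]) (use s ch in \<open>auto simp: UF_eq[symmetric]\<close>)
    from deriv_at_eq[OF this UF c(3) zF, of "[v]"] v
    have "deriv_at F (?U \<inter> F) (cmap c' \<circ> (\<lambda>x. x) \<circ> s) x [v] = L v" by (simp add: L_def)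
    moreover have "cdom c \<inter> S \<inter> (\<lambda>x. x) -` cdom c' = cdom c \<inter> S \<inter> cdom c'" by auto
    ultimately show ?thesis
      unfolding differential_def Let_def c(1) c'_def[symmetric] by (simp add: UF_eq s_def x_def)
  qed
  obtain D2 where D2: "has_derivs 2 (cmodel c') (cmap c' ` cdom c') (f \<circ> cinv c') D2"
    using f c'(1) unfolding smooth_fun_def smooth_on_def Ck_on_def by blast
  obtain D where D: "has_derivs 2 (cmodel c) (cmap c ` cdom c) (f \<circ> cinv c) D"
    using smooth_fun_max_atlas[OF M f c(2)] unfolding Ck_on_def by blast
  have "has_derivs 2 F (cmap c ` cdom c \<inter> F) (f \<circ> cinv c) D"
    using has_derivs_subset[OF has_derivs_subspace[OF D c(5)]] by blast
  then have D1: "has_derivs 2 F (cmap c ` (cdom c \<inter> S)) (f \<circ> s) D"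
    unfolding c(6)[symmetric] by (rule has_derivs_cong_fun) (use s ch in auto)
  have VF: "openin (top_of_set F) (cmap c ` (cdom c \<inter> S))"
    unfolding c(6) using openin_Int_subspace[OF is_chart_cdom(4)[OF ch] c(5)] .
  let ?cs = "\<lparr>cdom = cdom c \<inter> S, cmodel = F, cmap = cmap c\<rparr>"
  have cs: "has_derivs 2 (cmodel ?cs) (cmap ?cs ` cdom ?cs) (f \<circ> cinv ?cs) D"
    "openin (top_of_set (cmodel ?cs)) (cmap ?cs ` cdom ?cs)" "subspace (cmodel ?cs)" "z \<in> cdom ?cs"
    using D1 VF c(3,7) z by (simp_all add: s_def)
  have dN: "fun_differential ?N f z v = D x [v]" "hessian ?N f z u v = D x [u, v]"
    if "u \<in> F" "v \<in> F" for u v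
    using differential_and_hessian_eq[OF cs c(1)[symmetric]] that by (simp_all add: x_def)
  have dM: "fun_differential M f z v = D2 (cmap c' z) [v]" "hessian M f z u v = D2 (cmap c' z) [u, v]"
    if "u \<in> cmodel c'" "v \<in> cmodel c'" for u v
    using differential_and_hessian_eq[OF D2 is_chart_cdom(4)[OF c'(3)] sub(3) c'(2) c'_def] that by auto
  have maps: "(cmap c' \<circ> cinv c) ` (?U \<inter> F) \<subseteq> cmap c' ` cdom c'" using ch by auto
  have pmaps: "(\<lambda>x. x) ` F \<subseteq> F" "(\<lambda>x. x) ` (?U \<inter> F) \<subseteq> cmap c ` (cdom c \<inter> S)" using c(6) by auto
  have eq: "(f \<circ> cinv c') ((cmap c' \<circ> cinv c) w) = (f \<circ> s) w" if "w \<in> ?U \<inter> F" for w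
    using that ch c'(3) s unfolding UF_eq[symmetric] by auto
  have VE: "cmap c ` (cdom c \<inter> S) \<subseteq> F" using c(6) by blast
  have first: "D2 (cmap c' z) [L v] = D x [v]" if v: "v \<in> F" for v
    using has_derivs_first_order_identity[OF D2 D1 _ PF UF c(3) sub(3,4) is_chart_cdom(6)[OF c'(3)]
        c(3) VE bounded_linear_ident pmaps maps eq zF v] \<tau>x by (simp add: L_def)
  show ?thesis
  proof (rule that[of L L']; unfold tan)
    show L: "bounded_linear_on F L" and L': "bounded_linear_on (cmodel c') L'"
      using bounded_linear_on_has_derivs[OF PF zF order_refl] bounded_linear_on_has_derivs[OF P' xU(2) order_refl]
      by (simp_all add: L_def[abs_def] L'_def[abs_def])
    show "sub_tangent_space M S z = L ` F"
      unfolding sub_tangent_space_def tan using dif by auto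
    show LF: "L ` F \<subseteq> cmodel c'" using LE c(5) by blast
    show "\<forall>v\<in>F. L' (L v) = v" using L'L c(5) by blast
    show "subspace (L ` F)" by (rule subspace_image_linear_on[OF L c(3)])
    show "closed (L ` F)"
      by (rule closed_image_left_inverse[OF c(4) sub(4) LF bounded_linear_on_continuous[OF L' sub(3)]
            bounded_linear_on_continuous[OF L c(3)]]) (use L'L c(5) in auto)
    show "\<forall>v\<in>F. fun_differential ?N f z v = fun_differential M f z (L v)"
      using first dN(1) dM(1) LE c(5) by (metis subsetD)
    show "critical_point M f z \<and> critical_point ?N f z \<longrightarrow>
      (\<forall>u\<in>F. \<forall>v\<in>F. hessian ?N f z u v = hessian M f z (L u) (L v))"
    proof (intro impI ballI, elim conjE)
      fix u v assume crit: "critical_point M f z" "critical_point ?N f z" and uv: "u \<in> F" "v \<in> F"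
      have c2: "D2 ((cmap c' \<circ> cinv c) x) [w] = 0" if "w \<in> cmodel c'" for w
        using crit(1) dM(1)[OF that that] that \<tau>x unfolding critical_point_def tan by simp
      have c1: "D x [w] = 0" if "w \<in> F" for w
        using crit(2) dN(1)[OF that that] that unfolding critical_point_def tan by simp
      have "D2 ((cmap c' \<circ> cinv c) x) [P x [u], P x [v]] = D x [u, v]"
        by (rule has_derivs_second_order_identity[OF D2 D1 order_refl PF UF c(3) sub(3,4) is_chart_cdom(6)[OF c'(3)]
            c(3) VE bounded_linear_ident pmaps maps eq zF uv c2 c1])
      then show "hessian ?N f z u v = hessian M f z (L u) (L v)"
        using dN(2)[OF uv] dM(2)[OF LE LE, of u v] subsetD[OF c(5) uv(1)] subsetD[OF c(5) uv(2)] \<tau>x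
        by (simp add: L_def)
    qed
  qed
qed


section \<open>Invariant functions\<close>

definition action_domain where
  "action_domain MG Y act g y = map_prod (cmap (chart_at MG g)) (cmap (chart_at Y y)) `
    {(a, b). a \<in> cdom (chart_at MG g) \<and> b \<in> cdom (chart_at Y y) \<and> act a b \<in> cdom (chart_at Y (act g y))}"

definition action_chart where
  "action_chart MG Y act g y x =
    cmap (chart_at Y (act g y)) (act (cinv (chart_at MG g) (fst x)) (cinv (chart_at Y y) (snd x)))"

text \<open>The joint differential of the action at \<open>(g, y)\<close>. On \<open>(w, 0)\<close>
  it is the differential of the orbit map, on \<open>(0, v)\<close> that of
  \<open>b \<mapsto> act g b\<close>.\<close>

definition action_deriv ::
  "('g, 'e::{real_inner, complete_space}) mfd \<Rightarrow> ('y, 'h::{real_inner, complete_space}) mfd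
    \<Rightarrow> ('g \<Rightarrow> 'y \<Rightarrow> 'y) \<Rightarrow> 'g \<Rightarrow> 'y \<Rightarrow> 'e \<times> 'h \<Rightarrow> 'h" where
  "action_deriv MG Y act g y h =
    deriv_at (tangent_space MG g \<times> tangent_space Y y) (action_domain MG Y act g y)
      (action_chart MG Y act g y) (cmap (chart_at MG g) g, cmap (chart_at Y y) y) [h]"

text \<open>Finite dimension of the group enters through the sort of \<open>'e\<close>: every
  tangent space of \<open>MG\<close> is a subspace of a Euclidean space.\<close>

locale invariant_function =
  fixes Y :: "('y, 'h::{real_inner, complete_space}) mfd"
    and G :: "('g, 'b) monoid_scheme"
    and MG :: "('g, 'e::euclidean_space) mfd"
    and act :: "'g \<Rightarrow> 'y \<Rightarrow> 'y"
    and f :: "'y \<Rightarrow> real"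
  assumes Y: "hilbert_manifold Y" and MG: "lie_group G MG" and act: "C1_action G MG Y act"
    and smooth: "smooth_fun Y f" and inv: "G_invariant G Y act f"
begin

lemma MG_manifold: "hilbert_manifold MG" "points MG = carrier G" "group G"
  using MG unfolding lie_group_def by blast+

lemma action: "group_action G (points Y) act"
  using act unfolding C1_action_def by blast

lemma act_closed: "g \<in> carrier G \<Longrightarrow> y \<in> points Y \<Longrightarrow> act g y \<in> points Y"
  using group_action.element_image[OF action] by blast

lemma act_one: "y \<in> points Y \<Longrightarrow> act \<one>\<^bsub>G\<^esub> y = y"
  using group_action.id_eq_one[OF action] by (metis restrict_apply')

lemma act_inv: "g \<in> carrier G \<Longrightarrow> y \<in> points Y \<Longrightarrow> act (inv\<^bsub>G\<^esub> g) (act g y) = y"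
  using group_action.orbit_sym_aux[OF action] by blast

lemmas group_chart = chart_at_props[OF MG_manifold(1), unfolded MG_manifold(2)]
  and point_chart = chart_at_props[OF Y]

lemma tangent_space_props:
  "y \<in> points Y \<Longrightarrow> subspace (tangent_space Y y)" "y \<in> points Y \<Longrightarrow> closed (tangent_space Y y)"
  "g \<in> carrier G \<Longrightarrow> subspace (tangent_space MG g)"
  unfolding tangent_space_def using is_chart_cdom(2,3) point_chart(3) group_chart(3) by blast+

text \<open>\<open>deriv_at\<close> chooses a family separately for each order; here one family
  serves for both the differential and the Hessian.\<close>

lemma fun_derivs:
  assumes y: "y \<in> points Y"
  obtains D where
    "has_derivs 2 (tangent_space Y y) (cmap (chart_at Y y) ` cdom (chart_at Y y)) (f \<circ> cinv (chart_at Y y)) D"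
    "\<And>v. v \<in> tangent_space Y y \<Longrightarrow> fun_differential Y f y v = D (cmap (chart_at Y y) y) [v]"
    "\<And>u v. u \<in> tangent_space Y y \<Longrightarrow> v \<in> tangent_space Y y \<Longrightarrow>
      hessian Y f y u v = D (cmap (chart_at Y y) y) [u, v]"
proof -
  obtain D where D: "has_derivs 2 (cmodel (chart_at Y y)) (cmap (chart_at Y y) ` cdom (chart_at Y y))
      (f \<circ> cinv (chart_at Y y)) D"
    using smooth point_chart(1)[OF y] unfolding smooth_fun_def smooth_on_def Ck_on_def by blast
  show ?thesis
    using that D differential_and_hessian_eq[OF D is_chart_cdom(4,2)[OF point_chart(3)[OF y]] point_chart(2)[OF y] refl]
    unfolding tangent_space_def by blast
qed

lemma fun_differential_linear:
  assumes y: "y \<in> points Y" and "u \<in> tangent_space Y y" "v \<in> tangent_space Y y"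
  shows "fun_differential Y f y (u + v) = fun_differential Y f y u + fun_differential Y f y v"
    and "fun_differential Y f y 0 = 0"
proof -
  obtain D where D:
    "has_derivs 2 (tangent_space Y y) (cmap (chart_at Y y) ` cdom (chart_at Y y)) (f \<circ> cinv (chart_at Y y)) D"
    "\<And>v. v \<in> tangent_space Y y \<Longrightarrow> fun_differential Y f y v = D (cmap (chart_at Y y) y) [v]"
    using fun_derivs[OF y] by metis
  have "bounded_linear_on (tangent_space Y y) (\<lambda>v. D (cmap (chart_at Y y) y) [v])"
    by (rule bounded_linear_on_has_derivs[OF D(1)]) (use point_chart(2)[OF y] in auto)
  note lin = bounded_linear_onD(2,5)[OF this tangent_space_props(1)[OF y] assms(2,3)]
  then show "fun_differential Y f y (u + v) = fun_differential Y f y u + fun_differential Y f y v"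
    "fun_differential Y f y 0 = 0"
    using assms tangent_space_props(1)[OF y] by (simp_all add: D(2) subspace_add subspace_0)
qed

lemma hessian_bilinear:
  assumes y: "y \<in> points Y" and uvw: "u \<in> tangent_space Y y" "v \<in> tangent_space Y y" "w \<in> tangent_space Y y"
  shows "hessian Y f y (u + v) w = hessian Y f y u w + hessian Y f y v w"
    and "hessian Y f y w (u + v) = hessian Y f y w u + hessian Y f y w v"
    and "hessian Y f y 0 w = 0" and "hessian Y f y w 0 = 0"
proof -
  note E = tangent_space_props(1)[OF y]
  obtain D where D:
    "has_derivs 2 (tangent_space Y y) (cmap (chart_at Y y) ` cdom (chart_at Y y)) (f \<circ> cinv (chart_at Y y)) D"
    "\<And>u v. u \<in> tangent_space Y y \<Longrightarrow> v \<in> tangent_space Y y \<Longrightarrow>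
      hessian Y f y u v = D (cmap (chart_at Y y) y) [u, v]"
    using fun_derivs[OF y] by metis
  have ml: "bounded_multilinear_on 2 (tangent_space Y y) (D (cmap (chart_at Y y) y))"
    by (rule has_derivs_multilinear[OF D(1)]) (use point_chart(2)[OF y] in auto)
  note l = bounded_multilinear_on_2_iff[THEN iffD1, OF ml, THEN conjunct1, rule_format, OF uvw]
    and r = bounded_multilinear_on_2_iff[THEN iffD1, OF ml, THEN conjunct2, THEN conjunct1, rule_format, OF uvw]
  show "hessian Y f y (u + v) w = hessian Y f y u w + hessian Y f y v w"
    "hessian Y f y w (u + v) = hessian Y f y w u + hessian Y f y w v"
    "hessian Y f y 0 w = 0" "hessian Y f y w 0 = 0"
    using l[of 1 1] r[of 1 1] l[of 0 0] r[of 0 0] uvw E by (simp_all add: D(2) subspace_add subspace_0)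
qed

context
  fixes g y assumes g: "g \<in> carrier G" and y: "y \<in> points Y"
begin

abbreviation (input) "z \<equiv> act g y"
abbreviation (input) "cg \<equiv> chart_at MG g"
abbreviation (input) "cy \<equiv> chart_at Y y"
abbreviation (input) "cz \<equiv> chart_at Y z"
abbreviation (input) "x0 \<equiv> (cmap cg g, cmap cy y)"
abbreviation (input) "E \<equiv> tangent_space MG g \<times> tangent_space Y y"
abbreviation (input) "T \<equiv> action_deriv MG Y act g y"

lemma charts:
  "is_chart (mtop MG) cg" "is_chart (mtop Y) cy" "is_chart (mtop Y) cz"
  "g \<in> cdom cg" "y \<in> cdom cy" "z \<in> cdom cz"
  using group_chart[OF g] point_chart[OF y] point_chart[OF act_closed[OF g y]] by blast+

lemma mem_action_domain:
  assumes "a \<in> cdom cg" "b \<in> cdom cy"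
  shows "(cmap cg a, cmap cy b) \<in> action_domain MG Y act g y \<longleftrightarrow> act a b \<in> cdom cz"
proof
  assume "(cmap cg a, cmap cy b) \<in> action_domain MG Y act g y"
  then obtain a' b' where ab': "a' \<in> cdom cg" "b' \<in> cdom cy" "act a' b' \<in> cdom cz"
    "cmap cg a = cmap cg a'" "cmap cy b = cmap cy b'"
    unfolding action_domain_def by auto
  then have "a = a'" "b = b'"
    using is_chart_inj[OF charts(1)] is_chart_inj[OF charts(2)] assms by (auto dest: inj_onD)
  then show "act a b \<in> cdom cz" using ab' by simp
qed (use assms in \<open>auto simp: action_domain_def\<close>)

lemma action_domainE:
  assumes "x \<in> action_domain MG Y act g y"
  obtains a b where "a \<in> cdom cg" "b \<in> cdom cy" "act a b \<in> cdom cz" "x = (cmap cg a, cmap cy b)"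
    "a \<in> carrier G" "b \<in> points Y" "action_chart MG Y act g y x = cmap cz (act a b)"
proof -
  obtain a b where ab: "a \<in> cdom cg" "b \<in> cdom cy" "act a b \<in> cdom cz" "x = (cmap cg a, cmap cy b)"
    using assms unfolding action_domain_def by auto
  moreover have "a \<in> carrier G" "b \<in> points Y"
    using ab is_chart_cdom(5)[OF charts(1)] is_chart_cdom(5)[OF charts(2)] MG_manifold(2) by auto
  moreover have "action_chart MG Y act g y x = cmap cz (act a b)"
    using ab charts(1,2) by (simp add: action_chart_def)
  ultimately show ?thesis using that by blast
qed

lemma action_domain_center: "x0 \<in> action_domain MG Y act g y"
  using mem_action_domain charts by blast

lemma openin_action_domain: "openin (top_of_set E) (action_domain MG Y act g y)"
proof -
  have cont: "continuous_map (prod_topology (mtop MG) (mtop Y)) (mtop Y) (\<lambda>(g, y). act g y)"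
    using act unfolding C1_action_def Ck_map_def prod_mfd_def by simp
  have "openin (prod_topology (mtop MG) (mtop Y)) (cdom cg \<times> cdom cy)"
    by (simp add: openin_prod_Times_iff is_chart_cdom(1) charts)
  then have "openin (prod_topology (mtop MG) (mtop Y)) ((cdom cg \<times> cdom cy) \<inter>
      {x \<in> topspace (prod_topology (mtop MG) (mtop Y)). (\<lambda>(g, y). act g y) x \<in> cdom cz})"
    by (intro openin_Int openin_continuous_map_preimage[OF cont] is_chart_cdom(1)[OF charts(3)])
  moreover have "(cdom cg \<times> cdom cy) \<inter>
      {x \<in> topspace (prod_topology (mtop MG) (mtop Y)). (\<lambda>(g, y). act g y) x \<in> cdom cz} =
      {(a, b). a \<in> cdom cg \<and> b \<in> cdom cy \<and> act a b \<in> cdom cz}"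
    using is_chart_cdom(5)[OF charts(1)] is_chart_cdom(5)[OF charts(2)] by auto
  ultimately show ?thesis
    unfolding action_domain_def tangent_space_def
    by (intro prod_chart_open_image[OF charts(1,2)]) auto
qed

lemma action_chart_derivs:
  obtains P where "has_derivs 1 E (action_domain MG Y act g y) (action_chart MG Y act g y) P"
    "\<And>h. h \<in> E \<Longrightarrow> T h = P x0 [h]"
proof -
  let ?c = "\<lparr>cdom = cdom cg \<times> cdom cy, cmodel = cmodel cg \<times> cmodel cy, cmap = map_prod (cmap cg) (cmap cy)\<rparr>"
  have "?c \<in> atlas (prod_mfd MG Y)"
    unfolding prod_mfd_def using group_chart(1)[OF g] point_chart(1)[OF y] by auto
  moreover have "cz \<in> atlas Y" using point_chart(1)[OF act_closed[OF g y]] .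
  ultimately have "Ck_on 1 (cmodel ?c) (cmap ?c ` (cdom ?c \<inter> (\<lambda>(g, y). act g y) -` cdom cz))
      (cmap cz \<circ> (\<lambda>(g, y). act g y) \<circ> cinv ?c)"
    using act unfolding C1_action_def Ck_map_def by blast
  then obtain P where P: "has_derivs 1 E (map_prod (cmap cg) (cmap cy) `
        (cdom cg \<times> cdom cy \<inter> (\<lambda>(g, y). act g y) -` cdom cz))
      (cmap cz \<circ> (\<lambda>(g, y). act g y) \<circ> inv_into (cdom cg \<times> cdom cy) (map_prod (cmap cg) (cmap cy))) P"
    unfolding Ck_on_def tangent_space_def by auto
  have dom: "map_prod (cmap cg) (cmap cy) ` (cdom cg \<times> cdom cy \<inter> (\<lambda>(g, y). act g y) -` cdom cz) =
      action_domain MG Y act g y"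
    unfolding action_domain_def by (rule arg_cong[where f = "image _"]) auto
  have "inj_on (map_prod (cmap cg) (cmap cy)) (cdom cg \<times> cdom cy)"
    using is_chart_inj[OF charts(1)] is_chart_inj[OF charts(2)] by (rule map_prod_inj_on)
  then have inv: "inv_into (cdom cg \<times> cdom cy) (map_prod (cmap cg) (cmap cy)) (cmap cg a, cmap cy b) = (a, b)"
    if "a \<in> cdom cg" "b \<in> cdom cy" for a b
    using inv_into_f_f[of "map_prod (cmap cg) (cmap cy)" "cdom cg \<times> cdom cy" "(a, b)"] that by simp
  have P': "has_derivs 1 E (action_domain MG Y act g y) (action_chart MG Y act g y) P"
  proof (rule has_derivs_cong_fun[OF P[unfolded dom]])
    fix x assume "x \<in> action_domain MG Y act g y"
    then show "(cmap cz \<circ> (\<lambda>(g, y). act g y) \<circ>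
        inv_into (cdom cg \<times> cdom cy) (map_prod (cmap cg) (cmap cy))) x = action_chart MG Y act g y x"
      by (elim action_domainE) (simp add: inv)
  qed
  moreover have "T h = P x0 [h]" if "h \<in> E" for h
    unfolding action_deriv_def
    by (rule deriv_at_eq[OF P' openin_action_domain _ action_domain_center])
      (use that g y tangent_space_props in \<open>auto intro: subspace_Times\<close>)
  ultimately show ?thesis using that by blast
qed

lemma action_chart_maps: "action_chart MG Y act g y ` action_domain MG Y act g y \<subseteq> cmap cz ` cdom cz"
  by (auto elim!: action_domainE)

lemma action_chart_center: "action_chart MG Y act g y x0 = cmap cz z"
  using charts by (simp add: action_chart_def)

lemma action_deriv_linear: "bounded_linear_on E T" "h \<in> E \<Longrightarrow> T h \<in> tangent_space Y z"
proof -
  obtain P where P: "has_derivs 1 E (action_domain MG Y act g y) (action_chart MG Y act g y) P"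
    "\<And>h. h \<in> E \<Longrightarrow> T h = P x0 [h]" using action_chart_derivs by metis
  have E: "subspace E" using g y tangent_space_props by (intro subspace_Times) auto
  have "bounded_linear_on E (\<lambda>h. P x0 [h])"
    by (rule bounded_linear_on_has_derivs[OF P(1) action_domain_center order_refl])
  then show "bounded_linear_on E T"
    using P(2) E unfolding bounded_linear_on_def by (auto simp: subspace_add subspace_scale)
  have "P x0 [h] \<in> tangent_space Y z" if "h \<in> E"
  proof (rule has_derivs_in_closed_subspace[OF P(1) openin_action_domain E _ _ _ action_domain_center])
    show "action_chart MG Y act g y ` action_domain MG Y act g y \<subseteq> tangent_space Y z"
      using action_chart_maps is_chart_cdom(6)[OF charts(3)] unfolding tangent_space_def by blast
  qed (use that tangent_space_props act_closed[OF g y] in auto)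
  then show "h \<in> E \<Longrightarrow> T h \<in> tangent_space Y z" using P(2) by simp
qed

text \<open>In the charts at \<open>g\<close>, \<open>y\<close> and \<open>act g y\<close>,
  invariance reads \<open>f2 (\<Phi> x) = f1 (snd x)\<close>. The right side ignores the group
  coordinate, so \<open>v\<close> and \<open>v'\<close> drop out.\<close>

lemma
  assumes "v \<in> tangent_space MG g" "u \<in> tangent_space Y y"
  shows fun_differential_action: "fun_differential Y f z (T (v, u)) = fun_differential Y f y u"
    and hessian_action: "\<lbrakk>critical_point Y f y; critical_point Y f z;
      v' \<in> tangent_space MG g; u' \<in> tangent_space Y y\<rbrakk> \<Longrightarrow>
      hessian Y f z (T (v, u)) (T (v', u')) = hessian Y f y u u'"
proof -
  obtain P where P: "has_derivs 1 E (action_domain MG Y act g y) (action_chart MG Y act g y) P"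
    "\<And>h. h \<in> E \<Longrightarrow> T h = P x0 [h]" using action_chart_derivs by metis
  obtain D where D: "has_derivs 2 (tangent_space Y y) (cmap cy ` cdom cy) (f \<circ> cinv cy) D"
    "\<And>v. v \<in> tangent_space Y y \<Longrightarrow> fun_differential Y f y v = D (cmap cy y) [v]"
    "\<And>u v. u \<in> tangent_space Y y \<Longrightarrow> v \<in> tangent_space Y y \<Longrightarrow> hessian Y f y u v = D (cmap cy y) [u, v]"
    using fun_derivs[OF y] by metis
  note z = act_closed[OF g y]
  obtain D2 where D2: "has_derivs 2 (tangent_space Y z) (cmap cz ` cdom cz) (f \<circ> cinv cz) D2"
    "\<And>v. v \<in> tangent_space Y z \<Longrightarrow> fun_differential Y f z v = D2 (cmap cz z) [v]"
    "\<And>u v. u \<in> tangent_space Y z \<Longrightarrow> v \<in> tangent_space Y z \<Longrightarrow> hessian Y f z u v = D2 (cmap cz z) [u, v]"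
    using fun_derivs[OF z] by metis
  note Ez = tangent_space_props(1,2)[OF z] is_chart_cdom(6)[OF charts(3), folded tangent_space_def]
  note Ey = tangent_space_props(1)[OF y] is_chart_cdom(6)[OF charts(2), folded tangent_space_def]
  have E: "subspace E" using g y tangent_space_props by (intro subspace_Times) auto
  have snd: "snd ` E \<subseteq> tangent_space Y y" "snd ` action_domain MG Y act g y \<subseteq> cmap cy ` cdom cy"
    by (auto elim!: action_domainE)
  have eq: "(f \<circ> cinv cz) (action_chart MG Y act g y x) = (f \<circ> cinv cy) (snd x)"
    if "x \<in> action_domain MG Y act g y" for x
    using that inv charts(2,3) unfolding G_invariant_def by (auto elim!: action_domainE)
  have vu: "(v, u) \<in> E" using assms by simp
  show "fun_differential Y f z (T (v, u)) = fun_differential Y f y u"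
    using has_derivs_first_order_identity[OF D2(1) D(1) _ P(1) openin_action_domain E Ez Ey
        bounded_linear_snd snd action_chart_maps eq action_domain_center vu]
      P(2)[OF vu] D(2)[OF assms(2)] D2(2)[OF action_deriv_linear(2)[OF vu]] action_chart_center by simp
  assume crit: "critical_point Y f y" "critical_point Y f z"
    and v'u': "v' \<in> tangent_space MG g" "u' \<in> tangent_space Y y"
  then have vu': "(v', u') \<in> E" by simp
  have c2: "D2 (action_chart MG Y act g y x0) [w] = 0" if "w \<in> tangent_space Y z" for w
    using crit(2) that D2(2)[OF that] unfolding critical_point_def action_chart_center by simp
  have c1: "D (snd x0) [w] = 0" if "w \<in> tangent_space Y y" for w
    using crit(1) that D(2)[OF that] unfolding critical_point_def by simp
  show "hessian Y f z (T (v, u)) (T (v', u')) = hessian Y f y u u'"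
    using has_derivs_second_order_identity[OF D2(1) D(1) order_refl P(1) openin_action_domain E Ez Ey
        bounded_linear_snd snd action_chart_maps eq action_domain_center vu vu' c2 c1]
      P(2)[OF vu] P(2)[OF vu'] D(3)[OF assms(2) v'u'(2)]
      D2(3)[OF action_deriv_linear(2)[OF vu] action_deriv_linear(2)[OF vu']] action_chart_center by simp
qed

text \<open>Stated for curves in \<open>Y\<close> rather than in a chart, and with the domain
  condition as a second conclusion, so that it can be applied twice in a row, to \<open>g\<close>
  and then to its inverse.\<close>

lemma action_velocity:
  assumes b: "b 0 = y" "\<forall>\<^sub>F t in nhds 0. b t \<in> cdom cy" "velocity (\<lambda>t. cmap cy (b t)) v"
    and v: "v \<in> tangent_space Y y"
  shows "velocity (\<lambda>t. cmap cz (act g (b t))) (T (0, v))"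
    and "\<forall>\<^sub>F t in nhds 0. act g (b t) \<in> cdom cz"
proof -
  obtain P where P: "has_derivs 1 E (action_domain MG Y act g y) (action_chart MG Y act g y) P"
    "\<And>h. h \<in> E \<Longrightarrow> T h = P x0 [h]" using action_chart_derivs by metis
  have E: "subspace E" using g y tangent_space_props by (intro subspace_Times) auto
  let ?x = "\<lambda>t. (cmap cg g, cmap cy (b t))"
  have x: "velocity ?x (0, v)" using velocity_Pair[OF velocity_const b(3)] .
  have h: "(0, v) \<in> E" using v g tangent_space_props(3) by (simp add: subspace_0)
  obtain U where U: "open U" "action_domain MG Y act g y = E \<inter> U"
    using openin_action_domain by (auto simp: openin_open)
  have "?x 0 \<in> U" using action_domain_center U(2) b(1) by auto
  then have "\<forall>\<^sub>F t in nhds 0. ?x t \<in> U"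
    using topological_tendstoD[OF velocity_tendsto_nhds[OF x] U(1)] by simp
  with b(2) have dom: "\<forall>\<^sub>F t in nhds 0. b t \<in> cdom cy \<and> ?x t \<in> action_domain MG Y act g y"
  proof eventually_elim
    case (elim t)
    then have "?x t \<in> E"
      using charts is_chart_cdom(6)[OF charts(1)] is_chart_cdom(6)[OF charts(2)] unfolding tangent_space_def by auto
    with elim U(2) show ?case by blast
  qed
  then show "\<forall>\<^sub>F t in nhds 0. act g (b t) \<in> cdom cz"
    by eventually_elim (use mem_action_domain charts(4) in blast)
  have "\<forall>\<^sub>F t in nhds 0. ?x t \<in> action_domain MG Y act g y" using dom by eventually_elim blast
  from has_derivs_velocity_fun[OF P(1) _ x this h E]
  have "velocity (\<lambda>t. action_chart MG Y act g y (?x t)) (T (0, v))"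
    using P(2)[OF h] b(1) openin_imp_subset[OF openin_action_domain] by simp
  moreover have "\<forall>\<^sub>F t in nhds 0. action_chart MG Y act g y (?x t) = cmap cz (act g (b t))"
    using dom by eventually_elim (use charts in \<open>auto simp: action_chart_def\<close>)
  ultimately show "velocity (\<lambda>t. cmap cz (act g (b t))) (T (0, v))" by (rule velocity_cong)
qed

lemma chart_line:
  assumes v: "v \<in> tangent_space Y y"
  defines "b \<equiv> \<lambda>t. cinv cy (cmap cy y + t *\<^sub>R v)"
  shows "b 0 = y" "\<forall>\<^sub>F t in nhds 0. b t \<in> cdom cy \<and> cmap cy (b t) = cmap cy y + t *\<^sub>R v"
    "velocity (\<lambda>t. cmap cy (b t)) v"
proof -
  show "b 0 = y" using charts by (simp add: b_def)
  have "\<forall>\<^sub>F t in nhds 0. cmap cy y + t *\<^sub>R v \<in> cmap cy ` cdom cy"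
    by (rule eventually_line_in_openin[OF is_chart_cdom(4,2)[OF charts(2)]])
      (use v charts in \<open>auto simp: tangent_space_def\<close>)
  then show ev: "\<forall>\<^sub>F t in nhds 0. b t \<in> cdom cy \<and> cmap cy (b t) = cmap cy y + t *\<^sub>R v"
    by eventually_elim (auto simp: b_def cinv_cmap[OF charts(2)])
  have "\<forall>\<^sub>F t in nhds 0. cmap cy y + t *\<^sub>R v = cmap cy (b t)"
    using ev by eventually_elim simp
  then show "velocity (\<lambda>t. cmap cy (b t)) v" by (rule velocity_cong[OF velocity_line])
qed

text \<open>The joint derivative is restricted to the slice of fixed second coordinate; injectivity
  of the chart at \<open>y\<close> identifies that slice of \<open>action_domain\<close> with the
  chart domain of the orbit map.\<close>

lemma differential_orbit_map:
  assumes w: "w \<in> tangent_space MG g"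
  shows "differential MG Y (\<lambda>a. act a y) g w = T (w, 0)"
proof -
  obtain P where P: "has_derivs 1 E (action_domain MG Y act g y) (action_chart MG Y act g y) P"
    "\<And>h. h \<in> E \<Longrightarrow> T h = P x0 [h]" using action_chart_derivs by metis
  note E = tangent_space_props(1)[OF y] tangent_space_props(3)[OF g]
  have yE: "cmap cy y \<in> tangent_space Y y"
    using charts is_chart_cdom(6)[OF charts(2)] unfolding tangent_space_def by auto
  let ?V = "{x. (x, cmap cy y) \<in> action_domain MG Y act g y}"
  have V: "cmap cg ` (cdom cg \<inter> (\<lambda>a. act a y) -` cdom cz) = ?V"
  proof
    show "cmap cg ` (cdom cg \<inter> (\<lambda>a. act a y) -` cdom cz) \<subseteq> ?V"
      using mem_action_domain charts(5) by auto
    show "?V \<subseteq> cmap cg ` (cdom cg \<inter> (\<lambda>a. act a y) -` cdom cz)"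
    proof (clarify, elim action_domainE)
      fix x a b assume "a \<in> cdom cg" "b \<in> cdom cy" "act a b \<in> cdom cz" "(x, cmap cy y) = (cmap cg a, cmap cy b)"
      moreover from this have "b = y" using is_chart_inj[OF charts(2)] charts(5) by (auto dest: inj_onD)
      ultimately show "x \<in> cmap cg ` (cdom cg \<inter> (\<lambda>a. act a y) -` cdom cz)" by auto
    qed
  qed
  have "has_derivs 1 (tangent_space MG g) ?V (\<lambda>x. action_chart MG Y act g y (x, cmap cy y))
      (\<lambda>x vs. P (x, cmap cy y) (map (\<lambda>v. (v, 0)) vs))"
    by (rule has_derivs_slice[OF P(1) subspace_0[OF E(1)]])
  then have "has_derivs 1 (tangent_space MG g) ?V (cmap cz \<circ> (\<lambda>a. act a y) \<circ> cinv cg)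
      (\<lambda>x vs. P (x, cmap cy y) (map (\<lambda>v. (v, 0)) vs))"
    by (rule has_derivs_cong_fun) (use charts in \<open>auto simp: action_chart_def\<close>)
  from deriv_at_eq[OF this openin_slice[OF openin_action_domain yE] E(2), of "cmap cg g" "[w]"]
  have "deriv_at (tangent_space MG g) ?V (cmap cz \<circ> (\<lambda>a. act a y) \<circ> cinv cg) (cmap cg g) [w] = P x0 [(w, 0)]"
    using w action_domain_center by simp
  then show ?thesis
    using P(2)[of "(w, 0)"] w subspace_0[OF E(1)]
    unfolding differential_def Let_def V tangent_space_def by simp
qed

end

text \<open>A curve with velocity \<open>v\<close> is moved by \<open>g\<close> and back by its
  inverse, which returns the curve itself; velocities are unique.\<close>

lemma action_deriv_inverse:
  assumes g: "g \<in> carrier G" and y: "y \<in> points Y" and v: "v \<in> tangent_space Y y"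
  shows "action_deriv MG Y act (inv\<^bsub>G\<^esub> g) (act g y) (0, action_deriv MG Y act g y (0, v)) = v"
proof -
  have g': "inv\<^bsub>G\<^esub> g \<in> carrier G" using g MG_manifold(3) by (rule group.inv_closed[rotated])
  note z = act_closed[OF g y]
  let ?c = "chart_at Y y"
  let ?b = "\<lambda>t. cinv ?c (cmap ?c y + t *\<^sub>R v)"
  note b = chart_line[OF g y v]
  have b': "\<forall>\<^sub>F t in nhds 0. ?b t \<in> cdom ?c" using b(2) by eventually_elim simp
  note 1 = action_velocity[OF g y b(1) b' b(3) v]
  have 0: "(0, v) \<in> tangent_space MG g \<times> tangent_space Y y"
    using v tangent_space_props(3)[OF g] by (simp add: subspace_0)
  have "velocity (\<lambda>t. cmap (chart_at Y (act (inv\<^bsub>G\<^esub> g) (act g y))) (act (inv\<^bsub>G\<^esub> g) (act g (?b t))))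
      (action_deriv MG Y act (inv\<^bsub>G\<^esub> g) (act g y) (0, action_deriv MG Y act g y (0, v)))"
    by (rule action_velocity(1)[OF g' z _ 1(2,1) action_deriv_linear(2)[OF g y 0]]) (use b(1) in simp)
  then have "velocity (\<lambda>t. cmap ?c (act (inv\<^bsub>G\<^esub> g) (act g (?b t))))
      (action_deriv MG Y act (inv\<^bsub>G\<^esub> g) (act g y) (0, action_deriv MG Y act g y (0, v)))"
    by (simp add: act_inv[OF g y])
  moreover have "\<forall>\<^sub>F t in nhds 0. cmap ?c (act (inv\<^bsub>G\<^esub> g) (act g (?b t))) = cmap ?c (?b t)"
    using b(2)
  proof eventually_elim
    case (elim t)
    then have "?b t \<in> points Y" using is_chart_cdom(5)[OF point_chart(3)[OF y]] by blast
    then show ?case by (simp add: act_inv[OF g])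
  qed
  ultimately have "velocity (\<lambda>t. cmap ?c (?b t))
      (action_deriv MG Y act (inv\<^bsub>G\<^esub> g) (act g y) (0, action_deriv MG Y act g y (0, v)))"
    by (rule velocity_cong)
  then show ?thesis using b(3) by (rule velocity_unique)
qed

text \<open>Every tangent vector \<open>v\<close> is thus the image of \<open>(0, v)\<close> under
  the very map that produces orbit directions from \<open>(w, 0)\<close>; this lets the two kinds be
  paired in the Hessian.\<close>

lemma action_deriv_one:
  assumes y: "y \<in> points Y" and v: "v \<in> tangent_space Y y"
  shows "action_deriv MG Y act \<one>\<^bsub>G\<^esub> y (0, v) = v"
proof -
  have g: "\<one>\<^bsub>G\<^esub> \<in> carrier G" using MG_manifold(3) by (simp add: group.is_monoid monoid.one_closed)
  let ?c = "chart_at Y y"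
  let ?b = "\<lambda>t. cinv ?c (cmap ?c y + t *\<^sub>R v)"
  note b = chart_line[OF g y v]
  have b': "\<forall>\<^sub>F t in nhds 0. ?b t \<in> cdom ?c" using b(2) by eventually_elim simp
  have "velocity (\<lambda>t. cmap ?c (act \<one>\<^bsub>G\<^esub> (?b t))) (action_deriv MG Y act \<one>\<^bsub>G\<^esub> y (0, v))"
    using action_velocity(1)[OF g y b(1) b' b(3) v] by (simp add: act_one[OF y])
  moreover have "\<forall>\<^sub>F t in nhds 0. cmap ?c (act \<one>\<^bsub>G\<^esub> (?b t)) = cmap ?c (?b t)"
    using b(2)
  proof eventually_elim
    case (elim t)
    then have "?b t \<in> points Y" using is_chart_cdom(5)[OF point_chart(3)[OF y]] by blast
    then show ?case by (simp add: act_one)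
  qed
  ultimately have "velocity (\<lambda>t. cmap ?c (?b t)) (action_deriv MG Y act \<one>\<^bsub>G\<^esub> y (0, v))"
    by (rule velocity_cong)
  then show ?thesis using b(3) by (rule velocity_unique)
qed

section \<open>Orbit directions and critical orbits\<close>

lemma orbit_tangent_eq:
  assumes y: "y \<in> points Y"
  shows "orbit_tangent G MG Y act y =
    (\<lambda>w. action_deriv MG Y act \<one>\<^bsub>G\<^esub> y (w, 0)) ` tangent_space MG \<one>\<^bsub>G\<^esub>"
proof -
  have "\<one>\<^bsub>G\<^esub> \<in> carrier G" using MG_manifold(3) by (simp add: group.is_monoid monoid.one_closed)
  then show ?thesis unfolding orbit_tangent_def using differential_orbit_map y by (intro image_cong) auto
qed

text \<open>At the unit of the group, \<open>d\<close> is the image of \<open>(w, 0)\<close> and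
  \<open>u\<close> that of \<open>(0, u)\<close>; \<open>hessian_action\<close> then replaces
  \<open>d\<close> by its second component 0. Both slots are shown, since symmetry of the Hessian is
  not established.\<close>

lemma
  assumes y: "y \<in> points Y" and d: "d \<in> orbit_tangent G MG Y act y"
  shows orbit_tangent_subset: "d \<in> tangent_space Y y"
    and fun_differential_orbit: "fun_differential Y f y d = 0"
    and hessian_orbit: "\<lbrakk>critical_point Y f y; u \<in> tangent_space Y y\<rbrakk> \<Longrightarrow>
      hessian Y f y d u = 0 \<and> hessian Y f y u d = 0"
proof -
  have g: "\<one>\<^bsub>G\<^esub> \<in> carrier G" using MG_manifold(3) by (simp add: group.is_monoid monoid.one_closed)
  obtain w where w: "w \<in> tangent_space MG \<one>\<^bsub>G\<^esub>" "d = action_deriv MG Y act \<one>\<^bsub>G\<^esub> y (w, 0)"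
    using d orbit_tangent_eq[OF y] by blast
  note zero = subspace_0[OF tangent_space_props(1)[OF y]] and zero' = subspace_0[OF tangent_space_props(3)[OF g]]
  show "d \<in> tangent_space Y y"
    using action_deriv_linear(2)[OF g y, of "(w, 0)"] w zero by (simp add: act_one[OF y])
  show "fun_differential Y f y d = 0"
    using fun_differential_action[OF g y w(1) zero] fun_differential_linear(2)[OF y zero zero] w(2)
    by (simp add: act_one[OF y])
  assume crit: "critical_point Y f y" and u: "u \<in> tangent_space Y y"
  have "hessian Y f y d u = hessian Y f y 0 u"
    using hessian_action[OF g y w(1) zero, of 0 u] crit zero' u w(2) action_deriv_one[OF y u] by (simp add: act_one[OF y])
  moreover have "hessian Y f y u d = hessian Y f y u 0"
    using hessian_action[OF g y zero' u, of w 0] crit zero w action_deriv_one[OF y u] by (simp add: act_one[OF y])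
  ultimately show "hessian Y f y d u = 0 \<and> hessian Y f y u d = 0"
    using hessian_bilinear(3,4)[OF y zero zero u] by simp
qed

text \<open>A linear image of a subspace of a Euclidean space is spanned by the images of a basis.
  Finiteness makes projections along orbit directions continuous and comparisons of
  \<open>dim\<close> conclusive.\<close>

lemma orbit_tangent_finite_dim:
  assumes y: "y \<in> points Y"
  obtains B where "finite B" "orbit_tangent G MG Y act y = span B"
proof -
  have g: "\<one>\<^bsub>G\<^esub> \<in> carrier G" using MG_manifold(3) by (simp add: group.is_monoid monoid.one_closed)
  obtain B where B: "B \<subseteq> tangent_space MG \<one>\<^bsub>G\<^esub>" "independent B" "tangent_space MG \<one>\<^bsub>G\<^esub> \<subseteq> span B"
    using basis_exists by metis
  have span: "tangent_space MG \<one>\<^bsub>G\<^esub> = span B"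
    using B tangent_space_props(3)[OF g] by (metis span_minimal subset_antisym)
  let ?i = "\<lambda>w. (w, 0)"
  have "bounded_linear_on (tangent_space MG \<one>\<^bsub>G\<^esub>) (action_deriv MG Y act \<one>\<^bsub>G\<^esub> y \<circ> ?i)"
    by (rule bounded_linear_on_compose[OF _ action_deriv_linear(1)[OF g y]])
      (auto simp: bounded_linear_on_def norm_Pair subspace_0 tangent_space_props(1)[OF y] intro: exI[of _ 1])
  from linear_on_span_image[OF this span]
  have "orbit_tangent G MG Y act y = span ((action_deriv MG Y act \<one>\<^bsub>G\<^esub> y \<circ> ?i) ` B)"
    by (simp add: orbit_tangent_eq[OF y] comp_def)
  then show ?thesis using that independent_imp_finite[OF B(2)] by blast
qed

lemma action_deriv_Pair_zero:
  assumes g: "g \<in> carrier G" and y: "y \<in> points Y"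
  shows "bounded_linear_on (tangent_space Y y) (\<lambda>v. action_deriv MG Y act g y (0, v))"
    and "(\<lambda>v. action_deriv MG Y act g y (0, v)) ` tangent_space Y y \<subseteq> tangent_space Y (act g y)"
proof -
  have 0: "0 \<in> tangent_space MG g" using subspace_0[OF tangent_space_props(3)[OF g]] .
  have "bounded_linear_on (tangent_space Y y) (action_deriv MG Y act g y \<circ> Pair 0)"
    by (rule bounded_linear_on_compose[OF _ action_deriv_linear(1)[OF g y]])
      (use 0 in \<open>auto simp: bounded_linear_on_def norm_Pair intro: exI[of _ 1]\<close>)
  then show "bounded_linear_on (tangent_space Y y) (\<lambda>v. action_deriv MG Y act g y (0, v))"
    by (simp add: comp_def)
  show "(\<lambda>v. action_deriv MG Y act g y (0, v)) ` tangent_space Y y \<subseteq> tangent_space Y (act g y)"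
    using action_deriv_linear(2)[OF g y] 0 by auto
qed

text \<open>Every tangent vector at \<open>act g y\<close> is the image of its own pull-back by the
  inverse of \<open>g\<close>, so \<open>fun_differential_action\<close> reaches all of
  them.\<close>

lemma critical_point_action:
  assumes g: "g \<in> carrier G" and crit: "critical_point Y f y"
  shows "critical_point Y f (act g y)"
proof -
  have y: "y \<in> points Y" using crit unfolding critical_point_def by blast
  note z = act_closed[OF g y]
  have g': "inv\<^bsub>G\<^esub> g \<in> carrier G" using g MG_manifold(3) by (rule group.inv_closed[rotated])
  have inv_inv: "inv\<^bsub>G\<^esub> (inv\<^bsub>G\<^esub> g) = g" using g MG_manifold(3) by (rule group.inv_inv[rotated])
  have 0: "0 \<in> tangent_space MG g" using subspace_0[OF tangent_space_props(3)[OF g]] .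
  have "fun_differential Y f (act g y) v = 0" if v: "v \<in> tangent_space Y (act g y)" for v
  proof -
    define u where "u = action_deriv MG Y act (inv\<^bsub>G\<^esub> g) (act g y) (0, v)"
    have u: "u \<in> tangent_space Y y"
      using action_deriv_Pair_zero(2)[OF g' z] v by (auto simp: u_def act_inv[OF g y])
    have "v = action_deriv MG Y act g y (0, u)"
      using action_deriv_inverse[OF g' z v] by (simp add: u_def inv_inv act_inv[OF g y])
    then show ?thesis
      using fun_differential_action[OF g y 0 u] crit u unfolding critical_point_def by simp
  qed
  then show ?thesis using z unfolding critical_point_def by blast
qed

end


theorem proposition2p6:
  fixes Y :: "('y, 'h::{real_inner, complete_space}) mfd"
    and G :: "('g, 'b) monoid_scheme"
    and MG :: "('g, 'e::euclidean_space) mfd"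
    and act :: "'g \<Rightarrow> 'y \<Rightarrow> 'y"
    and S :: "nat \<Rightarrow> 'y set"
    and f :: "'y \<Rightarrow> real"
  assumes "hilbert_manifold Y" and "second_countable (mtop Y)"
    and "lie_group G MG"
    and "C1_action G MG Y act"
    and "\<exists>d. \<forall>y\<in>points Y. dim (orbit_tangent G MG Y act y) = d"
    and "\<And>n. n \<ge> 1 \<Longrightarrow> submanifold Y (S n)"
    and "\<And>n. n \<ge> 1 \<Longrightarrow> transverse_to_orbits G MG Y act (S n)"
    and "\<And>y. y \<in> points Y \<Longrightarrow> \<exists>n\<ge>1. orbit G act y \<inter> S n \<noteq> {}"
    and "smooth_fun Y f"
    and "G_invariant G Y act f"
  shows "G_Morse G MG Y act f \<longleftrightarrow> (\<forall>n\<ge>1. Morse (sub_mfd Y (S n)) f)"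
proof -
  interpret invariant_function Y G MG act f
    using assms by unfold_locales auto
  let ?D = "orbit_tangent G MG Y act" and ?E = "tangent_space Y" and ?H = "hessian Y f"
  let ?N = "\<lambda>n. sub_mfd Y (S n)"
  have S: "z \<in> points Y" if "n \<ge> 1" "z \<in> S n" for n z
    using assms(6)[OF that(1)] that(2) unfolding submanifold_def by blast
  have sum: "is_direct_sum (?E z) (sub_tangent_space Y (S n) z) (?D z)" if "n \<ge> 1" "z \<in> S n" for n z
    using assms(7)[OF that(1)] that(2) unfolding transverse_to_orbits_def by blast
  show ?thesis
  proof
    assume GM: "G_Morse G MG Y act f"
    show "\<forall>n\<ge>1. Morse (?N n) f"
      unfolding Morse_def
    proof (intro allI impI)
      fix n z assume n: "(1::nat) \<le> n" and crit: "critical_point (?N n) f z"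
      then have zS: "z \<in> S n" unfolding critical_point_def sub_mfd_def by simp
      note zY = S[OF n zS] and F = submanifold_tangent_space[OF assms(6)[OF n] zS]
      note E = tangent_space_props(1,2)[OF zY]
      let ?F = "tangent_space (?N n) z"
      obtain L L' where L: "bounded_linear_on ?F L" "bounded_linear_on (?E z) L'"
        "sub_tangent_space Y (S n) z = L ` ?F" "L ` ?F \<subseteq> ?E z" "\<forall>v\<in>?F. L' (L v) = v"
        "\<forall>v\<in>?F. fun_differential (?N n) f z v = fun_differential Y f z (L v)"
        "critical_point Y f z \<and> critical_point (?N n) f z \<longrightarrow>
          (\<forall>u\<in>?F. \<forall>v\<in>?F. hessian (?N n) f z u v = ?H z (L u) (L v))"
        and LF: "subspace (L ` ?F)" "closed (L ` ?F)"
        by (rule submanifold_differential[OF assms(1,9) assms(6)[OF n] zS]) (rule that, assumption+)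
      have sumL: "is_direct_sum (?E z) (L ` ?F) (?D z)" using sum[OF n zS] L(3) by simp
      \<comment> \<open>\<open>v\<close> splits into a part tangent to \<open>S n\<close>, where
        criticality of the restriction applies, and an orbit direction, along which the differential
        of \<open>f\<close> vanishes.\<close>
      have "fun_differential Y f z v = 0" if "v \<in> ?E z" for v
      proof -
        obtain l d where ld: "l \<in> L ` ?F" "d \<in> ?D z" "v = l + d"
          by (rule is_direct_sumE[OF sumL \<open>v \<in> ?E z\<close>])
        then obtain u where ud: "u \<in> ?F" "l = L u" by blast
        have "fun_differential Y f z (L u) = 0" using crit ud(1) L(6) unfolding critical_point_def by auto
        then show ?thesis
          using fun_differential_linear(1)[OF zY, of "L u" d] fun_differential_orbit[OF zY ld(2)]
            orbit_tangent_subset[OF zY ld(2)] L(4) ld(3) ud by auto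
      qed
      then have critY: "critical_point Y f z" using zY unfolding critical_point_def by blast
      then obtain W where W: "closed W" "is_direct_sum (?E z) W (?D z)" "strongly_nondegenerate_on W (?H z)"
        using GM unfolding G_Morse_def G_nondegenerate_def by blast
      obtain B where B: "finite B" "?D z = span B" using orbit_tangent_finite_dim[OF zY] .
      \<comment> \<open>Two transfers: from the given complement \<open>W\<close> to the tangent
        space of \<open>S n\<close> inside \<open>?E z\<close>, then along \<open>L\<close> to the
        model \<open>?F\<close> in which the Hessian of the restriction lives.\<close>
      have nd: "strongly_nondegenerate_on (L ` ?F) (?H z)"
        by (rule strongly_nondegenerate_on_complement[OF W(2) sumL W(1) LF(2) B E(1) hessian_bilinear(1,2)[OF zY] _ _ W(3)])
          (use hessian_orbit[OF zY _ critY] in auto)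
      show "strongly_nondegenerate_on ?F (hessian (?N n) f z)"
        by (rule strongly_nondegenerate_on_pullback[OF LF F L(1) order_refl bounded_linear_on_subset[OF L(2,4)] _ _ _ _ nd])
          (use L(5,7) critY crit in auto)
    qed
  next
    assume M: "\<forall>n\<ge>1. Morse (?N n) f"
    show "G_Morse G MG Y act f"
      unfolding G_Morse_def
    proof (intro allI impI)
      fix y assume crit: "critical_point Y f y"
      then have y: "y \<in> points Y" unfolding critical_point_def by blast
      from assms(8)[OF y] obtain n g where n: "n \<ge> 1" and g: "g \<in> carrier G" and gS: "act g y \<in> S n"
        unfolding orbit_def by blast
      define z where "z = act g y"
      have zS: "z \<in> S n" using gS z_def by simp
      note zY = S[OF n zS] and F = submanifold_tangent_space[OF assms(6)[OF n] zS]
      note Ez = tangent_space_props(1,2)[OF zY] and Ey = tangent_space_props(1,2)[OF y]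
      let ?F = "tangent_space (?N n) z"
      have critz: "critical_point Y f z" using critical_point_action[OF g crit] by (simp add: z_def)
      have g': "inv\<^bsub>G\<^esub> g \<in> carrier G" using g MG_manifold(3) by (rule group.inv_closed[rotated])
      have inv_inv: "inv\<^bsub>G\<^esub> (inv\<^bsub>G\<^esub> g) = g" using g MG_manifold(3) by (rule group.inv_inv[rotated])
      have act_back: "act (inv\<^bsub>G\<^esub> g) z = y" using act_inv[OF g y] z_def by simp
      define T where "T v = action_deriv MG Y act g y (0, v)" for v
      define R where "R v = action_deriv MG Y act (inv\<^bsub>G\<^esub> g) z (0, v)" for v
      have T: "bounded_linear_on (?E y) T" "T ` ?E y \<subseteq> ?E z"
        using action_deriv_Pair_zero[OF g y] by (simp_all add: T_def[abs_def] z_def)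
      have R: "bounded_linear_on (?E z) R" "R ` ?E z \<subseteq> ?E y"
        using action_deriv_Pair_zero[OF g' zY] by (simp_all add: R_def[abs_def] act_back)
      have RT: "R (T v) = v" if "v \<in> ?E y" for v
        using action_deriv_inverse[OF g y that] by (simp add: R_def T_def z_def)
      have TR: "T (R v) = v" if "v \<in> ?E z" for v
        using action_deriv_inverse[OF g' zY that] by (simp add: R_def T_def act_back inv_inv)
      have zero: "0 \<in> tangent_space MG g" using subspace_0[OF tangent_space_props(3)[OF g]] .
      have HT: "?H z (T u) (T v) = ?H y u v" if "u \<in> ?E y" "v \<in> ?E y" for u v
        using hessian_action[OF g y zero that(1) crit _ zero that(2)] critz by (simp add: T_def z_def)
      obtain L L' where L: "bounded_linear_on ?F L" "bounded_linear_on (?E z) L'"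
        "sub_tangent_space Y (S n) z = L ` ?F" "L ` ?F \<subseteq> ?E z" "\<forall>v\<in>?F. L' (L v) = v"
        "\<forall>v\<in>?F. fun_differential (?N n) f z v = fun_differential Y f z (L v)"
        "critical_point Y f z \<and> critical_point (?N n) f z \<longrightarrow>
          (\<forall>u\<in>?F. \<forall>v\<in>?F. hessian (?N n) f z u v = ?H z (L u) (L v))"
        and LF: "subspace (L ` ?F)" "closed (L ` ?F)"
        by (rule submanifold_differential[OF assms(1,9) assms(6)[OF n] zS]) (rule that, assumption+)
      have sumL: "is_direct_sum (?E z) (L ` ?F) (?D z)" using sum[OF n zS] L(3) by simp
      have critN: "critical_point (?N n) f z"
        using critz L(4,6) zS unfolding critical_point_def by (auto simp: sub_mfd_def)
      have ndF: "strongly_nondegenerate_on ?F (hessian (?N n) f z)"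
        using M n critN unfolding Morse_def by blast
      \<comment> \<open>The transfer along \<open>L\<close> runs the other way here, with
        \<open>L'\<close> carrying the image back to \<open>?F\<close>.\<close>
      have ndL: "strongly_nondegenerate_on (L ` ?F) (?H z)"
        by (rule strongly_nondegenerate_on_pullback[OF F LF bounded_linear_on_subset[OF L(2,4)] _ L(1) order_refl _ _ _ ndF])
          (use L(5,7) critz critN in auto)
      have Dz: "?D z \<subseteq> ?E z" and Dy: "?D y \<subseteq> ?E y"
        using orbit_tangent_subset zY y by blast+
      have T_orbit: "T ` ?D y \<subseteq> ?D z"
      proof clarify
        fix d assume d: "d \<in> ?D y"
        then have dE: "d \<in> ?E y" using Dy by blast
        obtain l e where le: "l \<in> L ` ?F" "e \<in> ?D z" "T d = l + e"
          using is_direct_sumE[OF sumL, of "T d"] T(2) dE by blast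
        have lE: "l \<in> ?E z" and eE: "e \<in> ?E z" using le L(4) Dz by blast+
        \<comment> \<open>\<open>T d\<close> pairs to zero with everything at \<open>z\<close>
          because \<open>d\<close> does so at \<open>y\<close>, and \<open>e\<close> is an orbit
          direction at \<open>z\<close>. So \<open>l\<close> pairs to zero with the very space on
          which the form is nondegenerate.\<close>
        have "l = 0"
        proof (rule strongly_nondegenerate_on_imp_zero[OF ndL LF(1) le(1)])
          fix v assume "v \<in> L ` ?F"
          then have v: "v \<in> ?E z" using L(4) by blast
          have "?H z (T d) v = ?H y d (R v)" using HT[OF dE, of "R v"] R(2) v TR[OF v] by auto
          also have "\<dots> = 0" using hessian_orbit[OF y d crit] R(2) v by blast
          finally show "?H z l v = 0"
            using hessian_bilinear(1)[OF zY lE eE v] hessian_orbit[OF zY le(2) critz v] le(3) by simp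
        qed
        then show "T d \<in> ?D z" using le by simp
      qed
      have "inj_on T (?D y)" using RT Dy by (metis inj_onI subsetD)
      moreover have "dim (?D y) = dim (?D z)" using assms(5) y zY by auto
      moreover obtain B where "finite B" "?D y = span B" using orbit_tangent_finite_dim[OF y] .
      moreover obtain B' where "finite B'" "?D z = span B'" using orbit_tangent_finite_dim[OF zY] .
      \<comment> \<open>Equality, not just inclusion, is what later lets every tangent vector at
        \<open>y\<close> be split.\<close>
      ultimately have TD: "T ` ?D y = ?D z"
        using linear_on_image_eq_if_dim_eq[OF T(1) Dy T_orbit] by blast
      let ?W = "R ` L ` ?F"
      have RL: "bounded_linear_on (L ` ?F) R" using bounded_linear_on_subset[OF R(1) L(4)] .
      have WE: "?W \<subseteq> ?E y" using R(2) L(4) by blast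
      have TW: "T ` ?W \<subseteq> L ` ?F" using TR L(4) by (auto simp: image_subset_iff)
      have W: "subspace ?W" "closed ?W"
        using subspace_image_linear_on[OF RL LF(1)]
          closed_image_left_inverse[OF LF(2) Ey(2) WE bounded_linear_on_continuous[OF T(1) Ey(1)]
            bounded_linear_on_continuous[OF RL LF(1)]] TR L(4) by auto
      have "strongly_nondegenerate_on ?W (?H y)"
        by (rule strongly_nondegenerate_on_pullback[OF LF W bounded_linear_on_subset[OF T(1) WE] TW RL order_refl
              RT[OF subsetD[OF WE]] TR[OF subsetD[OF L(4)]] HT[OF subsetD[OF WE] subsetD[OF WE], symmetric] ndL])
      moreover have "is_direct_sum (?E y) ?W (?D y)"
        unfolding is_direct_sum_def
      proof (intro conjI)
        show "subspace ?W" by (rule W)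
        show sD: "subspace (?D y)" using orbit_tangent_finite_dim[OF y] subspace_span by metis
        show "?W \<inter> ?D y = {0}"
        proof
          show "?W \<inter> ?D y \<subseteq> {0}"
          proof
            fix v assume v: "v \<in> ?W \<inter> ?D y"
            then have "T v \<in> L ` ?F \<inter> ?D z" using TW TD by blast
            then have "T v = 0" using sumL unfolding is_direct_sum_def by blast
            moreover have "T 0 = 0" using bounded_linear_onD(5)[OF T(1) Ey(1)] subspace_0[OF Ey(1)] by blast
            ultimately have "v = 0" using RT[of v] RT[of 0] v Dy subspace_0[OF Ey(1)] by auto
            then show "v \<in> {0}" by simp
          qed
          show "{0} \<subseteq> ?W \<inter> ?D y" using subspace_0[OF W(1)] subspace_0[OF sD] by blast
        qed
        show "?E y = {w + d |w d. w \<in> ?W \<and> d \<in> ?D y}"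
        proof
          show "{w + d |w d. w \<in> ?W \<and> d \<in> ?D y} \<subseteq> ?E y" using WE Dy Ey(1) by (auto intro: subspace_add)
          show "?E y \<subseteq> {w + d |w d. w \<in> ?W \<and> d \<in> ?D y}"
          proof
            fix u assume u: "u \<in> ?E y"
            \<comment> \<open>\<open>T u\<close> is split at \<open>z\<close> and both parts are
              pulled back; \<open>R e\<close> lies in \<open>?D y\<close> because \<open>T\<close>
              maps \<open>?D y\<close> onto \<open>?D z\<close>.\<close>
            obtain l e where le: "l \<in> L ` ?F" "e \<in> ?D z" "T u = l + e"
              using is_direct_sumE[OF sumL, of "T u"] T(2) u by blast
            obtain d where d: "d \<in> ?D y" "e = T d" using le(2) TD by blast
            have "l \<in> ?E z" "T d \<in> ?E z" using le d L(4) Dz by blast+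
            then have "u = R l + d"
              using bounded_linear_onD(2)[OF R(1) Ez(1), of l "T d"] RT[OF u] RT[of d] le(3) d Dy by auto
            then show "u \<in> {w + d |w d. w \<in> ?W \<and> d \<in> ?D y}" using le(1) d(1) by blast
          qed
        qed
      qed
      ultimately show "G_nondegenerate G MG Y act f y"
        unfolding G_nondegenerate_def using W(2) by blast
    qed
  qed
qed

end
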